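(* Let $1<p<+\infty$, $\varepsilon_0>0$, $\lambda>0$, and let $a,b\in L^\infty(\mathbb{R}_+\times(0,1))$ be such that $a\ge 0$ and $a\ge\lambda>0$ in $\mathbb{R}_+\times(x_0-\varepsilon_0,x_0+\varepsilon_0)\subset\mathbb{R}_+\times(0,1)$ for some $x_0\in(0,1)$. There exists a positive constant $\alpha$ depending only on $p$, $\|a\|_{L^\infty}$, $\varepsilon_0$, and $\lambda$ such that if $$\|b\|_{L^\infty}\le\alpha,$$ then there exist constants $C,\gamma>0$ depending only on $p$, $\|a\|_{L^\infty}$, $\varepsilon_0$, and $\lambda$ such that, for all $\rho_0,\xi_0\in L^p(0,1)$ with $\int_0^1(\rho_0+\xi_0)\,dx=0$, the (broad) solution $(\rho,\xi)$ of $$\begin{cases}\rho_t-\rho_x=-\tfrac12 a(\rho-\xi)-b(\rho-\xi) & \text{in }\mathbb{R}_+\times(0,1),\\ \xi_t+\xi_x=\tfrac12 a(\rho-\xi)+b(\rho-\xi) & \text{in }\mathbb{R}_+\times(0,1),\\ \rho(t,0)-\xi(t,0)=\rho(t,1)-\xi(t,1)=0 & \text{in }\mathbb{R}_+,\end{cases}$$ with initial condition $\rho(0,\cdot)=\rho_0$, $\xi(0,\cdot)=\xi_0$, satisfies $$\|(\rho,\xi)(t,\cdot)\|_{L^p(0,1)}\le C e^{-\gamma t}\,\|(\rho_0,\xi_0)\|_{L^p(0,1)},\qquad t\ge 0.$$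
   Context: $\mathbb{R}_+=(0,+\infty)$; $\|\cdot\|_{L^\infty}$ is the norm of $L^\infty(\mathbb{R}_+\times(0,1))$; $\|(f,g)\|_{L^p(0,1)}^p=\int_0^1(|f|^p+|g|^p)\,dx$. Broad solution: for $T>0$, a broad solution on $(0,T)$ of the system is a pair $(\rho,\xi)\in C([0,T];[L^p(0,1)]^2)\cap C([0,1];[L^p(0,T)]^2)$ that obeys the characteristic rules, i.e. with $F=-(\tfrac12a+b)(\rho-\xi)$ and $G=(\tfrac12a+b)(\rho-\xi)$, for a.e. $(t,x)\in(0,T)\times(0,1)$: $\rho(t,x)=\rho_0(x+t)+\int_0^tF(s,x+t-s)\,ds$ if $x+t<1$, and $\rho(t,x)=\rho(t+x-1,1)+\int_{t+x-1}^tF(s,x+t-s)\,ds$ if $x+t>1$; $\xi(t,x)=\xi_0(x-t)+\int_0^tG(s,x-t+s)\,ds$ if $x>t$, and $\xi(t,x)=\xi(t-x,0)+\int_{t-x}^tG(s,x-t+s)\,ds$ if $x<t$; and the boundary conditions $\rho(\cdot,0)=\xi(\cdot,0)$, $\rho(\cdot,1)=\xi(\cdot,1)$ hold a.e. in $(0,T)$. A solution on $\mathbb{R}_+$ is one whose restriction to $(0,T)$ is a broad solution for every $T>0$. *)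

theory Defs
  imports "HOL-Analysis.Analysis" "HOL-Probability.Essential_Supremum"
begin

text \<open>
  Elements of \<open>L\<^sup>p\<close> and \<open>L\<^sup>\<infinity>\<close> are represented by Lebesgue measurable functions, considered
  only almost everywhere on the set in question.  Functions on the \<open>(t,x)\<close>-plane take a pair.
\<close>

definition Lp_mem :: "real \<Rightarrow> real set \<Rightarrow> (real \<Rightarrow> real) \<Rightarrow> bool" where
  "Lp_mem p S f \<longleftrightarrow>
     f \<in> borel_measurable (lebesgue_on S) \<and> integrable (lebesgue_on S) (\<lambda>x. \<bar>f x\<bar> powr p)"

definition Lp_norm2 :: "real \<Rightarrow> real set \<Rightarrow> (real \<Rightarrow> real) \<Rightarrow> (real \<Rightarrow> real) \<Rightarrow> real" where
  "Lp_norm2 p S f g = (LINT x|lebesgue_on S. \<bar>f x\<bar> powr p + \<bar>g x\<bar> powr p) powr (1 / p)"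

definition strip :: "(real \<times> real) set" where
  "strip = {0<..} \<times> {0<..<1}"

definition Linf_mem :: "(real \<times> real) set \<Rightarrow> (real \<times> real \<Rightarrow> real) \<Rightarrow> bool" where
  "Linf_mem S f \<longleftrightarrow>
     f \<in> borel_measurable (lebesgue_on S) \<and> esssup (lebesgue_on S) (\<lambda>z. ereal \<bar>f z\<bar>) < \<infinity>"

definition Linf_norm :: "(real \<times> real) set \<Rightarrow> (real \<times> real \<Rightarrow> real) \<Rightarrow> real" where
  "Linf_norm S f = real_of_ereal (esssup (lebesgue_on S) (\<lambda>z. ereal \<bar>f z\<bar>))"

text \<open>
  Membership of the pair \<open>(\<rho>, \<xi>)\<close> in \<open>C([0,T]; [L\<^sup>p(0,1)]\<^sup>2) \<inter> C([0,1]; [L\<^sup>p(0,T)]\<^sup>2)\<close>.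
  A pair in this intersection has one representative for each of the two spaces, and these agree
  almost everywhere.  They can be merged into a single jointly measurable function: off the null
  set of times at which the two differ as functions of \<open>x\<close>, take the second one; on it, take the
  first.  So one function serves for both the time slices \<open>\<rho>(t,\<cdot>)\<close>, \<open>0 \<le> t \<le> T\<close>, and the traces
  \<open>\<rho>(\<cdot>,x)\<close>, \<open>0 \<le> x \<le> 1\<close>.
\<close>

definition broad_space ::
  "real \<Rightarrow> real \<Rightarrow> (real \<times> real \<Rightarrow> real) \<Rightarrow> (real \<times> real \<Rightarrow> real) \<Rightarrow> bool" where
  "broad_space p T \<rho> \<xi> \<longleftrightarrow>
     \<rho> \<in> borel_measurable (lebesgue_on ({0<..<T} \<times> {0<..<1})) \<and>
     \<xi> \<in> borel_measurable (lebesgue_on ({0<..<T} \<times> {0<..<1})) \<and>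
     (\<forall>t\<in>{0..T}.
        Lp_mem p {0<..<1} (\<lambda>x. \<rho> (t, x)) \<and> Lp_mem p {0<..<1} (\<lambda>x. \<xi> (t, x)) \<and>
        ((\<lambda>s. Lp_norm2 p {0<..<1} (\<lambda>x. \<rho> (s, x) - \<rho> (t, x)) (\<lambda>x. \<xi> (s, x) - \<xi> (t, x)))
           \<longlongrightarrow> 0) (at t within {0..T})) \<and>
     (\<forall>x\<in>{0..1}.
        Lp_mem p {0<..<T} (\<lambda>t. \<rho> (t, x)) \<and> Lp_mem p {0<..<T} (\<lambda>t. \<xi> (t, x)) \<and>
        ((\<lambda>y. Lp_norm2 p {0<..<T} (\<lambda>t. \<rho> (t, y) - \<rho> (t, x)) (\<lambda>t. \<xi> (t, y) - \<xi> (t, x)))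
           \<longlongrightarrow> 0) (at x within {0..1}))"

text \<open>
  The integrals below are over Lebesgue (not just Borel) measurable sections; for almost every
  \<open>(t,x)\<close> the integrand is measurable and integrable along the characteristic.
\<close>

definition broad_solution_on ::
  "real \<Rightarrow> real \<Rightarrow> (real \<times> real \<Rightarrow> real) \<Rightarrow> (real \<times> real \<Rightarrow> real) \<Rightarrow>
   (real \<Rightarrow> real) \<Rightarrow> (real \<Rightarrow> real) \<Rightarrow> (real \<times> real \<Rightarrow> real) \<Rightarrow> (real \<times> real \<Rightarrow> real) \<Rightarrow> bool" where
  "broad_solution_on p T a b \<rho>\<^sub>0 \<xi>\<^sub>0 \<rho> \<xi> \<longleftrightarrow>
     broad_space p T \<rho> \<xi> \<and>
     (let F = (\<lambda>z. - ((1/2) * a z + b z) * (\<rho> z - \<xi> z));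
          G = (\<lambda>z. ((1/2) * a z + b z) * (\<rho> z - \<xi> z))
      in AE (t, x) in lebesgue_on ({0<..<T} \<times> {0<..<1}).
           (x + t < 1 \<longrightarrow>
              \<rho> (t, x) = \<rho>\<^sub>0 (x + t) + (LINT s|lebesgue_on {0..t}. F (s, x + t - s))) \<and>
           (x + t > 1 \<longrightarrow>
              \<rho> (t, x) = \<rho> (t + x - 1, 1) + (LINT s|lebesgue_on {t + x - 1..t}. F (s, x + t - s))) \<and>
           (x > t \<longrightarrow>
              \<xi> (t, x) = \<xi>\<^sub>0 (x - t) + (LINT s|lebesgue_on {0..t}. G (s, x - t + s))) \<and>
           (x < t \<longrightarrow>
              \<xi> (t, x) = \<xi> (t - x, 0) + (LINT s|lebesgue_on {t - x..t}. G (s, x - t + s)))) \<and>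
     (AE t in lebesgue_on {0<..<T}. \<rho> (t, 0) = \<xi> (t, 0) \<and> \<rho> (t, 1) = \<xi> (t, 1))"

definition broad_solution ::
  "real \<Rightarrow> (real \<times> real \<Rightarrow> real) \<Rightarrow> (real \<times> real \<Rightarrow> real) \<Rightarrow>
   (real \<Rightarrow> real) \<Rightarrow> (real \<Rightarrow> real) \<Rightarrow> (real \<times> real \<Rightarrow> real) \<Rightarrow> (real \<times> real \<Rightarrow> real) \<Rightarrow> bool" where
  "broad_solution p a b \<rho>\<^sub>0 \<xi>\<^sub>0 \<rho> \<xi> \<longleftrightarrow> (\<forall>T>0. broad_solution_on p T a b \<rho>\<^sub>0 \<xi>\<^sub>0 \<rho> \<xi>)"

end

theory Submission
  imports Defs
begin

text \<open>
  Reflection at the boundary joins the two families of characteristics into one. Place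
  \<open>\<xi>(t,x)\<close> at the point \<open>y = x\<close> and \<open>\<rho>(t,x)\<close> at
  the point \<open>y = - x\<close> of the circle \<open>\<real> / 2\<int>\<close>, and call the
  resulting function \<open>w\<close>. The boundary conditions say that \<open>w\<close> is
  carried across \<open>0\<close> and \<open>1\<close> without a jump, and the system becomes
  \<open>w\<^sub>t + w\<^sub>y = k(t,y) (w(t,-y) - w(t,y))\<close> with the even coefficient
  \<open>k(t,y) = a(t,\<bar>y\<bar>)/2 + b(t,\<bar>y\<bar>)\<close>: everything moves at unit
  speed, and each point exchanges with its mirror image at rate \<open>k\<close>. In the
  coordinate \<open>z = y - t\<close>, which is constant along characteristics, \<open>v(t,z) =
  w(t,z+t)\<close> satisfies \<open>v\<^sub>t(t,z) = k(t,z+t) (v(t,-z-2t) - v(t,z))\<close>, an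
  ordinary differential equation in time.

  The map \<open>z \<mapsto> - z - 2 t\<close> preserves the measure of the circle. Hence the mean
  of \<open>v\<close> is conserved, so it is always \<open>0\<close>, and \<open>E(t) =
  \<integral>\<bar>v(t,z)\<bar>\<^sup>p dz\<close>, which is the \<open>p\<close>-th power of the
  norm of \<open>(\<rho>,\<xi>)(t,\<cdot>)\<close>, decreases at the rate \<open>(p/2)
  \<integral>k (v\<^sup>* - v) (\<phi>(v\<^sup>*) - \<phi>(v)) dz\<close>, where
  \<open>v\<^sup>*(t,z) = v(t,-z-2t)\<close> and \<open>\<phi>\<close> is the derivative of
  \<open>\<bar>\<cdot>\<bar>\<^sup>p\<close> divided by \<open>p\<close>; the part of
  \<open>k\<close> that comes from \<open>b\<close> has no sign, but contributes at most a
  multiple of \<open>\<parallel>b\<parallel> E\<close> (\<open>energy_dissipation\<close>).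

  Suppose that \<open>E\<close> loses little between the times \<open>t\<close> and \<open>t +
  2\<close>, that is, during one turn of the circle. Then \<open>v\<close> and
  \<open>v\<^sup>*\<close> are close wherever \<open>k\<close> is not small, and since
  \<open>v\<^sub>t\<close> is \<open>k\<close> times their difference, \<open>v\<close> is nearly
  constant in time. So \<open>f = v(t,\<cdot>)\<close> nearly satisfies \<open>f(z) =
  f(-z-2s)\<close> whenever \<open>y = z + s\<close> lies in the window \<open>(x\<^sub>0 -
  \<epsilon>\<^sub>0, x\<^sub>0 + \<epsilon>\<^sub>0)\<close>. With \<open>r = - y - s\<close>
  this reads \<open>f(r + 2 y) = f(r)\<close>: the function is nearly invariant under the
  translations by \<open>2 y\<close>. Composing one of them with the inverse of another gives all
  short translations, and iterating these gives all translations. So \<open>f\<close> is close to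
  its mean \<open>0\<close>. Quantitatively, \<open>E(t)\<close> is at most a constant times
  \<open>E(t) - E(t+2)\<close> (\<open>energy_le_gaps\<close>,
  \<open>exchange_contraction\<close>), so \<open>E\<close> shrinks by a fixed factor in each
  period. The constant involves only \<open>p\<close>, the bound on \<open>a\<close>,
  \<open>\<epsilon>\<^sub>0\<close> and the lower bound \<open>lam\<close>.

  It remains to derive the equation for \<open>v\<close> from the definition of a broad solution.
  Continuity of the traces in \<open>x\<close> identifies the trace on the side where a
  characteristic leaves the strip with the value that the characteristic carries there
  (\<open>outflow_eq_along\<close>). By the boundary condition this is the value with which the
  reflected characteristic enters, so the rules for successive crossings of the strip chain up
  (\<open>AE_match\<close>, \<open>solution_eq_v\<close>). All this holds for almost every time,
  and continuity in time gives the estimate for every time.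
\<close>

section \<open>Inequalities for \<open>p\<close>-th powers\<close>

text \<open>
  For \<open>q = p - 1\<close> this is the derivative of \<open>\<bar>x\<bar>\<^sup>p\<close>
  divided by \<open>p\<close>.
\<close>

definition signed_powr :: "real \<Rightarrow> real \<Rightarrow> real" where
  "signed_powr q x = sgn x * \<bar>x\<bar> powr q"

lemma signed_powr_minus: "signed_powr q (- x) = - signed_powr q x"
  by (simp add: signed_powr_def sgn_minus)

lemma abs_signed_powr: "\<bar>signed_powr q x\<bar> = (if x = 0 then 0 else \<bar>x\<bar> powr q)"
  by (simp add: signed_powr_def abs_mult abs_sgn_eq)

lemma abs_signed_powr_le: "\<bar>signed_powr q x\<bar> \<le> \<bar>x\<bar> powr q"
  by (simp add: abs_signed_powr)

lemma signed_powr_measurable [measurable]: "signed_powr q \<in> borel_measurable borel"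
  unfolding signed_powr_def[abs_def] by measurable

lemma signed_powr_mult_self:
  assumes "1 < p" shows "signed_powr (p - 1) x * x = \<bar>x\<bar> powr p"
proof (cases "x = 0")
  case False
  have "signed_powr (p - 1) x * x = \<bar>x\<bar> * \<bar>x\<bar> powr (p - 1)"
    by (simp add: signed_powr_def sgn_if)
  also have "\<dots> = \<bar>x\<bar> powr p" using powr_mult_base[of "\<bar>x\<bar>" "p - 1"] by simp
  finally show ?thesis .
qed (use assms in \<open>simp add: signed_powr_def\<close>)

lemma signed_powr_mono:
  assumes "0 < q" "x \<le> y" shows "signed_powr q x \<le> signed_powr q y"
proof -
  consider "0 \<le> x" | "x < 0" "0 \<le> y" | "y < 0" by linarith
  then show ?thesis
  proof cases
    case 1
    then have "\<bar>x\<bar> powr q \<le> \<bar>y\<bar> powr q" using assms by (intro powr_mono2) auto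
    with 1 assms show ?thesis by (auto simp: signed_powr_def sgn_if)
  next
    case 2
    then show ?thesis by (auto simp: signed_powr_def sgn_if intro: order_trans[of _ 0])
  next
    case 3
    then have "\<bar>y\<bar> powr q \<le> \<bar>x\<bar> powr q" using assms by (intro powr_mono2) auto
    with 3 assms show ?thesis by (auto simp: signed_powr_def sgn_if)
  qed
qed

lemma isCont_signed_powr:
  assumes "0 < q" shows "isCont (signed_powr q) x"
proof (cases "x = 0")
  case True
  have "(signed_powr q \<longlongrightarrow> 0) (at 0)"
  proof (rule Lim_null_comparison)
    show "\<forall>\<^sub>F x in at 0. norm (signed_powr q x) \<le> \<bar>x\<bar> powr q"
      using abs_signed_powr_le by simp
    have "((\<lambda>x::real. \<bar>x\<bar> powr q) \<longlongrightarrow> \<bar>0\<bar> powr q) (at 0)"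
      using assms by (intro tendsto_powr' tendsto_intros) auto
    then show "((\<lambda>x::real. \<bar>x\<bar> powr q) \<longlongrightarrow> 0) (at 0)" by simp
  qed
  then show ?thesis using True by (simp add: isCont_def signed_powr_def)
next
  case False
  then show ?thesis unfolding signed_powr_def[abs_def] by (intro continuous_intros) auto
qed

lemma abs_le_one_plus_powr:
  fixes p y :: real
  assumes "1 \<le> p" shows "\<bar>y\<bar> \<le> 1 + \<bar>y\<bar> powr p"
proof (cases "\<bar>y\<bar> \<le> 1")
  case False
  then have "\<bar>y\<bar> powr 1 \<le> \<bar>y\<bar> powr p" using assms by (intro powr_mono) auto
  then show ?thesis using False by simp
qed (simp add: add_increasing2)

lemma powr_weighted_product_le:
  fixes p x y :: real
  assumes "1 < p" "0 \<le> x" "0 \<le> y"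
  shows "p * (x powr (p - 1) * y) \<le> (p - 1) * x powr p + y powr p"
proof -
  have "(x powr (p - 1)) * y \<le> (x powr (p - 1)) powr (p / (p - 1)) / (p / (p - 1)) + y powr p / p"
    using assms by (intro Youngs_inequality) (auto simp: field_simps)
  also have "(x powr (p - 1)) powr (p / (p - 1)) = x powr p"
    using assms by (simp add: powr_powr)
  finally have "x powr (p - 1) * y \<le> x powr p * (p - 1) / p + y powr p / p" by simp
  then have "p * (x powr (p - 1) * y) \<le> p * (x powr p * (p - 1) / p + y powr p / p)"
    using assms by (intro mult_left_mono) auto
  also have "\<dots> = (p - 1) * x powr p + y powr p" using assms by (simp add: distrib_left)
  finally show ?thesis .
qed

text \<open>
  This is the convexity of \<open>\<bar>\<cdot>\<bar>\<^sup>p\<close>. It follows from Young's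
  inequality with the exponents \<open>p\<close> and \<open>p / (p - 1)\<close>.
\<close>

lemma abs_powr_above_tangent:
  assumes "1 < p"
  shows "\<bar>x\<bar> powr p - \<bar>y\<bar> powr p \<le> p * (signed_powr (p - 1) x * (x - y))"
proof -
  have "signed_powr (p - 1) x * y \<le> \<bar>signed_powr (p - 1) x\<bar> * \<bar>y\<bar>"
    by (metis abs_ge_self abs_mult)
  also have "\<dots> \<le> \<bar>x\<bar> powr (p - 1) * \<bar>y\<bar>"
    by (intro mult_right_mono abs_signed_powr_le) auto
  finally have "p * (signed_powr (p - 1) x * y) \<le> p * (\<bar>x\<bar> powr (p - 1) * \<bar>y\<bar>)"
    using assms by simp
  also have "\<dots> \<le> (p - 1) * \<bar>x\<bar> powr p + \<bar>y\<bar> powr p"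
    using assms by (intro powr_weighted_product_le) auto
  finally show ?thesis
    using signed_powr_mult_self[OF assms, of x] by (simp add: algebra_simps)
qed

lemma abs_add_powr_le:
  assumes "0 < p" shows "\<bar>x + y\<bar> powr p \<le> 2 powr p * (\<bar>x\<bar> powr p + \<bar>y\<bar> powr (p::real))"
proof -
  define m where "m = max \<bar>x\<bar> \<bar>y\<bar>"
  have "\<bar>x + y\<bar> powr p \<le> (2 * m) powr p"
    using assms by (intro powr_mono2) (auto simp: m_def)
  also have "\<dots> = 2 powr p * m powr p" by (simp add: powr_mult m_def)
  also have "m powr p \<le> \<bar>x\<bar> powr p + \<bar>y\<bar> powr p" by (auto simp: m_def max_def)
  finally show ?thesis by simp
qed

lemma abs_sum_powr_le:
  assumes "0 < p"
  shows "\<bar>\<Sum>i<n. f i\<bar> powr p \<le> real n powr p * (\<Sum>i<n. \<bar>f i\<bar> powr p)"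
proof (cases "n = 0")
  case False
  define m where "m = Max ((\<lambda>i. \<bar>f i\<bar>) ` {..<n})"
  have m: "\<bar>f i\<bar> \<le> m" if "i < n" for i using that by (auto simp: m_def)
  have "m \<in> (\<lambda>i. \<bar>f i\<bar>) ` {..<n}" unfolding m_def using False by (intro Max_in) auto
  then obtain j where j: "j < n" "m = \<bar>f j\<bar>" by auto
  have "\<bar>\<Sum>i<n. f i\<bar> \<le> (\<Sum>i<n. \<bar>f i\<bar>)" by (rule sum_abs)
  also have "\<dots> \<le> (\<Sum>i<n. m)" by (intro sum_mono) (use m in auto)
  finally have "\<bar>\<Sum>i<n. f i\<bar> \<le> real n * m" by simp
  then have "\<bar>\<Sum>i<n. f i\<bar> powr p \<le> (real n * m) powr p" using assms by (intro powr_mono2) auto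
  also have "\<dots> = real n powr p * m powr p" using j by (simp add: powr_mult)
  also have "m powr p \<le> (\<Sum>i<n. \<bar>f i\<bar> powr p)"
    using j by (auto intro!: member_le_sum)
  finally show ?thesis by (simp add: mult_left_mono)
qed simp

text \<open>
  If \<open>x - y\<close> is at most \<open>h x\<close>, the first summand on the right is enough.
  Otherwise \<open>y \<le> (1 - h) x\<close>, and monotonicity of the signed power bounds the
  product in the second summand below by a multiple of \<open>x\<^sup>p\<close>.
\<close>

lemma powr_dissipation_bound_ordered:
  assumes "1 < p" "0 < h" "h < 1" "\<bar>y\<bar> \<le> x" 
  shows "\<bar>x - y\<bar> powr p \<le> h powr p * x powr p +
     2 powr p / (h * (1 - (1 - h) powr (p - 1))) * ((x - y) * (signed_powr (p - 1) x - signed_powr (p - 1) y))"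
proof (cases "x - y \<le> h * x")
  case True
  have "(1 - h) powr (p - 1) < 1" using assms powr_less_mono2[of "p - 1" "1 - h" 1] by simp
  moreover have "signed_powr (p - 1) y \<le> signed_powr (p - 1) x" using assms by (intro signed_powr_mono) auto
  moreover have "\<bar>x - y\<bar> powr p \<le> (h * x) powr p" using True assms by (intro powr_mono2) auto
  moreover have "(h * x) powr p = h powr p * x powr p" using assms by (simp add: powr_mult)
  moreover have "0 \<le> 2 powr p / (h * (1 - (1 - h) powr (p - 1)))" using calculation(1) assms by simp
  ultimately show ?thesis using assms
    by (smt (verit, ccfv_SIG) mult_nonneg_nonneg)
next
  case False
  moreover have "x \<noteq> 0" using False assms by auto
  ultimately have x: "0 < x" "y \<le> (1 - h) * x" using assms by (auto simp: algebra_simps)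
  define d where "d = h * (1 - (1 - h) powr (p - 1))"
  have lt1: "(1 - h) powr (p - 1) < 1" using assms powr_less_mono2[of "p - 1" "1 - h" 1] by simp
  then have d: "0 < d" using assms by (simp add: d_def)
  have s: "signed_powr (p - 1) x = x powr (p - 1)" using x by (simp add: signed_powr_def)
  have "signed_powr (p - 1) y \<le> signed_powr (p - 1) ((1 - h) * x)"
    using x assms by (intro signed_powr_mono) auto
  also have "\<dots> = (1 - h) powr (p - 1) * x powr (p - 1)"
    using x assms by (simp add: signed_powr_def sgn_mult powr_mult abs_mult)
  finally have "(1 - (1 - h) powr (p - 1)) * x powr (p - 1) \<le> signed_powr (p - 1) x - signed_powr (p - 1) y"
    using s by (simp add: algebra_simps)
  moreover have "h * x \<le> x - y" using False by simp
  moreover have "0 \<le> (1 - (1 - h) powr (p - 1)) * x powr (p - 1)" using lt1 by simp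
  ultimately have "(h * x) * ((1 - (1 - h) powr (p - 1)) * x powr (p - 1)) \<le>
      (x - y) * (signed_powr (p - 1) x - signed_powr (p - 1) y)"
    using x assms by (intro mult_mono) auto
  moreover have e: "x * x powr (p - 1) = x powr p" using x powr_mult_base[of x "p - 1"] by simp
  have "(h * x) * ((1 - (1 - h) powr (p - 1)) * x powr (p - 1)) = d * x powr p"
    by (simp add: d_def flip: e)
  ultimately have "d * x powr p \<le> (x - y) * (signed_powr (p - 1) x - signed_powr (p - 1) y)"
    by simp
  then have "x powr p \<le> (x - y) * (signed_powr (p - 1) x - signed_powr (p - 1) y) / d"
    using d by (simp add: field_simps)
  moreover have "\<bar>x - y\<bar> powr p \<le> (2 * x) powr p" using assms by (intro powr_mono2) auto
  moreover have "(2 * x) powr p = 2 powr p * x powr p" using x by (simp add: powr_mult)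
  ultimately have "\<bar>x - y\<bar> powr p \<le> 2 powr p * ((x - y) * (signed_powr (p - 1) x - signed_powr (p - 1) y) / d)"
    by (smt (verit) mult_left_mono powr_ge_zero)
  then show ?thesis by (simp add: d_def add_increasing)
qed

text \<open>
  The dissipation controls \<open>\<bar>x - y\<bar>\<^sup>p\<close> directly only for \<open>p
  \<ge> 2\<close>: for \<open>p < 2\<close> and \<open>x\<close> close to \<open>y\<close> it is
  of the smaller order \<open>(x - y)\<^sup>2\<close>. An additional term with an arbitrarily
  small factor \<open>\<eta>\<close> makes up for this, and then all \<open>p > 1\<close> can be
  treated alike.
\<close>

lemma abs_diff_powr_le_dissipation:
  fixes p \<eta> :: real
  assumes "1 < p" "0 < \<eta>"
  shows "\<exists>C>0. \<forall>x y. \<bar>x - y\<bar> powr p \<le>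
     \<eta> * (\<bar>x\<bar> powr p + \<bar>y\<bar> powr p) + C * ((x - y) * (signed_powr (p - 1) x - signed_powr (p - 1) y))"
proof -
  define h where "h = min (1 / 2) (\<eta> powr (1 / p))"
  have h: "0 < h" "h < 1" using assms by (auto simp: h_def)
  have "h powr p \<le> (\<eta> powr (1 / p)) powr p" using h assms by (intro powr_mono2) (auto simp: h_def)
  then have hp: "h powr p \<le> \<eta>" using assms by (simp add: powr_powr)
  define C where "C = 2 powr p / (h * (1 - (1 - h) powr (p - 1)))"
  have "(1 - h) powr (p - 1) < 1" using assms h powr_less_mono2[of "p - 1" "1 - h" 1] by simp
  then have C: "0 < C" using h by (simp add: C_def)
  define R where "R x y \<longleftrightarrow> \<bar>x - y\<bar> powr p \<le>
     \<eta> * (\<bar>x\<bar> powr p + \<bar>y\<bar> powr p) + C * ((x - y) * (signed_powr (p - 1) x - signed_powr (p - 1) y))" for x y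
  have R0: "R x y" if "\<bar>y\<bar> \<le> x" for x y
  proof -
    have "h powr p * x powr p \<le> \<eta> * x powr p" by (intro mult_right_mono hp) auto
    also have "\<dots> \<le> \<eta> * (\<bar>x\<bar> powr p + \<bar>y\<bar> powr p)" using that assms by (intro mult_left_mono) auto
    finally show ?thesis
      using powr_dissipation_bound_ordered[OF assms(1) h that] unfolding R_def C_def by linarith
  qed
  have R1: "R x y" if "\<bar>y\<bar> \<le> \<bar>x\<bar>" for x y
  proof (cases "0 \<le> x")
    case False
    with R0[of "-y" "-x"] that have "R (-x) (-y)" by simp
    then show ?thesis by (simp add: R_def signed_powr_minus abs_minus_commute algebra_simps)
  qed (use that R0 in auto)
  have "R x y" for x y
  proof (cases "\<bar>y\<bar> \<le> \<bar>x\<bar>")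
    case False
    then have "R y x" by (intro R1) auto
    then show ?thesis by (simp add: R_def abs_minus_commute algebra_simps)
  qed (rule R1)
  with C show ?thesis unfolding R_def by blast
qed

lemma (in finite_measure) integrable_of_abs_powr:
  fixes f :: "'a \<Rightarrow> real"
  assumes "1 \<le> p" "f \<in> borel_measurable M" "integrable M (\<lambda>x. \<bar>f x\<bar> powr p)"
  shows "integrable M f"
proof (rule Bochner_Integration.integrable_bound)
  show "integrable M (\<lambda>x. 1 + \<bar>f x\<bar> powr p)" using assms by auto
  have "\<bar>y\<bar> \<le> 1 + \<bar>y\<bar> powr p" for y :: real by (rule abs_le_one_plus_powr[OF assms(1)])
  then show "AE x in M. norm (f x) \<le> norm (1 + \<bar>f x\<bar> powr p)" by (simp add: abs_of_nonneg)
qed (use assms in auto)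

text \<open>
  Jensen's inequality: integrate the tangent inequality at the average of \<open>f\<close>.
\<close>

lemma (in finite_measure) abs_integral_powr_le:
  fixes f :: "'a \<Rightarrow> real"
  assumes p: "1 < p" and f: "f \<in> borel_measurable M" "integrable M (\<lambda>x. \<bar>f x\<bar> powr p)"
  shows "\<bar>integral\<^sup>L M f\<bar> powr p \<le> measure M (space M) powr (p - 1) * (\<integral>x. \<bar>f x\<bar> powr p \<partial>M)"
proof (cases "measure M (space M) = 0")
  case True
  then have "space M \<in> null_sets M" by (simp add: null_sets_def emeasure_eq_measure)
  then have "AE x in M. f x = 0" by (rule AE_I') auto
  then have "integral\<^sup>L M f = 0" using integral_eq_zero_AE by blast
  then show ?thesis by simp
next
  case False
  define m where "m = measure M (space M)"
  have m: "0 < m" using False by (simp add: m_def zero_less_measure_iff)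
  define c where "c = integral\<^sup>L M f / m"
  have i: "integrable M f" using integrable_of_abs_powr[OF _ f] p by simp
  have "(\<integral>x. \<bar>c\<bar> powr p - \<bar>f x\<bar> powr p \<partial>M) \<le> (\<integral>x. p * (signed_powr (p - 1) c * (c - f x)) \<partial>M)"
    using i f p by (intro integral_mono abs_powr_above_tangent) auto
  also have "\<dots> = p * (signed_powr (p - 1) c * (m * c - integral\<^sup>L M f))"
    using i by (simp add: m_def)
  also have "\<dots> = 0" using m by (simp add: c_def)
  finally have "m * \<bar>c\<bar> powr p \<le> (\<integral>x. \<bar>f x\<bar> powr p \<partial>M)" using f by (simp add: m_def)
  then have "m powr (p - 1) * (m * \<bar>c\<bar> powr p) \<le> m powr (p - 1) * (\<integral>x. \<bar>f x\<bar> powr p \<partial>M)"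
    by (intro mult_left_mono) auto
  moreover have "m powr (p - 1) * (m * \<bar>c\<bar> powr p) = (m * m powr (p - 1)) * \<bar>c\<bar> powr p" by simp
  also have "\<dots> = m powr p * \<bar>c\<bar> powr p" using m powr_mult_base[of m "p - 1"] by simp
  also have "\<dots> = \<bar>m * c\<bar> powr p" using m by (simp add: abs_mult powr_mult)
  also have "m * c = integral\<^sup>L M f" using m by (simp add: c_def)
  ultimately show ?thesis by (simp add: m_def)
qed

lemma set_integral_Icc_same:
  fixes f :: "real \<Rightarrow> real"
  shows "(LINT s:{a..a}|lborel. f s) = 0"
  unfolding set_lebesgue_integral_def
  by (rule integral_eq_zero_AE) (use AE_lborel_singleton[of a] in eventually_elim, simp)

lemma set_integral_Icc_append:
  fixes g :: "real \<Rightarrow> real"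
  assumes "set_integrable lborel {a..b} g" "a \<le> s" "s \<le> t" "t \<le> b"
  shows "(LINT r:{a..t}|lborel. g r) = (LINT r:{a..s}|lborel. g r) + (LINT r:{s<..t}|lborel. g r)"
proof -
  have "{a..t} = {a..s} \<union> {s<..t}" using assms by auto
  then show ?thesis
    using assms by (auto intro!: set_integral_Un set_integrable_subset[OF assms(1)])
qed

lemma continuous_on_indefinite_set_integral:
  fixes g :: "real \<Rightarrow> real"
  assumes "set_integrable lborel {a..b} g"
  shows "continuous_on {a..b} (\<lambda>t. LINT s:{a..t}|lborel. g s)"
proof -
  have "continuous_on {a..b} (\<lambda>t. integral {a..t} g)"
    by (rule indefinite_integral_continuous_1[OF set_borel_integral_eq_integral(1)[OF assms]])
  then show ?thesis
  proof (rule continuous_on_eq)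
    fix t assume t: "t \<in> {a..b}"
    have "set_integrable lborel {a..t} g" by (rule set_integrable_subset[OF assms]) (use t in auto)
    then show "integral {a..t} g = (LINT s:{a..t}|lborel. g s)"
      by (rule set_borel_integral_eq_integral(2)[symmetric])
  qed
qed

text \<open>
  A chain rule for \<open>\<bar>V\<bar>\<^sup>p\<close> with \<open>V\<close> absolutely
  continuous, as an inequality. Over each interval of a partition, convexity bounds the increment
  of \<open>\<bar>V\<bar>\<^sup>p\<close> by the slope at the right end point times the increment
  of \<open>V\<close>. Refining the partition gives the integral, by dominated convergence.
\<close>

lemma abs_powr_indefinite_integral_le:
  fixes g V :: "real \<Rightarrow> real"
  assumes p: "1 < p" and ab: "a \<le> b" and g: "set_integrable lborel {a..b} g"
    and V: "\<And>t. t \<in> {a..b} \<Longrightarrow> V t = V a + (LINT s:{a..t}|lborel. g s)"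
  shows "set_integrable lborel {a..b} (\<lambda>s. signed_powr (p - 1) (V s) * g s)"
    and "\<bar>V b\<bar> powr p \<le> \<bar>V a\<bar> powr p + p * (LINT s:{a..b}|lborel. signed_powr (p - 1) (V s) * g s)"
proof -
  define \<phi> where "\<phi> t = signed_powr (p - 1) (V (max a (min b t)))" for t
  have cV: "continuous_on {a..b} V"
    by (rule continuous_on_eq[of _ "\<lambda>t. V a + (LINT s:{a..t}|lborel. g s)"])
       (intro continuous_intros continuous_on_indefinite_set_integral g, metis V)
  have cs: "continuous_on UNIV (signed_powr (p - 1))"
    using isCont_signed_powr[of "p - 1"] p by (simp add: continuous_on_eq_continuous_at)
  have c1: "continuous_on UNIV (\<lambda>t. V (max a (min b t)))"
    by (rule continuous_on_compose2[OF cV]) (use ab in \<open>auto intro!: continuous_intros\<close>)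
  have c\<phi>: "continuous_on UNIV \<phi>"
    unfolding \<phi>_def by (rule continuous_on_compose2[OF cs c1]) auto
  have m\<phi> [measurable]: "\<phi> \<in> borel_measurable borel" by (rule borel_measurable_continuous_onI[OF c\<phi>])
  have "compact (\<phi> ` {a..b})"
    using c\<phi> by (intro compact_continuous_image) (auto intro: continuous_on_subset)
  then obtain B where "\<forall>y\<in>\<phi> ` {a..b}. norm y \<le> B"
    using compact_imp_bounded bounded_iff by metis
  then have B: "\<bar>\<phi> t\<bar> \<le> B" if "t \<in> {a..b}" for t using that by auto
  have gi: "integrable lborel (\<lambda>s. indicator {a..b} s * g s)" using g by (simp add: set_integrable_def)
  have mg [measurable]: "(\<lambda>s. indicator {a..b} s * g s) \<in> borel_measurable borel"
    using borel_measurable_integrable[OF gi] by simp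
  have bounded_mult: "set_integrable lborel {a..b} (\<lambda>s. \<psi> s * g s)"
    if [measurable]: "\<psi> \<in> borel_measurable borel" and b: "\<And>s. s \<in> {a..b} \<Longrightarrow> \<bar>\<psi> s\<bar> \<le> B" for \<psi>
    unfolding set_integrable_def
  proof (rule Bochner_Integration.integrable_bound)
    show "integrable lborel (\<lambda>s. B * (indicator {a..b} s * g s))" using gi by simp
    have e: "(\<lambda>s. indicator {a..b} s *\<^sub>R (\<psi> s * g s)) = (\<lambda>s. \<psi> s * (indicator {a..b} s * g s))" by auto
    show "(\<lambda>s. indicator {a..b} s *\<^sub>R (\<psi> s * g s)) \<in> borel_measurable lborel" unfolding e by measurable
    show "AE s in lborel. norm (indicator {a..b} s *\<^sub>R (\<psi> s * g s)) \<le> norm (B * (indicator {a..b} s * g s))"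
    proof (rule AE_I2)
      fix s
      have "\<bar>\<psi> s * g s\<bar> \<le> \<bar>B * g s\<bar>" if "s \<in> {a..b}"
        using b[OF that] by (auto simp: abs_mult intro!: mult_right_mono)
      then show "norm (indicator {a..b} s *\<^sub>R (\<psi> s * g s)) \<le> norm (B * (indicator {a..b} s * g s))"
        by (auto simp: indicator_def)
    qed
  qed
  have \<phi>V: "\<phi> s = signed_powr (p - 1) (V s)" if "s \<in> {a..b}" for s using that by (simp add: \<phi>_def)
  have i\<phi>: "set_integrable lborel {a..b} (\<lambda>s. \<phi> s * g s)" by (rule bounded_mult) (auto intro: B)
  show "set_integrable lborel {a..b} (\<lambda>s. signed_powr (p - 1) (V s) * g s)"
    using i\<phi> by (rule iffD1[OF set_integrable_cong, rotated 3]) (auto simp: \<phi>V)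
  show "\<bar>V b\<bar> powr p \<le> \<bar>V a\<bar> powr p + p * (LINT s:{a..b}|lborel. signed_powr (p - 1) (V s) * g s)"
  proof (cases "a = b")
    case True
    then show ?thesis by (simp add: set_integral_Icc_same del: atLeastAtMost_singleton)
  next
    case False
    define d where "d n = (b - a) / real (Suc n)" for n
    (* the first point of the \<open>n\<close>-th grid that is not to the left of \<open>s\<close> *)
    define r where "r n s = a + of_int \<lceil>(s - a) / d n\<rceil> * d n" for n s
    have d: "0 < d n" "real (Suc n) * d n = b - a" for n using False ab by (auto simp: d_def)
    have r_eq: "r n s = a + real (Suc i) * d n" if "a + real i * d n < s" "s \<le> a + real (Suc i) * d n" for n s i
    proof -
      have "\<lceil>(s - a) / d n\<rceil> = int (Suc i)"
        using that d[of n] by (intro ceiling_unique) (auto simp: field_simps)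
      then show ?thesis by (simp add: r_def)
    qed
    have rge: "s \<le> r n s" "r n s < s + d n" for n s
    proof -
      have "(s - a) / d n \<le> of_int \<lceil>(s - a) / d n\<rceil>" "of_int \<lceil>(s - a) / d n\<rceil> < (s - a) / d n + 1" by linarith+
      then have "s - a \<le> of_int \<lceil>(s - a) / d n\<rceil> * d n" "of_int \<lceil>(s - a) / d n\<rceil> * d n < ((s - a) / d n + 1) * d n"
        using d(1)[of n] by (auto simp only: pos_divide_le_eq mult_less_cancel_right_pos)
      then show "s \<le> r n s" "r n s < s + d n" using d[of n] by (simp_all add: r_def distrib_right)
    qed
    have rin: "r n s \<in> {a..b}" if "s \<in> {a..b}" for n s
    proof -
      have "(s - a) / d n \<le> of_int (int (Suc n))" using that d[of n] by (simp add: pos_divide_le_eq)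
      then have "\<lceil>(s - a) / d n\<rceil> \<le> int (Suc n)" by (simp only: ceiling_le_iff)
      then have "of_int \<lceil>(s - a) / d n\<rceil> * d n \<le> real (Suc n) * d n"
        using d[of n] by (intro mult_right_mono) linarith+
      also have "\<dots> = b - a" by (rule d)
      finally have "r n s \<le> b" by (simp add: r_def)
      then show ?thesis using that rge(1)[of s n] by auto
    qed
    have [measurable]: "r n \<in> borel_measurable borel" for n unfolding r_def[abs_def] by measurable
    have ir: "set_integrable lborel {a..b} (\<lambda>s. \<phi> (r n s) * g s)" for n
      by (rule bounded_mult) (use B rin in auto)
    have step: "\<bar>V (a + real i * d n)\<bar> powr p \<le> \<bar>V a\<bar> powr p + p * (LINT s:{a..a + real i * d n}|lborel. \<phi> (r n s) * g s)"
      if "i \<le> Suc n" for i n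
      using that
    proof (induction i)
      case 0
      show ?case by (simp add: set_integral_Icc_same del: atLeastAtMost_singleton)
    next
      case (Suc i)
      define s where "s = a + real i * d n"
      define t where "t = a + real (Suc i) * d n"
      have "real (Suc i) * d n \<le> real (Suc n) * d n" using Suc d[of n] by (intro mult_right_mono) auto
      then have st: "a \<le> s" "s \<le> t" "t \<le> b" using d[of n] by (auto simp: s_def t_def algebra_simps)
      have "V t - V s = (LINT r:{s<..t}|lborel. g r)"
        using set_integral_Icc_append[OF g st] V[of s] V[of t] st by simp
      then have "\<phi> t * (V t - V s) = (LINT r:{s<..t}|lborel. \<phi> t * g r)" by simp
      also have "\<dots> = (LINT x:{s<..t}|lborel. \<phi> (r n x) * g x)"
        by (intro set_lebesgue_integral_cong) (use r_eq[of i n] in \<open>auto simp: s_def t_def\<close>)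
      finally have e: "\<phi> t * (V t - V s) = (LINT x:{s<..t}|lborel. \<phi> (r n x) * g x)" .
      have "\<bar>V t\<bar> powr p - \<bar>V s\<bar> powr p \<le> p * (\<phi> t * (V t - V s))"
        using abs_powr_above_tangent[OF p, of "V t" "V s"] \<phi>V[of t] st by auto
      moreover have "\<bar>V s\<bar> powr p \<le> \<bar>V a\<bar> powr p + p * (LINT x:{a..s}|lborel. \<phi> (r n x) * g x)"
        using Suc by (simp add: s_def)
      ultimately show ?case
        unfolding t_def[symmetric] using set_integral_Icc_append[OF ir[of n] st] e by (simp add: distrib_left)
    qed
    have le: "\<bar>V b\<bar> powr p \<le> \<bar>V a\<bar> powr p + p * (LINT s:{a..b}|lborel. \<phi> (r n s) * g s)" for n
      using step[of "Suc n" n] d(2)[of n] by simp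
    have d0: "d \<longlonglongrightarrow> 0" unfolding d_def
      using tendsto_mult_right_zero[OF LIMSEQ_inverse_real_of_nat, of "b - a"] by (simp add: divide_inverse)
    have lim_r: "(\<lambda>n. r n s) \<longlonglongrightarrow> s" for s
    proof (rule tendsto_sandwich[of "\<lambda>_. s" _ _ "\<lambda>n. s + d n"])
      show "(\<lambda>n. s + d n) \<longlonglongrightarrow> s" using tendsto_add[OF tendsto_const d0, of s] by simp
      show "\<forall>\<^sub>F n in sequentially. s \<le> r n s" using rge(1) by simp
      show "\<forall>\<^sub>F n in sequentially. r n s \<le> s + d n" using rge(2) by (simp add: less_imp_le)
    qed simp
    have "(\<lambda>n. LINT s:{a..b}|lborel. \<phi> (r n s) * g s) \<longlonglongrightarrow> (LINT s:{a..b}|lborel. \<phi> s * g s)"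
      unfolding set_lebesgue_integral_def
    proof (rule integral_dominated_convergence)
      show "integrable lborel (\<lambda>s. B * \<bar>indicator {a..b} s * g s\<bar>)" using gi by simp
      show "(\<lambda>s. indicator {a..b} s *\<^sub>R (\<phi> s * g s)) \<in> borel_measurable lborel"
        using i\<phi> by (auto simp: set_integrable_def)
      show "(\<lambda>s. indicator {a..b} s *\<^sub>R (\<phi> (r n s) * g s)) \<in> borel_measurable lborel" for n
        using ir[of n] by (auto simp: set_integrable_def)
      have "(\<lambda>n. \<phi> (r n s)) \<longlonglongrightarrow> \<phi> s" for s
        using c\<phi> lim_r by (intro isCont_tendsto_compose[of _ \<phi>]) (auto simp: continuous_on_eq_continuous_at)
      then show "AE s in lborel. (\<lambda>n. indicator {a..b} s *\<^sub>R (\<phi> (r n s) * g s)) \<longlonglongrightarrow> indicator {a..b} s *\<^sub>R (\<phi> s * g s)"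
        by (intro AE_I2 tendsto_intros)
      show "AE s in lborel. norm (indicator {a..b} s *\<^sub>R (\<phi> (r n s) * g s)) \<le> B * \<bar>indicator {a..b} s * g s\<bar>" for n
        using B rin[of _ n] by (intro AE_I2) (auto simp: indicator_def abs_mult intro!: mult_right_mono)
    qed
    then have "(\<lambda>n. \<bar>V a\<bar> powr p + p * (LINT s:{a..b}|lborel. \<phi> (r n s) * g s)) \<longlonglongrightarrow> \<bar>V a\<bar> powr p + p * (LINT s:{a..b}|lborel. \<phi> s * g s)"
      by (intro tendsto_intros)
    then have "\<bar>V b\<bar> powr p \<le> \<bar>V a\<bar> powr p + p * (LINT s:{a..b}|lborel. \<phi> s * g s)"
      by (rule LIMSEQ_le_const) (use le in auto)
    also have "(LINT s:{a..b}|lborel. \<phi> s * g s) = (LINT s:{a..b}|lborel. signed_powr (p - 1) (V s) * g s)"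
      by (intro set_lebesgue_integral_cong) (auto simp: \<phi>V)
    finally show ?thesis .
  qed
qed

section \<open>Measure-preserving maps of the circle\<close>

text \<open>
  A density rather than a restricted space: the underlying space remains the whole line, so that
  measurability means Borel measurability throughout.
\<close>

definition lborel_in :: "real set \<Rightarrow> real measure" where
  "lborel_in A = density lborel (indicator A)"

lemma sets_lborel_in [simp, measurable_cong]: "sets (lborel_in A) = sets borel"
  by (simp add: lborel_in_def)

lemma space_lborel_in [simp]: "space (lborel_in A) = UNIV"
  by (simp add: lborel_in_def)

lemma AE_lborel_in:
  assumes [measurable]: "A \<in> sets borel"
  shows "(AE x in lborel_in A. P x) \<longleftrightarrow> (AE x in lborel. x \<in> A \<longrightarrow> P x)"
  unfolding lborel_in_def by (subst AE_density) (auto simp: indicator_def)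

lemma nn_integral_lborel_in:
  assumes [measurable]: "A \<in> sets borel" "f \<in> borel_measurable borel"
  shows "(\<integral>\<^sup>+x. f x \<partial>lborel_in A) = (\<integral>\<^sup>+x. f x * indicator A x \<partial>lborel)"
  unfolding lborel_in_def by (subst nn_integral_density) (auto simp: mult.commute)

lemma integral_lborel_in:
  fixes f :: "real \<Rightarrow> real"
  assumes [measurable]: "A \<in> sets borel" "f \<in> borel_measurable borel"
  shows "(\<integral>x. f x \<partial>lborel_in A) = (LINT x:A|lborel. f x)"
proof -
  have "lborel_in A = density lborel (\<lambda>x. ennreal (indicator A x))"
    by (simp add: lborel_in_def ennreal_indicator)
  then show ?thesis by (simp add: integral_real_density set_lebesgue_integral_def)
qed

lemma integrable_lborel_in:
  fixes f :: "real \<Rightarrow> real"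
  assumes [measurable]: "A \<in> sets borel" "f \<in> borel_measurable borel"
  shows "integrable (lborel_in A) f \<longleftrightarrow> set_integrable lborel A f"
proof -
  have "lborel_in A = density lborel (\<lambda>x. ennreal (indicator A x))"
    by (simp add: lborel_in_def ennreal_indicator)
  then show ?thesis by (simp add: integrable_real_density set_integrable_def)
qed

lemma emeasure_lborel_in:
  assumes [measurable]: "A \<in> sets borel"
  shows "emeasure (lborel_in A) UNIV = emeasure lborel A"
  by (simp add: lborel_in_def emeasure_density)

lemma finite_measure_lborel_in:
  assumes "A \<in> sets borel" "emeasure lborel A < \<infinity>"
  shows "finite_measure (lborel_in A)"
  by (rule finite_measureI) (use assms in \<open>auto simp: emeasure_lborel_in\<close>)

text \<open>
  The circle \<open>\<real> / 2\<int>\<close>. Functions on it are functions of period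
  \<open>2\<close> on the line.
\<close>

definition circle :: "real measure" where
  "circle = lborel_in {0..<2}"

definition wrap :: "real \<Rightarrow> real" where
  "wrap z = z - 2 * of_int \<lfloor>z / 2\<rfloor>"

definition periodic :: "(real \<Rightarrow> 'a) \<Rightarrow> bool" where
  "periodic f \<longleftrightarrow> (\<forall>z. f (z + 2) = f z)"

lemma sets_circle [simp, measurable_cong]: "sets circle = sets borel"
  by (simp add: circle_def)

lemma space_circle [simp]: "space circle = UNIV"
  by (simp add: circle_def)

lemma finite_measure_circle: "finite_measure circle"
  unfolding circle_def by (rule finite_measure_lborel_in) auto

lemma finite_measure_lborel_in_Icc: "finite_measure (lborel_in {a..b})"
  by (rule finite_measure_lborel_in) (auto simp: emeasure_lborel_Icc_eq)

interpretation circle: finite_measure circle by (rule finite_measure_circle)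
interpretation Icc: finite_measure "lborel_in {a..b}" for a b by (rule finite_measure_lborel_in_Icc)
interpretation Icc_circle: pair_sigma_finite "lborel_in {a..b}" circle for a b ..

lemma measure_circle [simp]: "measure circle UNIV = 2"
  by (simp add: measure_def circle_def emeasure_lborel_in)

lemma measure_lborel_in_Icc: "a \<le> b \<Longrightarrow> measure (lborel_in {a..b}) UNIV = b - a"
  by (simp add: measure_def emeasure_lborel_in)

lemma wrap_range: "0 \<le> wrap z" "wrap z < 2"
  unfolding wrap_def by linarith+

lemma wrap_id: "0 \<le> z \<Longrightarrow> z < 2 \<Longrightarrow> wrap z = z"
  unfolding wrap_def by (simp add: floor_eq_iff)

lemma wrap_measurable [measurable]: "wrap \<in> borel_measurable borel"
  unfolding wrap_def[abs_def] by measurable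

lemma periodic_of_nat: "periodic f \<Longrightarrow> f (z + 2 * of_nat n) = f z"
proof (induction n)
  case (Suc n)
  have "f (z + 2 * of_nat (Suc n)) = f ((z + 2 * of_nat n) + 2)" by (simp add: algebra_simps)
  with Suc show ?case by (simp add: periodic_def)
qed simp

lemma periodic_of_int:
  assumes "periodic f" shows "f (z + 2 * of_int k) = f z"
proof (cases "0 \<le> k")
  case True
  then show ?thesis using periodic_of_nat[OF assms, of z "nat k"] by simp
next
  case False
  then show ?thesis using periodic_of_nat[OF assms, of "z + 2 * of_int k" "nat (- k)"] by simp
qed

lemma periodic_wrap: "periodic f \<Longrightarrow> f (wrap z) = f z"
  using periodic_of_int[of f "wrap z" "\<lfloor>z / 2\<rfloor>"] by (simp add: wrap_def)

lemma wrap_add_2: "periodic wrap"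
  by (simp add: periodic_def wrap_def add_divide_distrib)

lemma periodic_shift: "periodic f \<Longrightarrow> periodic (\<lambda>z. f (z + h))"
  unfolding periodic_def by (metis add.assoc add.commute)

lemma periodic_reflect:
  assumes "periodic f" shows "periodic (\<lambda>z. f (h - z))"
  unfolding periodic_def
proof
  fix z show "f (h - (z + 2)) = f (h - z)" using periodic_of_int[OF assms, of "h - z" "-1"] by (simp add: algebra_simps)
qed

lemma periodic_compose: "periodic f \<Longrightarrow> periodic (\<lambda>z. g (f z))"
  by (simp add: periodic_def)

lemma periodic_compose2: "periodic f \<Longrightarrow> periodic f' \<Longrightarrow> periodic (\<lambda>z. g (f z) (f' z))"
  by (simp add: periodic_def)

lemma nn_integral_shift:
  fixes c :: real
  assumes [measurable]: "f \<in> borel_measurable borel"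
  shows "(\<integral>\<^sup>+x. f (x + c) \<partial>lborel) = (\<integral>\<^sup>+x. f x \<partial>lborel)"
  using nn_integral_real_affine[of f 1 c] by (simp add: add.commute)

lemma nn_integral_reflect:
  fixes c :: real
  assumes [measurable]: "f \<in> borel_measurable borel"
  shows "(\<integral>\<^sup>+x. f (c - x) \<partial>lborel) = (\<integral>\<^sup>+x. f x \<partial>lborel)"
  using nn_integral_real_affine[of f "-1" c] by simp

lemma nn_integral_circle_shift:
  assumes [measurable]: "f \<in> borel_measurable borel" and f: "periodic f"
  shows "(\<integral>\<^sup>+z. f (z + h) \<partial>circle) = (\<integral>\<^sup>+z. f z \<partial>circle)"
proof -
  define r where "r = wrap h"
  have r: "0 \<le> r" "r < 2" by (auto simp: r_def wrap_range)
  have fr: "f (z + h) = f (z + r)" for z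
    using periodic_of_int[OF f, of "z + r" "\<lfloor>h / 2\<rfloor>"] by (simp add: r_def wrap_def)
  have "(\<integral>\<^sup>+z. f (z + h) \<partial>circle) = (\<integral>\<^sup>+z. f (z + r) * indicator {0..<2} z \<partial>lborel)"
    unfolding circle_def fr by (rule nn_integral_lborel_in) auto
  also have "\<dots> = (\<integral>\<^sup>+z. (\<lambda>y. f y * indicator {0..<2} (y - r)) (z + r) \<partial>lborel)" by simp
  also have "\<dots> = (\<integral>\<^sup>+y. f y * indicator {0..<2} (y - r) \<partial>lborel)"
    by (rule nn_integral_shift) auto
  (* the part of the shifted period beyond \<open>2\<close> is moved back to the beginning *)
  also have "\<dots> = (\<integral>\<^sup>+y. f y * indicator {r..<2} y + f y * indicator {0..<r} (y - 2) \<partial>lborel)"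
    using r by (intro nn_integral_cong) (auto simp: indicator_def)
  also have "\<dots> = (\<integral>\<^sup>+y. f y * indicator {r..<2} y \<partial>lborel) + (\<integral>\<^sup>+y. f y * indicator {0..<r} (y - 2) \<partial>lborel)"
    by (rule nn_integral_add) auto
  also have "(\<integral>\<^sup>+y. f y * indicator {0..<r} (y - 2) \<partial>lborel) = (\<integral>\<^sup>+y. (\<lambda>y. f y * indicator {0..<r} (y - 2)) (y + 2) \<partial>lborel)"
    by (rule nn_integral_shift[symmetric]) auto
  also have "\<dots> = (\<integral>\<^sup>+y. f y * indicator {0..<r} y \<partial>lborel)"
    using f by (simp add: periodic_def)
  also have "(\<integral>\<^sup>+y. f y * indicator {r..<2} y \<partial>lborel) + (\<integral>\<^sup>+y. f y * indicator {0..<r} y \<partial>lborel) =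
     (\<integral>\<^sup>+y. f y * indicator {r..<2} y + f y * indicator {0..<r} y \<partial>lborel)"
    by (rule nn_integral_add[symmetric]) auto
  also have "\<dots> = (\<integral>\<^sup>+y. f y * indicator {0..<2} y \<partial>lborel)"
    using r by (intro nn_integral_cong) (auto simp: indicator_def)
  also have "\<dots> = (\<integral>\<^sup>+z. f z \<partial>circle)"
    unfolding circle_def by (rule nn_integral_lborel_in[symmetric]) auto
  finally show ?thesis .
qed

lemma nn_integral_Icc_period:
  assumes [measurable]: "f \<in> borel_measurable borel" and f: "periodic f"
  shows "(\<integral>\<^sup>+z. f z \<partial>lborel_in {t..t + 2}) = (\<integral>\<^sup>+z. f z \<partial>circle)"
proof -
  have "(\<integral>\<^sup>+z. f z \<partial>lborel_in {t..t + 2}) = (\<integral>\<^sup>+z. f z * indicator {t..t + 2} z \<partial>lborel)"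
    by (rule nn_integral_lborel_in) auto
  also have "\<dots> = (\<integral>\<^sup>+z. f z * indicator {0..<2} (z - t) \<partial>lborel)"
    by (rule nn_integral_cong_AE, use AE_lborel_singleton[of "t + 2"] in eventually_elim) (auto simp: indicator_def)
  also have "\<dots> = (\<integral>\<^sup>+z. (\<lambda>z. f z * indicator {0..<2} (z - t)) (z + t) \<partial>lborel)"
    by (rule nn_integral_shift[symmetric]) auto
  also have "\<dots> = (\<integral>\<^sup>+z. f (z + t) * indicator {0..<2} z \<partial>lborel)" by simp
  also have "\<dots> = (\<integral>\<^sup>+z. f (z + t) \<partial>circle)"
    unfolding circle_def by (rule nn_integral_lborel_in[symmetric]) auto
  also have "\<dots> = (\<integral>\<^sup>+z. f z \<partial>circle)" by (rule nn_integral_circle_shift) (use f in auto)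
  finally show ?thesis .
qed

lemma nn_integral_circle_reflect:
  assumes [measurable]: "f \<in> borel_measurable borel" and f: "periodic f"
  shows "(\<integral>\<^sup>+z. f (h - z) \<partial>circle) = (\<integral>\<^sup>+z. f z \<partial>circle)"
proof -
  have "(\<integral>\<^sup>+z. f (h - z) \<partial>circle) = (\<integral>\<^sup>+z. f (h - z) * indicator {0..<2} z \<partial>lborel)"
    unfolding circle_def by (rule nn_integral_lborel_in) auto
  also have "\<dots> = (\<integral>\<^sup>+z. (\<lambda>y. f y * indicator {0..<2} (h - y)) (h - z) \<partial>lborel)" by simp
  also have "\<dots> = (\<integral>\<^sup>+y. f y * indicator {0..<2} (h - y) \<partial>lborel)"
    by (rule nn_integral_reflect) auto
  also have "\<dots> = (\<integral>\<^sup>+y. f y * indicator {h - 2..(h - 2) + 2} y \<partial>lborel)"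
    by (rule nn_integral_cong_AE, use AE_lborel_singleton[of "h - 2"] in eventually_elim) (auto simp: indicator_def)
  also have "\<dots> = (\<integral>\<^sup>+y. f y \<partial>lborel_in {h - 2..(h - 2) + 2})"
    by (rule nn_integral_lborel_in[symmetric]) auto
  also have "\<dots> = (\<integral>\<^sup>+z. f z \<partial>circle)" by (rule nn_integral_Icc_period) (use f in auto)
  finally show ?thesis .
qed

lemma AE_circle_wrap: "AE z in circle. wrap z = z"
  unfolding circle_def by (subst AE_lborel_in) (auto intro!: AE_I2 wrap_id)

lemma distr_circle_shift: "distr circle circle (\<lambda>z. wrap (z + h)) = circle"
proof (rule measure_eqI)
  fix A assume "A \<in> sets (distr circle circle (\<lambda>z. wrap (z + h)))"
  then have [measurable]: "A \<in> sets borel" by simp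
  have "emeasure (distr circle circle (\<lambda>z. wrap (z + h))) A = (\<integral>\<^sup>+z. indicator A (wrap (z + h)) \<partial>circle)"
    by (subst nn_integral_indicator[symmetric], simp, subst nn_integral_distr) auto
  also have "\<dots> = (\<integral>\<^sup>+z. indicator A (wrap z) \<partial>circle)"
    by (rule nn_integral_circle_shift[where f = "\<lambda>z. indicator A (wrap z)"]) (auto intro: periodic_compose wrap_add_2)
  also have "\<dots> = (\<integral>\<^sup>+z. indicator A z \<partial>circle)"
    by (rule nn_integral_cong_AE, use AE_circle_wrap in eventually_elim) auto
  finally show "emeasure (distr circle circle (\<lambda>z. wrap (z + h))) A = emeasure circle A" by simp
qed simp

lemma integral_circle_shift:
  fixes f :: "real \<Rightarrow> real"
  assumes [measurable]: "f \<in> borel_measurable borel" and f: "periodic f"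
  shows "(\<integral>z. f (z + h) \<partial>circle) = (\<integral>z. f z \<partial>circle)"
    and "integrable circle (\<lambda>z. f (z + h)) \<longleftrightarrow> integrable circle f"
proof -
  have m: "(\<lambda>z. wrap (z + h)) \<in> circle \<rightarrow>\<^sub>M circle" "f \<in> borel_measurable circle" by auto
  show "(\<integral>z. f (z + h) \<partial>circle) = (\<integral>z. f z \<partial>circle)"
    using integral_distr[OF m] by (simp add: distr_circle_shift periodic_wrap[OF f])
  show "integrable circle (\<lambda>z. f (z + h)) \<longleftrightarrow> integrable circle f"
    using integrable_distr_eq[OF m] by (simp add: distr_circle_shift periodic_wrap[OF f])
qed

text \<open>
  In the coordinate \<open>z\<close> that labels characteristics, the exchange at time
  \<open>s\<close> between the points \<open>y = z + s\<close> and \<open>- y\<close> is the map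
  \<open>z \<mapsto> - z - 2 s\<close>. For each \<open>s\<close> it is a reflection of the
  circle.
\<close>

lemma distr_exchange:
  "distr (lborel_in {a..b} \<Otimes>\<^sub>M circle) (lborel_in {a..b} \<Otimes>\<^sub>M circle) (\<lambda>(s, z). (s, wrap (- z - 2 * s)))
    = lborel_in {a..b} \<Otimes>\<^sub>M circle" (is "distr ?P ?P ?R = ?P")
proof (rule measure_eqI)
  fix A assume A: "A \<in> sets (distr ?P ?P ?R)"
  then have A' [measurable]: "A \<in> sets ?P" by simp
  have [measurable]: "?R \<in> ?P \<rightarrow>\<^sub>M ?P" by measurable
  have 1: "(\<integral>\<^sup>+z. indicator A (s, wrap (- z - 2 * s)) \<partial>circle) = (\<integral>\<^sup>+z. indicator A (s, z) \<partial>circle)" for s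
  proof -
    have "(\<integral>\<^sup>+z. indicator A (s, wrap (- z - 2 * s)) \<partial>circle) = (\<integral>\<^sup>+z. (\<lambda>y. indicator A (s, wrap y)) (- 2 * s - z) \<partial>circle)"
      by (simp add: minus_diff_commute)
    also have "\<dots> = (\<integral>\<^sup>+z. indicator A (s, wrap z) \<partial>circle)"
      by (rule nn_integral_circle_reflect) (auto intro: periodic_compose[of wrap "\<lambda>y. indicator A (s, y)"] wrap_add_2)
    also have "\<dots> = (\<integral>\<^sup>+z. indicator A (s, z) \<partial>circle)"
      by (rule nn_integral_cong_AE, use AE_circle_wrap in eventually_elim) auto
    finally show ?thesis .
  qed
  have "emeasure (distr ?P ?P ?R) A = (\<integral>\<^sup>+x. indicator A x \<partial>distr ?P ?P ?R)"
    by (rule nn_integral_indicator[symmetric, OF A])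
  also have "\<dots> = (\<integral>\<^sup>+x. indicator A (?R x) \<partial>?P)"
    by (rule nn_integral_distr) auto
  also have "\<dots> = (\<integral>\<^sup>+s. \<integral>\<^sup>+z. indicator A (s, wrap (- z - 2 * s)) \<partial>circle \<partial>lborel_in {a..b})"
    by (subst circle.nn_integral_fst[symmetric]) (auto simp: split_beta)
  also have "\<dots> = (\<integral>\<^sup>+s. \<integral>\<^sup>+z. indicator A (s, z) \<partial>circle \<partial>lborel_in {a..b})" by (simp add: 1)
  also have "\<dots> = (\<integral>\<^sup>+x. indicator A x \<partial>?P)" by (rule circle.nn_integral_fst) auto
  also have "\<dots> = emeasure ?P A" by (rule nn_integral_indicator[OF A'])
  finally show "emeasure (distr ?P ?P ?R) A = emeasure ?P A" .
qed simp

lemma integral_exchange: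
  fixes f :: "real \<Rightarrow> real \<Rightarrow> real"
  assumes [measurable]: "case_prod f \<in> borel_measurable (borel \<Otimes>\<^sub>M borel)" and f: "\<And>s. periodic (f s)"
  shows "(\<integral>(s, z). f s (- z - 2 * s) \<partial>(lborel_in {a..b} \<Otimes>\<^sub>M circle)) = (\<integral>(s, z). f s z \<partial>(lborel_in {a..b} \<Otimes>\<^sub>M circle))"
    and "integrable (lborel_in {a..b} \<Otimes>\<^sub>M circle) (\<lambda>(s, z). f s (- z - 2 * s)) \<longleftrightarrow>
         integrable (lborel_in {a..b} \<Otimes>\<^sub>M circle) (\<lambda>(s, z). f s z)"
proof -
  let ?P = "lborel_in {a..b} \<Otimes>\<^sub>M circle"
  let ?R = "\<lambda>(s, z). (s, wrap (- z - 2 * s))"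
  have m: "?R \<in> ?P \<rightarrow>\<^sub>M ?P" "case_prod f \<in> borel_measurable ?P" by measurable
  have e: "(\<lambda>x. case_prod f (?R x)) = (\<lambda>(s, z). f s (- z - 2 * s))"
    by (auto simp: periodic_wrap[OF f])
  show "(\<integral>(s, z). f s (- z - 2 * s) \<partial>?P) = (\<integral>(s, z). f s z \<partial>?P)"
    using integral_distr[OF m] unfolding distr_exchange e by simp
  show "integrable ?P (\<lambda>(s, z). f s (- z - 2 * s)) \<longleftrightarrow> integrable ?P (\<lambda>(s, z). f s z)"
    using integrable_distr_eq[OF m] unfolding distr_exchange e by simp
qed


section \<open>Functions of mean zero that are nearly invariant under some translations\<close>

definition shift_defect :: "real \<Rightarrow> (real \<Rightarrow> real) \<Rightarrow> real \<Rightarrow> ennreal" where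
  "shift_defect p f h = (\<integral>\<^sup>+r. ennreal (\<bar>f (r + h) - f r\<bar> powr p) \<partial>circle)"

lemma shift_defect_measurable [measurable]:
  assumes [measurable]: "f \<in> borel_measurable borel"
  shows "shift_defect p f \<in> borel_measurable borel"
  unfolding shift_defect_def[abs_def] by measurable

lemma shift_defect_shifted:
  assumes [measurable]: "f \<in> borel_measurable borel" and f: "periodic f"
  shows "(\<integral>\<^sup>+r. ennreal (\<bar>f (r + c + h) - f (r + c)\<bar> powr p) \<partial>circle) = shift_defect p f h"
proof -
  have "periodic (\<lambda>r. ennreal (\<bar>f (r + h) - f r\<bar> powr p))"
    using f by (intro periodic_compose2[of "\<lambda>r. f (r + h)" f "\<lambda>x y. ennreal (\<bar>x - y\<bar> powr p)"] periodic_shift)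
  then show ?thesis
    unfolding shift_defect_def
    using nn_integral_circle_shift[of "\<lambda>r. ennreal (\<bar>f (r + h) - f r\<bar> powr p)" c] by simp
qed

text \<open>
  The translation by \<open>h\<close> is the translation by \<open>c + h\<close> composed with the
  inverse of the translation by \<open>c\<close>.
\<close>

lemma shift_defect_diff:
  assumes [measurable]: "f \<in> borel_measurable borel" and f: "periodic f" and p: "0 < p"
  shows "shift_defect p f h \<le> ennreal (2 powr p) * (shift_defect p f (c + h) + shift_defect p f c)"
proof -
  have "shift_defect p f h = (\<integral>\<^sup>+r. ennreal (\<bar>f (r + c + h) - f (r + c)\<bar> powr p) \<partial>circle)"
    by (rule shift_defect_shifted[symmetric]) (use f in auto)
  also have "\<dots> \<le> (\<integral>\<^sup>+r. ennreal (2 powr p) * (ennreal (\<bar>f (r + (c + h)) - f r\<bar> powr p) + ennreal (\<bar>f (r + c) - f r\<bar> powr p)) \<partial>circle)"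
  proof (rule nn_integral_mono)
    fix r
    have "\<bar>f (r + c + h) - f (r + c)\<bar> powr p \<le> 2 powr p * (\<bar>f (r + c + h) - f r\<bar> powr p + \<bar>- (f (r + c) - f r)\<bar> powr p)"
      using abs_add_powr_le[OF p, of "f (r + c + h) - f r" "- (f (r + c) - f r)"] by simp
    also have "\<dots> = 2 powr p * (\<bar>f (r + (c + h)) - f r\<bar> powr p + \<bar>f (r + c) - f r\<bar> powr p)"
      by (simp add: add.assoc abs_minus_commute)
    finally show "ennreal (\<bar>f (r + c + h) - f (r + c)\<bar> powr p) \<le> ennreal (2 powr p) * (ennreal (\<bar>f (r + (c + h)) - f r\<bar> powr p) + ennreal (\<bar>f (r + c) - f r\<bar> powr p))"
      by (simp flip: ennreal_plus ennreal_mult)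
  qed
  also have "\<dots> = ennreal (2 powr p) * (shift_defect p f (c + h) + shift_defect p f c)"
    unfolding shift_defect_def by (simp add: nn_integral_cmult nn_integral_add)
  finally show ?thesis .
qed

text \<open>
  A telescoping sum of \<open>n\<close> translations by \<open>h\<close>. The \<open>p\<close>-th
  power of a sum of \<open>n\<close> terms costs the factor \<open>n\<^sup>p\<close>, and the
  \<open>n\<close> terms have equal integrals.
\<close>

lemma shift_defect_of_nat:
  assumes [measurable]: "f \<in> borel_measurable borel" and f: "periodic f" and p: "0 < p"
  shows "shift_defect p f (real n * h) \<le> ennreal (real n powr (p + 1)) * shift_defect p f h"
proof -
  have "shift_defect p f (real n * h) \<le> (\<integral>\<^sup>+r. ennreal (real n powr p) * (\<Sum>i<n. ennreal (\<bar>f (r + real i * h + h) - f (r + real i * h)\<bar> powr p)) \<partial>circle)"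
    unfolding shift_defect_def
  proof (rule nn_integral_mono)
    fix r
    have "(\<Sum>i<n. f (r + real i * h + h) - f (r + real i * h)) = f (r + real n * h) - f r"
      by (induction n) (auto simp: algebra_simps)
    then show "ennreal (\<bar>f (r + real n * h) - f r\<bar> powr p) \<le> ennreal (real n powr p) * (\<Sum>i<n. ennreal (\<bar>f (r + real i * h + h) - f (r + real i * h)\<bar> powr p))"
      using abs_sum_powr_le[OF p, of "\<lambda>i. f (r + real i * h + h) - f (r + real i * h)" n]
      by (simp flip: ennreal_mult add: sum_nonneg)
  qed
  also have "\<dots> = ennreal (real n powr p) * (\<Sum>i<n. shift_defect p f h)"
    by (simp add: nn_integral_cmult nn_integral_sum shift_defect_shifted[OF assms(1) f] del: sum_ennreal)
  also have "\<dots> = ennreal (real n * real n powr p) * shift_defect p f h"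
    by (simp add: ennreal_mult ennreal_of_nat_eq_real_of_nat mult_ac)
  also have "real n * real n powr p = real n powr (p + 1)"
    by (subst powr_mult_base) (auto simp: add.commute)
  finally show ?thesis .
qed

text \<open>
  Since \<open>f\<close> has mean zero, the integral of \<open>f (r + h) - f r\<close> over
  \<open>h\<close> is \<open>- 2 f r\<close>. Jensen's inequality bounds \<open>\<bar>f
  r\<bar>\<^sup>p\<close>, and it remains to integrate over \<open>r\<close>.
\<close>

lemma nn_integral_powr_le_shift_defect:
  assumes [measurable]: "f \<in> borel_measurable borel" and f: "periodic f" and p: "1 < p"
    and i: "integrable circle (\<lambda>z. \<bar>f z\<bar> powr p)" and mean: "(\<integral>z. f z \<partial>circle) = 0"
  shows "(\<integral>\<^sup>+z. ennreal (\<bar>f z\<bar> powr p) \<partial>circle) \<le> (\<integral>\<^sup>+h. shift_defect p f h \<partial>circle)"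
proof -
  have fi: "integrable circle f" by (rule circle.integrable_of_abs_powr[OF _ _ i]) (use p in auto)
  have *: "ennreal (\<bar>f r\<bar> powr p) \<le> (\<integral>\<^sup>+h. ennreal (\<bar>f (r + h) - f r\<bar> powr p) \<partial>circle)" for r
  proof -
    have pf: "periodic (\<lambda>h. \<bar>f h\<bar> powr p)" using f by (simp add: periodic_def)
    have ir: "integrable circle (\<lambda>h. \<bar>f (r + h)\<bar> powr p)"
      using integral_circle_shift(2)[OF _ pf, of r] i by (simp add: add.commute)
    have fir: "integrable circle (\<lambda>h. f (r + h))" "(\<integral>h. f (r + h) \<partial>circle) = 0"
      using integral_circle_shift[OF _ f, of r] fi mean by (simp_all add: add.commute)
    have id: "integrable circle (\<lambda>h. \<bar>f (r + h) - f r\<bar> powr p)"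
    proof (rule Bochner_Integration.integrable_bound)
      show "integrable circle (\<lambda>h. 2 powr p * (\<bar>f (r + h)\<bar> powr p + \<bar>- f r\<bar> powr p))"
        using ir by auto
      show "AE h in circle. norm (\<bar>f (r + h) - f r\<bar> powr p) \<le> norm (2 powr p * (\<bar>f (r + h)\<bar> powr p + \<bar>- f r\<bar> powr p))"
        using abs_add_powr_le[of p "f (r + h)" "- f r" for h] p by (intro AE_I2) (simp add: abs_of_nonneg)
    qed auto
    have "\<bar>\<integral>h. f (r + h) - f r \<partial>circle\<bar> powr p \<le> 2 powr (p - 1) * (\<integral>h. \<bar>f (r + h) - f r\<bar> powr p \<partial>circle)"
      using circle.abs_integral_powr_le[OF p _ id] by simp
    also have "(\<integral>h. f (r + h) - f r \<partial>circle) = - 2 * f r" using fir by simp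
    also have "\<bar>- 2 * f r\<bar> powr p = 2 * 2 powr (p - 1) * \<bar>f r\<bar> powr p"
      by (simp add: abs_mult powr_mult powr_mult_base)
    finally have "2 * \<bar>f r\<bar> powr p \<le> (\<integral>h. \<bar>f (r + h) - f r\<bar> powr p \<partial>circle)" by simp
    moreover have "\<bar>f r\<bar> powr p \<le> 2 * \<bar>f r\<bar> powr p" by simp
    ultimately have "\<bar>f r\<bar> powr p \<le> (\<integral>h. \<bar>f (r + h) - f r\<bar> powr p \<partial>circle)" by linarith
    then show ?thesis using nn_integral_eq_integral[OF id] by simp
  qed
  have "(\<integral>\<^sup>+z. ennreal (\<bar>f z\<bar> powr p) \<partial>circle) \<le> (\<integral>\<^sup>+r. \<integral>\<^sup>+h. ennreal (\<bar>f (r + h) - f r\<bar> powr p) \<partial>circle \<partial>circle)"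
    by (intro nn_integral_mono *)
  also have "\<dots> = (\<integral>\<^sup>+h. \<integral>\<^sup>+r. ennreal (\<bar>f (r + h) - f r\<bar> powr p) \<partial>circle \<partial>circle)"
    by (rule pair_sigma_finite.Fubini') (auto simp: pair_sigma_finite_def circle.sigma_finite_measure_axioms)
  finally show ?thesis by (simp add: shift_defect_def)
qed

text \<open>
  The price of passing from the translations by \<open>2 y\<close>, with \<open>y\<close> in an
  interval of radius \<open>\<epsilon>\<close>, to all translations: a difference of two of them
  can be any translation by at most \<open>2 \<epsilon>\<close>, and \<open>\<lceil>1 /
  \<epsilon>\<rceil>\<close> of those reach any translation by at most \<open>2\<close>.
\<close>

definition translation_const :: "real \<Rightarrow> real \<Rightarrow> real" where
  "translation_const p \<epsilon> = 2 * real (nat \<lceil>1 / \<epsilon>\<rceil>) powr (p + 1) * (2 powr p * 2 / \<epsilon>)"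

lemma translation_const_pos:
  assumes "0 < \<epsilon>" shows "0 < translation_const p \<epsilon>"
proof -
  have "1 / \<epsilon> \<le> real (nat \<lceil>1 / \<epsilon>\<rceil>)" by (rule real_nat_ceiling_ge)
  moreover have "0 < 1 / \<epsilon>" using assms by simp
  ultimately have "real (nat \<lceil>1 / \<epsilon>\<rceil>) \<noteq> 0" by linarith
  then have "0 < real (nat \<lceil>1 / \<epsilon>\<rceil>) powr (p + 1)" by (rule powr_gt_zero[THEN iffD2])
  then show ?thesis using assms unfolding translation_const_def by (intro mult_pos_pos divide_pos_pos) auto
qed

text \<open>
  Let \<open>0 \<le> h \<le> 2 \<epsilon>\<close>. For \<open>y\<close> in the left half of the
  window, both \<open>y\<close> and \<open>y + h / 2\<close> lie in the window, and
  \<open>h\<close> is the difference of \<open>2 (y + h / 2)\<close> and \<open>2 y\<close>.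
  Averaging over such \<open>y\<close> bounds the defect of the translation by \<open>h\<close>.
  Longer translations are multiples of these.
\<close>

lemma nn_integral_powr_le_window_defect:
  assumes [measurable]: "f \<in> borel_measurable borel" and f: "periodic f" and p: "1 < p" and \<epsilon>: "0 < \<epsilon>"
    and i: "integrable circle (\<lambda>z. \<bar>f z\<bar> powr p)" and mean: "(\<integral>z. f z \<partial>circle) = 0"
  shows "(\<integral>\<^sup>+z. ennreal (\<bar>f z\<bar> powr p) \<partial>circle) \<le>
     ennreal (translation_const p \<epsilon>) * (\<integral>\<^sup>+y. shift_defect p f (2 * y) * indicator {x - \<epsilon><..<x + \<epsilon>} y \<partial>lborel)"
proof -
  let ?\<Gamma> = "\<integral>\<^sup>+y. shift_defect p f (2 * y) * indicator {x - \<epsilon><..<x + \<epsilon>} y \<partial>lborel"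
  have p0: "0 < p" using p by simp
  have small: "shift_defect p f h \<le> ennreal (2 powr p * 2 / \<epsilon>) * ?\<Gamma>" if h: "0 \<le> h" "h \<le> 2 * \<epsilon>" for h
  proof -
    have "ennreal \<epsilon> * shift_defect p f h = (\<integral>\<^sup>+y. shift_defect p f h * indicator {x - \<epsilon><..<x} y \<partial>lborel)"
      using \<epsilon> by (simp add: nn_integral_cmult mult.commute)
    also have "\<dots> \<le> (\<integral>\<^sup>+y. ennreal (2 powr p) * (shift_defect p f (2 * (y + h / 2)) * indicator {x - \<epsilon><..<x + \<epsilon>} (y + h / 2)
         + shift_defect p f (2 * y) * indicator {x - \<epsilon><..<x + \<epsilon>} y) \<partial>lborel)"
      using shift_defect_diff[OF assms(1) f p0, of h "2 * y" for y] h \<epsilon>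
      by (intro nn_integral_mono) (auto simp: indicator_def distrib_left)
    also have "\<dots> = ennreal (2 powr p) * ((\<integral>\<^sup>+y. shift_defect p f (2 * (y + h / 2)) * indicator {x - \<epsilon><..<x + \<epsilon>} (y + h / 2) \<partial>lborel) + ?\<Gamma>)"
      by (simp add: nn_integral_cmult nn_integral_add)
    also have "(\<integral>\<^sup>+y. shift_defect p f (2 * (y + h / 2)) * indicator {x - \<epsilon><..<x + \<epsilon>} (y + h / 2) \<partial>lborel) = ?\<Gamma>"
      by (rule nn_integral_shift[where f = "\<lambda>y. shift_defect p f (2 * y) * indicator {x - \<epsilon><..<x + \<epsilon>} y"]) auto
    also have "?\<Gamma> + ?\<Gamma> = ennreal 2 * ?\<Gamma>" by (simp only: ennreal_numeral mult_2)
    finally have "ennreal (1 / \<epsilon>) * (ennreal \<epsilon> * shift_defect p f h) \<le> ennreal (1 / \<epsilon>) * (ennreal (2 powr p) * (ennreal 2 * ?\<Gamma>))"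
      by (rule mult_left_mono) auto
    also have "ennreal (1 / \<epsilon>) * (ennreal \<epsilon> * shift_defect p f h) = shift_defect p f h"
      using \<epsilon> by (simp flip: mult.assoc ennreal_mult)
    also have "ennreal (1 / \<epsilon>) * (ennreal (2 powr p) * (ennreal 2 * ?\<Gamma>)) = (ennreal (1 / \<epsilon>) * ennreal (2 powr p) * ennreal 2) * ?\<Gamma>"
      by (simp only: mult.assoc)
    also have "ennreal (1 / \<epsilon>) * ennreal (2 powr p) * ennreal 2 = ennreal (2 powr p * 2 / \<epsilon>)"
      using \<epsilon> by (simp add: ennreal_mult[symmetric] field_simps del: ennreal_numeral)
    finally show ?thesis .
  qed
  define N where "N = nat \<lceil>1 / \<epsilon>\<rceil>"
  have N: "1 / \<epsilon> \<le> real N" unfolding N_def by (rule real_nat_ceiling_ge)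
  then have N0: "0 < real N" using \<epsilon> by (smt (verit) divide_pos_pos)
  have all: "shift_defect p f h \<le> ennreal (real N powr (p + 1) * (2 powr p * 2 / \<epsilon>)) * ?\<Gamma>" if h: "0 \<le> h" "h \<le> 2" for h
  proof -
    have "h / real N \<le> 2 / real N" using h N0 by (intro divide_right_mono) auto
    also have "2 / real N \<le> 2 * \<epsilon>" using N N0 \<epsilon> by (simp add: field_simps)
    finally have "shift_defect p f (h / real N) \<le> ennreal (2 powr p * 2 / \<epsilon>) * ?\<Gamma>"
      using h N0 by (intro small) auto
    moreover have "shift_defect p f h \<le> ennreal (real N powr (p + 1)) * shift_defect p f (h / real N)"
      using shift_defect_of_nat[OF assms(1) f p0, of N "h / real N"] N0 by simp
    ultimately have "shift_defect p f h \<le> ennreal (real N powr (p + 1)) * (ennreal (2 powr p * 2 / \<epsilon>) * ?\<Gamma>)"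
      by (meson mult_left_mono order_trans zero_le)
    then show ?thesis using \<epsilon> by (subst ennreal_mult) (auto simp: mult.assoc)
  qed
  have "(\<integral>\<^sup>+z. ennreal (\<bar>f z\<bar> powr p) \<partial>circle) \<le> (\<integral>\<^sup>+h. shift_defect p f h \<partial>circle)"
    by (rule nn_integral_powr_le_shift_defect) (use assms in auto)
  also have "\<dots> = (\<integral>\<^sup>+h. shift_defect p f h * indicator {0..<2} h \<partial>lborel)"
    unfolding circle_def by (rule nn_integral_lborel_in) auto
  also have "\<dots> \<le> (\<integral>\<^sup>+h. (ennreal (real N powr (p + 1) * (2 powr p * 2 / \<epsilon>)) * ?\<Gamma>) * indicator {0..<2} (h::real) \<partial>lborel)"
    using all by (intro nn_integral_mono) (auto simp: indicator_def)
  also have "\<dots> = (ennreal (real N powr (p + 1) * (2 powr p * 2 / \<epsilon>)) * ?\<Gamma>) * ennreal 2"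
    by (simp add: nn_integral_cmult)
  also have "\<dots> = (ennreal (real N powr (p + 1) * (2 powr p * 2 / \<epsilon>)) * ennreal 2) * ?\<Gamma>"
    by (simp only: mult_ac)
  also have "ennreal (real N powr (p + 1) * (2 powr p * 2 / \<epsilon>)) * ennreal 2 = ennreal (translation_const p \<epsilon>)"
    using \<epsilon> by (subst ennreal_mult[symmetric]) (auto simp: translation_const_def N_def)
  finally show ?thesis .
qed

text \<open>
  Substitute \<open>y = z + s\<close> and \<open>r = - y - s\<close>. Then the exchange partners
  \<open>z\<close> and \<open>- z - 2 s\<close> become \<open>r + 2 y\<close> and
  \<open>r\<close>, and \<open>r\<close> runs through a full period as \<open>s\<close> does.
\<close>

lemma nn_integral_powr_le_exchange_defect:
  assumes [measurable]: "f \<in> borel_measurable borel" and f: "periodic f" and p: "1 < p" and \<epsilon>: "0 < \<epsilon>"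
    and i: "integrable circle (\<lambda>z. \<bar>f z\<bar> powr p)" and mean: "(\<integral>z. f z \<partial>circle) = 0"
    and W: "{x - \<epsilon><..<x + \<epsilon>} \<subseteq> {0..<2}"
  shows "(\<integral>\<^sup>+z. ennreal (\<bar>f z\<bar> powr p) \<partial>circle) \<le> ennreal (translation_const p \<epsilon>) *
     (\<integral>\<^sup>+s. \<integral>\<^sup>+z. indicator {x - \<epsilon><..<x + \<epsilon>} (wrap (z + s)) * ennreal (\<bar>f (- z - 2 * s) - f z\<bar> powr p) \<partial>circle \<partial>lborel_in {t..t + 2})"
proof -
  let ?W = "{x - \<epsilon><..<x + \<epsilon>}"
  define g where "g s y = indicator ?W (wrap y) * ennreal (\<bar>f (- y - s) - f (y - s)\<bar> powr p)" for s y :: real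
  have [measurable]: "case_prod g \<in> borel_measurable (borel \<Otimes>\<^sub>M borel)" unfolding g_def[abs_def] by measurable
  have 1: "(\<integral>\<^sup>+z. indicator ?W (wrap (z + s)) * ennreal (\<bar>f (- z - 2 * s) - f z\<bar> powr p) \<partial>circle) = (\<integral>\<^sup>+y. g s y \<partial>circle)" for s
  proof -
    have "periodic (g s)"
      unfolding periodic_def
    proof
      fix y
      have "f (- (y + 2) - s) = f (- y - s)" using periodic_of_int[OF f, of "- y - s" "-1"] by (simp add: algebra_simps)
      moreover have "f (y + 2 - s) = f (y - s)" using periodic_of_int[OF f, of "y - s" 1] by (simp add: algebra_simps)
      moreover have "wrap (y + 2) = wrap y" using wrap_add_2 by (simp add: periodic_def)
      ultimately show "g s (y + 2) = g s y" by (simp only: g_def)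
    qed
    from nn_integral_circle_shift[OF _ this, of s] show ?thesis by (simp add: g_def algebra_simps)
  qed
  have 2: "(\<integral>\<^sup>+s. g s y \<partial>lborel_in {t..t + 2}) = indicator ?W (wrap y) * shift_defect p f (2 * y)" for y
  proof -
    define k where "k r = ennreal (\<bar>f (r + 2 * y) - f r\<bar> powr p)" for r
    have [measurable]: "k \<in> borel_measurable borel" unfolding k_def[abs_def] by measurable
    have k: "periodic k" unfolding k_def[abs_def] using f periodic_shift[OF f, of "2 * y"] by (simp add: periodic_def)
    have gk: "g s y = indicator ?W (wrap y) * k (- y - s)" for s
      by (simp add: g_def k_def abs_minus_commute algebra_simps)
    have "(\<integral>\<^sup>+s. g s y \<partial>lborel_in {t..t + 2}) = indicator ?W (wrap y) * (\<integral>\<^sup>+s. k (- y - s) \<partial>lborel_in {t..t + 2})"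
      unfolding gk by (rule nn_integral_cmult) measurable
    also have "(\<integral>\<^sup>+s. k (- y - s) \<partial>lborel_in {t..t + 2}) = (\<integral>\<^sup>+s. k (- y - s) \<partial>circle)"
      by (rule nn_integral_Icc_period) (auto intro: periodic_reflect k)
    also have "\<dots> = (\<integral>\<^sup>+s. k s \<partial>circle)" by (rule nn_integral_circle_reflect) (auto intro: k)
    finally show ?thesis by (simp add: k_def shift_defect_def)
  qed
  have "(\<integral>\<^sup>+s. \<integral>\<^sup>+z. indicator ?W (wrap (z + s)) * ennreal (\<bar>f (- z - 2 * s) - f z\<bar> powr p) \<partial>circle \<partial>lborel_in {t..t + 2})
     = (\<integral>\<^sup>+s. \<integral>\<^sup>+y. g s y \<partial>circle \<partial>lborel_in {t..t + 2})" by (simp add: 1)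
  also have "\<dots> = (\<integral>\<^sup>+y. \<integral>\<^sup>+s. g s y \<partial>lborel_in {t..t + 2} \<partial>circle)"
    by (rule Icc_circle.Fubini'[symmetric]) measurable
  also have "\<dots> = (\<integral>\<^sup>+y. indicator ?W (wrap y) * shift_defect p f (2 * y) \<partial>circle)" by (simp add: 2)
  also have "\<dots> = (\<integral>\<^sup>+y. indicator ?W (wrap y) * shift_defect p f (2 * y) * indicator {0..<2} y \<partial>lborel)"
    unfolding circle_def by (rule nn_integral_lborel_in) auto
  also have "\<dots> = (\<integral>\<^sup>+y. shift_defect p f (2 * y) * indicator ?W y \<partial>lborel)"
    using W by (intro nn_integral_cong) (auto simp: indicator_def wrap_id)
  finally show ?thesis
    using nn_integral_powr_le_window_defect[OF assms(1) f p \<epsilon> i mean, of x] by simp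
qed

section \<open>Dissipation for the exchange equation\<close>

abbreviation spacetime :: "real \<Rightarrow> real \<Rightarrow> (real \<times> real) measure" where
  "spacetime a b \<equiv> lborel_in {a..b} \<Otimes>\<^sub>M circle"

lemma nn_integral_spacetime_mono:
  assumes ab: "{a..b} \<subseteq> {c..d}" and [measurable]: "f \<in> borel_measurable (borel \<Otimes>\<^sub>M borel)"
  shows "(\<integral>\<^sup>+x. f x \<partial>spacetime a b) \<le> (\<integral>\<^sup>+x. f x \<partial>spacetime c d)"
proof -
  have "(\<integral>\<^sup>+x. f x \<partial>spacetime a b) = (\<integral>\<^sup>+s. \<integral>\<^sup>+z. f (s, z) \<partial>circle \<partial>lborel_in {a..b})"
    by (rule circle.nn_integral_fst[symmetric]) measurable
  also have "\<dots> = (\<integral>\<^sup>+s. (\<integral>\<^sup>+z. f (s, z) \<partial>circle) * indicator {a..b} s \<partial>lborel)"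
    by (rule nn_integral_lborel_in) measurable
  also have "\<dots> \<le> (\<integral>\<^sup>+s. (\<integral>\<^sup>+z. f (s, z) \<partial>circle) * indicator {c..d} s \<partial>lborel)"
    using ab by (intro nn_integral_mono) (auto simp: indicator_def)
  also have "\<dots> = (\<integral>\<^sup>+s. \<integral>\<^sup>+z. f (s, z) \<partial>circle \<partial>lborel_in {c..d})"
    by (rule nn_integral_lborel_in[symmetric]) measurable
  also have "\<dots> = (\<integral>\<^sup>+x. f x \<partial>spacetime c d)"
    by (rule circle.nn_integral_fst) measurable
  finally show ?thesis .
qed

lemma emeasure_spacetime_mono:
  assumes "{a..b} \<subseteq> {c..d}" "X \<in> sets (borel \<Otimes>\<^sub>M borel)"
  shows "emeasure (spacetime a b) X \<le> emeasure (spacetime c d) X"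
proof -
  have X: "X \<in> sets (spacetime a b)" "X \<in> sets (spacetime c d)"
    using assms(2) by (simp_all cong: sets_pair_measure_cong)
  show ?thesis
    using nn_integral_spacetime_mono[OF assms(1), of "indicator X"] assms(2)
    by (simp add: nn_integral_indicator[OF X(1)] nn_integral_indicator[OF X(2)])
qed

lemma AE_spacetime_mono:
  assumes ab: "{a..b} \<subseteq> {c..d}" and "AE x in spacetime c d. Q x"
  shows "AE x in spacetime a b. Q x"
proof -
  obtain N where N: "{x \<in> space (spacetime c d). \<not> Q x} \<subseteq> N" "emeasure (spacetime c d) N = 0" "N \<in> sets (spacetime c d)"
    using assms(2) by (rule AE_E)
  have N': "N \<in> sets (borel \<Otimes>\<^sub>M borel)" using N(3) by (simp cong: sets_pair_measure_cong)
  have "emeasure (spacetime a b) N \<le> 0" using emeasure_spacetime_mono[OF ab N'] N(2) by simp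
  then show ?thesis using N N' by (intro AE_I[of _ _ N]) (auto simp: space_pair_measure cong: sets_pair_measure_cong)
qed

lemma integrable_spacetime_mono:
  fixes f :: "real \<times> real \<Rightarrow> real"
  assumes ab: "{a..b} \<subseteq> {c..d}" and f: "f \<in> borel_measurable (borel \<Otimes>\<^sub>M borel)" and i: "integrable (spacetime c d) f"
  shows "integrable (spacetime a b) f"
proof (rule integrableI_bounded)
  have "(\<integral>\<^sup>+x. ennreal (norm (f x)) \<partial>spacetime a b) \<le> (\<integral>\<^sup>+x. ennreal (norm (f x)) \<partial>spacetime c d)"
    using f by (intro nn_integral_spacetime_mono ab) auto
  also have "\<dots> < \<infinity>" using i by (simp add: integrable_iff_bounded)
  finally show "(\<integral>\<^sup>+x. ennreal (norm (f x)) \<partial>spacetime a b) < \<infinity>" .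
  show "f \<in> borel_measurable (spacetime a b)" using f by (simp cong: measurable_cong_sets sets_pair_measure_cong)
qed

lemma finite_measure_spacetime: "finite_measure (spacetime a b)"
  by (rule finite_measure_pair_measure) (rule finite_measure_lborel_in_Icc finite_measure_circle)+

interpretation spacetime: finite_measure "spacetime a b" for a b by (rule finite_measure_spacetime)

lemma spacetime_measurable:
  "f \<in> borel_measurable (borel \<Otimes>\<^sub>M borel) \<Longrightarrow> f \<in> borel_measurable (spacetime a b)"
  by (simp cong: measurable_cong_sets sets_pair_measure_cong)

lemma nn_integral_exchange:
  assumes [measurable]: "case_prod f \<in> borel_measurable (borel \<Otimes>\<^sub>M borel)" and f: "\<And>s. periodic (f s)"
  shows "(\<integral>\<^sup>+(s, z). f s (- z - 2 * s) \<partial>spacetime a b) = (\<integral>\<^sup>+(s, z). f s z \<partial>spacetime a b)"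
proof -
  let ?R = "\<lambda>(s, z). (s, wrap (- z - 2 * s))"
  have m: "?R \<in> spacetime a b \<rightarrow>\<^sub>M spacetime a b" "case_prod f \<in> borel_measurable (spacetime a b)" by measurable
  have e: "(\<lambda>x. case_prod f (?R x)) = (\<lambda>(s, z). f s (- z - 2 * s))"
    by (auto simp: periodic_wrap[OF f])
  show ?thesis using nn_integral_distr[OF m(1), of "case_prod f"] m(2) unfolding distr_exchange e by simp
qed

lemma powr_add_le_mixed:
  assumes "1 < p" "0 \<le> x" "0 \<le> y"
  shows "(x + y) * (x powr (p - 1) + y powr (p - 1)) \<le> 4 * (x powr p + y powr (p::real))"
proof -
  define m where "m = max x y"
  have "x powr (p - 1) \<le> m powr (p - 1)" "y powr (p - 1) \<le> m powr (p - 1)"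
    using assms by (auto simp: m_def intro!: powr_mono2)
  then have "(x + y) * (x powr (p - 1) + y powr (p - 1)) \<le> (2 * m) * (2 * m powr (p - 1))"
    using assms by (intro mult_mono) (auto simp: m_def)
  also have "\<dots> = 4 * (m * m powr (p - 1))" by simp
  also have "m * m powr (p - 1) = m powr p" using assms by (subst powr_mult_base) (auto simp: m_def)
  also have "m powr p \<le> x powr p + y powr p" by (auto simp: m_def max_def)
  finally show ?thesis by simp
qed

text \<open>
  The equation \<open>v\<^sub>t(s,z) = k(s,z) (v(s,-z-2s) - v(s,z))\<close> in integrated form.
  The rate \<open>k = ka + kb\<close> consists of a nonnegative part and a part of size at most
  \<open>\<alpha>\<close>. It is the same at both exchange partners, so the exchange is mutual.
\<close>

locale exchange_evolution =
  fixes p M \<alpha> :: real and v u ka kb :: "real \<Rightarrow> real \<Rightarrow> real"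
  assumes p: "1 < p" and M: "0 \<le> M" and \<alpha>: "0 \<le> \<alpha>"
    and v_measurable [measurable]: "case_prod v \<in> borel_measurable (borel \<Otimes>\<^sub>M borel)"
    and u_measurable [measurable]: "case_prod u \<in> borel_measurable (borel \<Otimes>\<^sub>M borel)"
    and ka_measurable [measurable]: "case_prod ka \<in> borel_measurable (borel \<Otimes>\<^sub>M borel)"
    and kb_measurable [measurable]: "case_prod kb \<in> borel_measurable (borel \<Otimes>\<^sub>M borel)"
    and periodic_v: "periodic (v s)" and periodic_ka: "periodic (ka s)" and periodic_kb: "periodic (kb s)"
    and ka_sym: "ka s (- z - 2 * s) = ka s z" and kb_sym: "kb s (- z - 2 * s) = kb s z"
    and ka_bounds: "0 \<le> ka s z" "ka s z \<le> M" and kb_bound: "\<bar>kb s z\<bar> \<le> \<alpha>"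
    and v_eq: "0 \<le> t \<Longrightarrow> v t z = v 0 z + (LINT s:{0..t}|lborel. u s z)"
    and u_eq: "0 \<le> T \<Longrightarrow> AE (s, z) in spacetime 0 T. u s z = (ka s z + kb s z) * (v s (- z - 2 * s) - v s z)"
    and v_Lp: "0 \<le> T \<Longrightarrow> integrable (spacetime 0 T) (\<lambda>(s, z). \<bar>v s z\<bar> powr p)"
    and v0_Lp: "integrable circle (\<lambda>z. \<bar>v 0 z\<bar> powr p)"
begin

abbreviation v' :: "real \<Rightarrow> real \<Rightarrow> real" where "v' s z \<equiv> v s (- z - 2 * s)"

abbreviation \<phi> :: "real \<Rightarrow> real" where "\<phi> \<equiv> signed_powr (p - 1)"

abbreviation pair_powr :: "real \<Rightarrow> real \<Rightarrow> real" where
  "pair_powr s z \<equiv> \<bar>v' s z\<bar> powr p + \<bar>v s z\<bar> powr p"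

abbreviation gap_powr :: "real \<Rightarrow> real \<Rightarrow> real" where
  "gap_powr s z \<equiv> \<bar>v' s z - v s z\<bar> powr p"

abbreviation dissipation_density :: "real \<Rightarrow> real \<Rightarrow> real" where
  "dissipation_density s z \<equiv> (v' s z - v s z) * (\<phi> (v' s z) - \<phi> (v s z))"

definition energy :: "real \<Rightarrow> real" where
  "energy t = (\<integral>z. \<bar>v t z\<bar> powr p \<partial>circle)"

definition energy_over :: "real \<Rightarrow> real \<Rightarrow> real" where
  "energy_over a b = (\<integral>(s, z). \<bar>v s z\<bar> powr p \<partial>spacetime a b)"

definition dissipation :: "real \<Rightarrow> real \<Rightarrow> real" where
  "dissipation a b = (\<integral>(s, z). ka s z * dissipation_density s z \<partial>spacetime a b)"

lemma energy_nonneg: "0 \<le> energy t"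
  by (simp add: energy_def)

lemma energy_over_nonneg: "0 \<le> energy_over a b"
  by (simp add: energy_over_def split_beta')

lemma exchange_involution: "- (- z - 2 * s) - 2 * s = (z :: real)" by simp

lemma exchange_antisym:
  "(ka s (- z - 2 * s) + kb s (- z - 2 * s)) * (v' s (- z - 2 * s) - v s (- z - 2 * s)) = - ((ka s z + kb s z) * (v' s z - v s z))"
  by (subst ka_sym, subst kb_sym, subst exchange_involution) (simp add: algebra_simps)

lemma period_rules:
  "v s (z + 2) = v s z" "v s (- (z + 2) - 2 * s) = v s (- z - 2 * s)" "ka s (z + 2) = ka s z" "kb s (z + 2) = kb s z"
  using periodic_v[of s] periodic_ka[of s] periodic_kb[of s] periodic_of_int[OF periodic_v[of s], of "- z - 2 * s" "-1"]
  by (simp_all add: periodic_def algebra_simps)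

lemma u_eq_on: "0 \<le> a \<Longrightarrow> AE (s, z) in spacetime a b. u s z = (ka s z + kb s z) * (v' s z - v s z)"
  by (rule AE_spacetime_mono[OF _ u_eq[of "max 0 b"]]) auto

lemma v_Lp_on: "0 \<le> a \<Longrightarrow> integrable (spacetime a b) (\<lambda>(s, z). \<bar>v s z\<bar> powr p)"
  by (rule integrable_spacetime_mono[OF _ _ v_Lp[of "max 0 b"]]) auto

lemma v'_Lp_on:
  assumes "0 \<le> a"
  shows "integrable (spacetime a b) (\<lambda>(s, z). \<bar>v' s z\<bar> powr p)"
    and "(\<integral>(s, z). \<bar>v' s z\<bar> powr p \<partial>spacetime a b) = energy_over a b"
proof -
  have *: "periodic (\<lambda>z. \<bar>v s z\<bar> powr p)" for s by (rule periodic_compose) (rule periodic_v)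
  show "integrable (spacetime a b) (\<lambda>(s, z). \<bar>v' s z\<bar> powr p)"
    using integral_exchange(2)[OF _ *, where a = a and b = b] v_Lp_on[OF assms] by simp
  show "(\<integral>(s, z). \<bar>v' s z\<bar> powr p \<partial>spacetime a b) = energy_over a b"
    using integral_exchange(1)[OF _ *, where a = a and b = b] by (simp add: energy_over_def)
qed

lemma both_Lp_on:
  assumes "0 \<le> a"
  shows "integrable (spacetime a b) (\<lambda>(s, z). pair_powr s z)"
    and "(\<integral>(s, z). pair_powr s z \<partial>spacetime a b) = 2 * energy_over a b"
  using v_Lp_on[OF assms, of b] v'_Lp_on[OF assms, of b]
  by (auto simp: split_beta' energy_over_def Bochner_Integration.integral_add)

lemma integrable_dominated:
  assumes "0 \<le> a" and [measurable]: "case_prod g \<in> borel_measurable (borel \<Otimes>\<^sub>M borel)"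
    and "AE (s, z) in spacetime a b. \<bar>g s z\<bar> \<le> c * pair_powr s z"
  shows "integrable (spacetime a b) (\<lambda>(s, z). g s z)"
proof (rule Bochner_Integration.integrable_bound)
  show "integrable (spacetime a b) (\<lambda>x. c * (case x of (s, z) \<Rightarrow> pair_powr s z))"
    using both_Lp_on[OF assms(1)] by simp
  show "AE x in spacetime a b. norm (case x of (s, z) \<Rightarrow> g s z) \<le> norm (c * (case x of (s, z) \<Rightarrow> pair_powr s z))"
    using assms(3) by eventually_elim (auto simp: split_beta')
qed (use assms(2) in \<open>auto intro: spacetime_measurable\<close>)

lemma mixed_bound: "\<bar>\<phi> x\<bar> * \<bar>y\<bar> \<le> 4 * (\<bar>y\<bar> powr p + \<bar>x\<bar> powr p)"
proof -
  have "\<bar>\<phi> x\<bar> * \<bar>y\<bar> \<le> \<bar>x\<bar> powr (p - 1) * \<bar>y\<bar>" by (intro mult_right_mono abs_signed_powr_le) auto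
  also have "\<dots> \<le> (\<bar>y\<bar> + \<bar>x\<bar>) * (\<bar>y\<bar> powr (p - 1) + \<bar>x\<bar> powr (p - 1))"
    by (simp add: distrib_left distrib_right mult.commute)
  also have "\<dots> \<le> 4 * (\<bar>y\<bar> powr p + \<bar>x\<bar> powr p)" using p by (intro powr_add_le_mixed) auto
  finally show ?thesis .
qed

lemma dissipation_density_bounds:
  "0 \<le> (y - x) * (\<phi> y - \<phi> x)" "(y - x) * (\<phi> y - \<phi> x) \<le> 4 * (\<bar>y\<bar> powr p + \<bar>x\<bar> powr p)"
proof -
  have "\<phi> x \<le> \<phi> y" if "x \<le> y" for x y using that p by (intro signed_powr_mono) auto
  then show "0 \<le> (y - x) * (\<phi> y - \<phi> x)" by (cases "x \<le> y") (auto intro: mult_nonpos_nonpos)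
  have "(y - x) * (\<phi> y - \<phi> x) \<le> \<bar>y - x\<bar> * \<bar>\<phi> y - \<phi> x\<bar>" by (metis abs_ge_self abs_mult)
  also have "\<dots> \<le> (\<bar>y\<bar> + \<bar>x\<bar>) * (\<bar>y\<bar> powr (p - 1) + \<bar>x\<bar> powr (p - 1))"
    using abs_signed_powr_le[of "p - 1" x] abs_signed_powr_le[of "p - 1" y] by (intro mult_mono) linarith+
  also have "\<dots> \<le> 4 * (\<bar>y\<bar> powr p + \<bar>x\<bar> powr p)" using p by (intro powr_add_le_mixed) auto
  finally show "(y - x) * (\<phi> y - \<phi> x) \<le> 4 * (\<bar>y\<bar> powr p + \<bar>x\<bar> powr p)" .
qed

lemma k_bound: "\<bar>ka s z + kb s z\<bar> \<le> M + \<alpha>"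
  using ka_bounds[of s z] kb_bound[of s z] by linarith

lemma u_Lp_on:
  assumes "0 \<le> a" shows "integrable (spacetime a b) (\<lambda>(s, z). \<bar>u s z\<bar> powr p)"
proof (rule integrable_dominated[OF assms, where c = "(M + \<alpha>) powr p * 2 powr p"])
  show "AE (s, z) in spacetime a b. \<bar>\<bar>u s z\<bar> powr p\<bar> \<le> (M + \<alpha>) powr p * 2 powr p * pair_powr s z"
    using u_eq_on[OF assms]
  proof (eventually_elim, clarify)
    fix s z assume u: "u s z = (ka s z + kb s z) * (v' s z - v s z)"
    have "\<bar>u s z\<bar> powr p = \<bar>ka s z + kb s z\<bar> powr p * \<bar>v' s z + - v s z\<bar> powr p"
      by (simp add: u abs_mult powr_mult)
    also have "\<dots> \<le> (M + \<alpha>) powr p * (2 powr p * (\<bar>v' s z\<bar> powr p + \<bar>- v s z\<bar> powr p))"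
      using k_bound[of s z] p by (intro mult_mono abs_add_powr_le powr_mono2) auto
    finally show "\<bar>\<bar>u s z\<bar> powr p\<bar> \<le> (M + \<alpha>) powr p * 2 powr p * pair_powr s z"
      by (simp add: mult_ac)
  qed
qed measurable

lemma u_integrable_on:
  assumes "0 \<le> a" shows "integrable (spacetime a b) (\<lambda>(s, z). u s z)"
proof (rule spacetime.integrable_of_abs_powr)
  show "integrable (spacetime a b) (\<lambda>x. \<bar>case x of (s, z) \<Rightarrow> u s z\<bar> powr p)"
    using u_Lp_on[OF assms] by (simp add: split_beta')
qed (use p in \<open>auto intro: spacetime_measurable\<close>)

lemma AE_set_integrable_u:
  assumes "0 \<le> a" shows "AE z in circle. set_integrable lborel {a..b} (\<lambda>s. u s z)"
proof -
  have "AE z in circle. integrable (lborel_in {a..b}) (\<lambda>s. u s z)"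
    using Icc_circle.AE_integrable_snd[where f = u and a = a and b = b] u_integrable_on[OF assms] by simp
  then show ?thesis by eventually_elim (simp add: integrable_lborel_in)
qed

lemma AE_set_integrable_u_powr:
  assumes "0 \<le> a" shows "AE z in circle. set_integrable lborel {a..b} (\<lambda>s. \<bar>u s z\<bar> powr p)"
proof -
  have "AE z in circle. integrable (lborel_in {a..b}) (\<lambda>s. \<bar>u s z\<bar> powr p)"
    using Icc_circle.AE_integrable_snd[where f = "\<lambda>s z. \<bar>u s z\<bar> powr p" and a = a and b = b] u_Lp_on[OF assms] by simp
  then show ?thesis by eventually_elim (simp add: integrable_lborel_in)
qed

lemma v_increment:
  assumes "0 \<le> a" "a \<le> t" "t \<le> b" "set_integrable lborel {0..b} (\<lambda>s. u s z)"
  shows "v t z = v a z + (LINT s:{a..t}|lborel. u s z)"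
proof -
  have "(LINT s:{a<..t}|lborel. u s z) = (LINT s:{a..t}|lborel. u s z)"
    unfolding set_lebesgue_integral_def
    by (rule integral_cong_AE) (use AE_lborel_singleton[of a] in \<open>auto simp: indicator_def\<close>)
  then show ?thesis
    using set_integral_Icc_append[OF assms(4) assms(1-3)] v_eq[of t z] v_eq[of a z] assms by simp
qed

text \<open>
  The chain rule inequality on almost every characteristic, integrated over the circle.
\<close>

lemma energy_le_work:
  assumes ab: "0 \<le> a" "a \<le> b" and i: "integrable circle (\<lambda>z. \<bar>v a z\<bar> powr p)"
  shows "integrable circle (\<lambda>z. \<bar>v b z\<bar> powr p)"
    and "energy b \<le> energy a + p * (\<integral>(s, z). \<phi> (v s z) * u s z \<partial>spacetime a b)"
    and "integrable (spacetime a b) (\<lambda>(s, z). \<phi> (v s z) * u s z)"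
proof -
  show g: "integrable (spacetime a b) (\<lambda>(s, z). \<phi> (v s z) * u s z)"
  proof (rule integrable_dominated[OF ab(1), where c = "12 * (M + \<alpha>)"])
    show "AE (s, z) in spacetime a b. \<bar>\<phi> (v s z) * u s z\<bar> \<le> 12 * (M + \<alpha>) * pair_powr s z"
      using u_eq_on[OF ab(1)]
    proof (eventually_elim, clarify)
      fix s z assume u: "u s z = (ka s z + kb s z) * (v' s z - v s z)"
      have lin: "X + Y \<le> 12 * (c + d)" if "X \<le> 4 * (c + d)" "Y \<le> 4 * (d + d)" "0 \<le> c" for X Y c d :: real
        using that by simp
      have "\<bar>\<phi> (v s z) * u s z\<bar> = \<bar>ka s z + kb s z\<bar> * (\<bar>\<phi> (v s z)\<bar> * \<bar>v' s z - v s z\<bar>)"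
        by (simp add: u abs_mult mult_ac)
      also have "\<dots> \<le> (M + \<alpha>) * (\<bar>\<phi> (v s z)\<bar> * \<bar>v' s z\<bar> + \<bar>\<phi> (v s z)\<bar> * \<bar>v s z\<bar>)"
        using k_bound M \<alpha> by (intro mult_mono) (auto simp flip: distrib_left intro!: mult_left_mono)
      also have "\<dots> \<le> (M + \<alpha>) * (12 * pair_powr s z)"
        by (intro mult_left_mono lin[OF mixed_bound[of "v s z" "v' s z"] mixed_bound[of "v s z" "v s z"]]) (use M \<alpha> in auto)
      finally show "\<bar>\<phi> (v s z) * u s z\<bar> \<le> 12 * (M + \<alpha>) * pair_powr s z" by (simp only: mult.assoc)
    qed
  qed measurable
  define w where "w z = (\<integral>s. \<phi> (v s z) * u s z \<partial>lborel_in {a..b})" for z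
  have [measurable]: "w \<in> borel_measurable borel" unfolding w_def[abs_def] by measurable
  have w: "integrable circle w" "(\<integral>z. w z \<partial>circle) = (\<integral>(s, z). \<phi> (v s z) * u s z \<partial>spacetime a b)"
    unfolding w_def[abs_def]
    using Icc_circle.integrable_snd[where f = "\<lambda>s z. \<phi> (v s z) * u s z" and a = a and b = b] Icc_circle.integral_snd[where f = "\<lambda>s z. \<phi> (v s z) * u s z" and a = a and b = b] g by simp_all
  have *: "AE z in circle. \<bar>v b z\<bar> powr p \<le> \<bar>v a z\<bar> powr p + p * w z"
    using AE_set_integrable_u[OF order_refl, of b]
  proof eventually_elim
    fix z assume z: "set_integrable lborel {0..b} (\<lambda>s. u s z)"
    have "\<bar>v b z\<bar> powr p \<le> \<bar>v a z\<bar> powr p + p * (LINT s:{a..b}|lborel. \<phi> (v s z) * u s z)"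
    proof (rule abs_powr_indefinite_integral_le(2)[OF p ab(2)])
      show "set_integrable lborel {a..b} (\<lambda>s. u s z)" by (rule set_integrable_subset[OF z]) (use ab in auto)
      show "v t z = v a z + (LINT s:{a..t}|lborel. u s z)" if "t \<in> {a..b}" for t
        using that ab by (intro v_increment[OF _ _ _ z]) auto
    qed
    then show "\<bar>v b z\<bar> powr p \<le> \<bar>v a z\<bar> powr p + p * w z"
      by (simp add: w_def integral_lborel_in)
  qed
  have i2: "integrable circle (\<lambda>z. \<bar>v a z\<bar> powr p + p * w z)" using i w by simp
  show i3: "integrable circle (\<lambda>z. \<bar>v b z\<bar> powr p)"
    by (rule Bochner_Integration.integrable_bound[OF i2]) (use * in \<open>auto elim!: eventually_mono\<close>)
  have "energy b \<le> (\<integral>z. \<bar>v a z\<bar> powr p + p * w z \<partial>circle)"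
    unfolding energy_def by (rule integral_mono_AE[OF i3 i2 *])
  also have "\<dots> = energy a + p * (\<integral>(s, z). \<phi> (v s z) * u s z \<partial>spacetime a b)"
    using i w by (simp add: energy_def)
  finally show "energy b \<le> energy a + p * (\<integral>(s, z). \<phi> (v s z) * u s z \<partial>spacetime a b)" .
qed

lemma energy_integrable: "0 \<le> t \<Longrightarrow> integrable circle (\<lambda>z. \<bar>v t z\<bar> powr p)"
  using energy_le_work(1)[of 0 t] v0_Lp by simp

lemma dissipation_integrable:
  "0 \<le> a \<Longrightarrow> integrable (spacetime a b) (\<lambda>(s, z). ka s z * dissipation_density s z)"
proof (rule integrable_dominated[where c = "M * 4"])
  show "AE (s, z) in spacetime a b. \<bar>ka s z * dissipation_density s z\<bar> \<le> M * 4 * pair_powr s z"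
  proof (rule AE_I2, clarify)
    fix s z
    have "\<bar>ka s z * dissipation_density s z\<bar> = ka s z * dissipation_density s z"
      using ka_bounds dissipation_density_bounds by (subst abs_mult) simp
    also have "\<dots> \<le> M * (4 * pair_powr s z)"
      by (rule mult_mono) (use ka_bounds dissipation_density_bounds M in auto)
    finally show "\<bar>ka s z * dissipation_density s z\<bar> \<le> M * 4 * pair_powr s z" by (simp only: mult.assoc)
  qed
qed measurable

lemma dissipation_nonneg: "0 \<le> dissipation a b"
  unfolding dissipation_def using ka_bounds dissipation_density_bounds by (auto intro!: integral_nonneg_AE simp: split_beta')

text \<open>
  The exchange preserves the measure and reverses the flux. Averaging the work with its image
  under the exchange therefore replaces \<open>\<phi>(v)\<close> by half the difference of its
  values at the two partners, and turns the work of \<open>ka\<close> into minus the dissipation.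
  The work of \<open>kb\<close> has no sign and is bounded by the energy.
\<close>

lemma energy_dissipation:
  assumes ab: "0 \<le> a" "a \<le> b"
  shows "energy b + p / 2 * dissipation a b \<le> energy a + 4 * p * \<alpha> * energy_over a b"
proof -
  define X where "X s z = (v' s z - v s z) * (\<phi> (v' s z) - \<phi> (v s z))" for s z
  have [measurable]: "case_prod X \<in> borel_measurable (borel \<Otimes>\<^sub>M borel)" unfolding X_def[abs_def] by measurable
  have iX: "integrable (spacetime a b) (\<lambda>(s, z). ka s z * X s z)"
    using dissipation_integrable[OF ab(1)] by (simp add: X_def)
  have bX: "\<bar>kb s z * X s z\<bar> \<le> \<alpha> * 4 * pair_powr s z" for s z
  proof -
    have "\<bar>kb s z * X s z\<bar> = \<bar>kb s z\<bar> * X s z"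
      unfolding X_def using dissipation_density_bounds by (subst abs_mult) simp
    also have "\<dots> \<le> \<alpha> * (4 * pair_powr s z)"
      unfolding X_def by (rule mult_mono) (use kb_bound dissipation_density_bounds \<alpha> in auto)
    finally show ?thesis by (simp only: mult.assoc)
  qed
  have iX2: "integrable (spacetime a b) (\<lambda>(s, z). kb s z * X s z)"
    using bX by (intro integrable_dominated[OF ab(1), where c = "\<alpha> * 4"] AE_I2) auto
  define h where "h s z = \<phi> (v s z) * ((ka s z + kb s z) * (v' s z - v s z))" for s z
  have [measurable]: "case_prod h \<in> borel_measurable (borel \<Otimes>\<^sub>M borel)" unfolding h_def[abs_def] by measurable
  have hu: "AE (s, z) in spacetime a b. h s z = \<phi> (v s z) * u s z"
    using u_eq_on[OF ab(1)] by eventually_elim (auto simp: h_def)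
  have W: "energy b \<le> energy a + p * (\<integral>(s, z). \<phi> (v s z) * u s z \<partial>spacetime a b)"
    "integrable (spacetime a b) (\<lambda>(s, z). \<phi> (v s z) * u s z)"
    using energy_le_work[OF ab energy_integrable[OF ab(1)]] by auto
  have ih: "integrable (spacetime a b) (\<lambda>(s, z). h s z)"
    using hu by (intro integrable_cong_AE[THEN iffD2, OF _ _ _ W(2)] spacetime_measurable) (auto simp: split_beta')
  have eh: "(\<integral>(s, z). \<phi> (v s z) * u s z \<partial>spacetime a b) = (\<integral>(s, z). h s z \<partial>spacetime a b)"
    using hu by (intro integral_cong_AE spacetime_measurable) (auto simp: split_beta')
  have ph: "periodic (h s)" for s
    by (simp only: periodic_def h_def period_rules) simp
  note ex = integral_exchange[where f = h, OF _ ph, of a b]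
  have h': "h s (- z - 2 * s) = - (\<phi> (v' s z) * ((ka s z + kb s z) * (v' s z - v s z)))" for s z
    unfolding h_def exchange_antisym by simp
  have sum: "h s (- z - 2 * s) + h s z = - (ka s z * X s z) - kb s z * X s z" for s z
    by (simp only: h') (simp add: h_def X_def algebra_simps)
  have "2 * (\<integral>(s, z). h s z \<partial>spacetime a b) = (\<integral>(s, z). h s (- z - 2 * s) \<partial>spacetime a b) + (\<integral>(s, z). h s z \<partial>spacetime a b)"
    using ex by simp
  also have "\<dots> = (\<integral>(s, z). h s (- z - 2 * s) + h s z \<partial>spacetime a b)"
    using ih ex by (subst Bochner_Integration.integral_add[symmetric]) (auto simp: split_beta')
  also have "\<dots> = - (\<integral>(s, z). ka s z * X s z \<partial>spacetime a b) - (\<integral>(s, z). kb s z * X s z \<partial>spacetime a b)"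
    unfolding sum using iX iX2 by (simp add: split_beta')
  also have "(\<integral>(s, z). ka s z * X s z \<partial>spacetime a b) = dissipation a b" by (simp add: dissipation_def X_def)
  finally have 1: "2 * (\<integral>(s, z). h s z \<partial>spacetime a b) = - dissipation a b - (\<integral>(s, z). kb s z * X s z \<partial>spacetime a b)" .
  have "\<bar>\<integral>(s, z). kb s z * X s z \<partial>spacetime a b\<bar> \<le> (\<integral>(s, z). \<alpha> * 4 * pair_powr s z \<partial>spacetime a b)"
    using both_Lp_on[OF ab(1), of b] bX iX2
    by (intro order_trans[OF integral_abs_bound] integral_mono) (auto simp: split_beta')
  also have "\<dots> = \<alpha> * 4 * (2 * energy_over a b)"
    using both_Lp_on(2)[OF ab(1), of b] by (simp add: split_beta')
  finally have 2: "\<bar>\<integral>(s, z). kb s z * X s z \<partial>spacetime a b\<bar> \<le> 8 * \<alpha> * energy_over a b" by simp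
  have "2 * (\<integral>(s, z). h s z \<partial>spacetime a b) \<le> - dissipation a b + 8 * \<alpha> * energy_over a b" using 1 2 by linarith
  then have "p / 2 * (2 * (\<integral>(s, z). h s z \<partial>spacetime a b)) \<le> p / 2 * (- dissipation a b + 8 * \<alpha> * energy_over a b)"
    using p by (intro mult_left_mono) auto
  then have "p * (\<integral>(s, z). h s z \<partial>spacetime a b) \<le> - (p / 2 * dissipation a b) + 4 * p * \<alpha> * energy_over a b"
    by (simp add: algebra_simps)
  then show ?thesis using W(1) unfolding eh by linarith
qed

lemma energy_measurable [measurable]: "energy \<in> borel_measurable borel"
  unfolding energy_def[abs_def] by measurable

lemma energy_over_eq:
  assumes "0 \<le> a"
  shows "set_integrable lborel {a..b} energy" "energy_over a b = (LINT s:{a..b}|lborel. energy s)"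
proof -
  note fst = Icc_circle.integrable_fst[where f = "\<lambda>s z. \<bar>v s z\<bar> powr p" and a = a and b = b]
    Icc_circle.integral_fst[where f = "\<lambda>s z. \<bar>v s z\<bar> powr p" and a = a and b = b]
  show "set_integrable lborel {a..b} energy"
    using fst(1) v_Lp_on[OF assms, of b] by (simp add: energy_def[abs_def] flip: integrable_lborel_in)
  show "energy_over a b = (LINT s:{a..b}|lborel. energy s)"
    using fst(2) v_Lp_on[OF assms, of b] by (simp add: energy_def[abs_def] energy_over_def flip: integral_lborel_in)
qed

lemma energy_over_mono:
  assumes "0 \<le> a" "a \<le> t" "t \<le> b" shows "energy_over a t \<le> energy_over a b"
proof -
  have "0 \<le> (LINT s:{t<..b}|lborel. energy s)"
    unfolding set_lebesgue_integral_def by (intro integral_nonneg_AE AE_I2) (auto simp: energy_nonneg)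
  then show ?thesis
    using set_integral_Icc_append[OF energy_over_eq(1)[OF assms(1), of b] assms(2,3)] assms by (simp add: energy_over_eq)
qed

text \<open>
  The energy at each time is at most the initial energy plus a small multiple of the time integral
  of the energy. Integrating this bound over the period absorbs the integral on the right, since
  \<open>\<alpha>\<close> is small.
\<close>

lemma energy_growth:
  assumes a: "0 \<le> a" and small: "16 * p * \<alpha> \<le> 1"
  shows "energy_over a (a + 2) \<le> 4 * energy a" and "t \<in> {a..a + 2} \<Longrightarrow> energy t \<le> 2 * energy a"
proof -
  define I where "I = energy_over a (a + 2)"
  have E: "energy t \<le> energy a + I / 4" if t: "t \<in> {a..a + 2}" for t
  proof -
    have "energy t \<le> energy a + 4 * p * \<alpha> * energy_over a t"
      using energy_dissipation[of a t] dissipation_nonneg[of a t] a t p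
      by (smt (verit) atLeastAtMost_iff divide_nonneg_pos mult_nonneg_nonneg)
    also have "4 * p * \<alpha> * energy_over a t \<le> 1 / 4 * I"
      using small p \<alpha> energy_over_mono[of a t "a + 2"] a t energy_over_nonneg unfolding I_def
      by (intro mult_mono) auto
    finally show ?thesis by simp
  qed
  have "I = (LINT s:{a..a + 2}|lborel. energy s)" unfolding I_def by (rule energy_over_eq(2)[OF a])
  also have "\<dots> \<le> (LINT s:{a..a + 2}|lborel. energy a + I / 4)"
    by (rule set_integral_mono) (use E energy_over_eq(1)[OF a] in \<open>auto simp: set_integrable_def\<close>)
  also have "\<dots> = 2 * (energy a + I / 4)" by (simp add: set_integral_const)
  finally have I: "I \<le> 4 * energy a" by simp
  then show "energy_over a (a + 2) \<le> 4 * energy a" by (simp add: I_def)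
  show "t \<in> {a..a + 2} \<Longrightarrow> energy t \<le> 2 * energy a" using E[of t] I by simp
qed

text \<open>
  The flux is odd under the exchange, so its integral vanishes.
\<close>

lemma integral_v_eq:
  assumes t: "0 \<le> t" shows "(\<integral>z. v t z \<partial>circle) = (\<integral>z. v 0 z \<partial>circle)"
proof -
  define q where "q s z = (ka s z + kb s z) * (v' s z - v s z)" for s z
  have [measurable]: "case_prod q \<in> borel_measurable (borel \<Otimes>\<^sub>M borel)" unfolding q_def[abs_def] by measurable
  have pq: "periodic (q s)" for s
    by (simp only: periodic_def q_def period_rules) simp
  have q': "q s (- z - 2 * s) = - q s z" for s z
    unfolding q_def exchange_antisym by simp
  have "(\<integral>(s, z). u s z \<partial>spacetime 0 t) = (\<integral>(s, z). q s z \<partial>spacetime 0 t)"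
    using u_eq_on[OF order_refl, of t] by (intro integral_cong_AE spacetime_measurable) (auto simp: split_beta' q_def)
  moreover have "(\<integral>(s, z). q s z \<partial>spacetime 0 t) = - (\<integral>(s, z). q s z \<partial>spacetime 0 t)"
    using integral_exchange(1)[where f = q and a = 0 and b = t, OF _ pq] by (simp add: q' split_beta')
  ultimately have U0: "(\<integral>(s, z). u s z \<partial>spacetime 0 t) = 0" by simp
  have v0: "integrable circle (v 0)"
    by (rule circle.integrable_of_abs_powr[OF _ _ v0_Lp]) (use p in auto)
  note snd = Icc_circle.integrable_snd[where f = u and a = 0 and b = t] Icc_circle.integral_snd[where f = u and a = 0 and b = t]
  have iu: "integrable circle (\<lambda>z. \<integral>s. u s z \<partial>lborel_in {0..t})" "(\<integral>z. \<integral>s. u s z \<partial>lborel_in {0..t} \<partial>circle) = 0"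
    using snd u_integrable_on[OF order_refl, of t] U0 by simp_all
  have "(\<integral>z. v t z \<partial>circle) = (\<integral>z. v 0 z + (\<integral>s. u s z \<partial>lborel_in {0..t}) \<partial>circle)"
    by (intro Bochner_Integration.integral_cong refl, subst v_eq[OF t]) (simp add: integral_lborel_in)
  also have "\<dots> = (\<integral>z. v 0 z \<partial>circle)" using v0 iu by simp
  finally show ?thesis .
qed

definition exchange_gap :: "real \<Rightarrow> real \<Rightarrow> real" where
  "exchange_gap a b = (\<integral>(s, z). ka s z * gap_powr s z \<partial>spacetime a b)"

lemma gap_powr_le: "gap_powr s z \<le> 2 powr p * pair_powr s z"
  using abs_add_powr_le[of p "v' s z" "- v s z"] p by simp

lemma exchange_gap_integrable:
  assumes "0 \<le> a" shows "integrable (spacetime a b) (\<lambda>(s, z). ka s z * gap_powr s z)"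
proof (rule integrable_dominated[OF assms, where c = "M * 2 powr p"])
  show "AE (s, z) in spacetime a b. \<bar>ka s z * gap_powr s z\<bar> \<le> M * 2 powr p * pair_powr s z"
    using gap_powr_le ka_bounds M by (intro AE_I2) (auto simp: abs_mult mult.assoc intro!: mult_mono)
qed measurable

lemma exchange_gap_le:
  assumes a: "0 \<le> a" and C: "\<And>x y. \<bar>x - y\<bar> powr p \<le> \<eta> * (\<bar>x\<bar> powr p + \<bar>y\<bar> powr p) + C * ((x - y) * (\<phi> x - \<phi> y))"
    and \<eta>: "0 \<le> \<eta>"
  shows "exchange_gap a b \<le> C * dissipation a b + 2 * \<eta> * M * energy_over a b"
proof -
  have "exchange_gap a b \<le> (\<integral>x. C * (case x of (s, z) \<Rightarrow> ka s z * dissipation_density s z)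
      + \<eta> * M * (case x of (s, z) \<Rightarrow> pair_powr s z) \<partial>spacetime a b)"
    unfolding exchange_gap_def
  proof (rule integral_mono)
    show "integrable (spacetime a b) (\<lambda>(s, z). ka s z * gap_powr s z)" by (rule exchange_gap_integrable[OF a])
    show "integrable (spacetime a b) (\<lambda>x. C * (case x of (s, z) \<Rightarrow> ka s z * dissipation_density s z)
      + \<eta> * M * (case x of (s, z) \<Rightarrow> pair_powr s z))"
      using dissipation_integrable[OF a, of b] both_Lp_on(1)[OF a, of b] by simp
    fix x
    obtain s z :: real where x: "x = (s, z)" by fastforce
    have "ka s z * gap_powr s z \<le> ka s z * (\<eta> * pair_powr s z + C * dissipation_density s z)"
      by (intro mult_left_mono C ka_bounds)
    also have "\<dots> = ka s z * (\<eta> * pair_powr s z) + C * (ka s z * dissipation_density s z)"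
      by (simp add: distrib_left mult.left_commute)
    also have "ka s z * (\<eta> * pair_powr s z) \<le> M * (\<eta> * pair_powr s z)"
      using \<eta> ka_bounds by (intro mult_right_mono) auto
    finally show "(case x of (s, z) \<Rightarrow> ka s z * gap_powr s z) \<le> C * (case x of (s, z) \<Rightarrow> ka s z * dissipation_density s z)
      + \<eta> * M * (case x of (s, z) \<Rightarrow> pair_powr s z)"
      by (simp add: x mult_ac)
  qed
  also have "\<dots> = C * dissipation a b + \<eta> * M * (2 * energy_over a b)"
    using dissipation_integrable[OF a, of b] both_Lp_on[OF a, of b] by (simp add: dissipation_def)
  finally show ?thesis by (simp add: mult_ac)
qed

text \<open>
  One factor \<open>ka\<close> is kept for the gap, and the remaining power
  \<open>ka\<^sup>p\<^sup>-\<^sup>1\<close> is bounded by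
  \<open>M\<^sup>p\<^sup>-\<^sup>1\<close>.
\<close>

lemma u_powr_le:
  assumes a: "0 \<le> a"
  shows "(\<integral>(s, z). \<bar>u s z\<bar> powr p \<partial>spacetime a b) \<le>
     2 powr p * (M powr (p - 1) * exchange_gap a b + \<alpha> powr p * (2 powr p * (2 * energy_over a b)))"
proof -
  have "(\<integral>(s, z). \<bar>u s z\<bar> powr p \<partial>spacetime a b) \<le> (\<integral>x. 2 powr p * (M powr (p - 1) * (case x of (s, z) \<Rightarrow> ka s z * gap_powr s z)
      + \<alpha> powr p * (2 powr p * (case x of (s, z) \<Rightarrow> pair_powr s z))) \<partial>spacetime a b)"
  proof (rule integral_mono_AE)
    show "integrable (spacetime a b) (\<lambda>(s, z). \<bar>u s z\<bar> powr p)" by (rule u_Lp_on[OF a])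
    show "integrable (spacetime a b) (\<lambda>x. 2 powr p * (M powr (p - 1) * (case x of (s, z) \<Rightarrow> ka s z * gap_powr s z)
      + \<alpha> powr p * (2 powr p * (case x of (s, z) \<Rightarrow> pair_powr s z))))"
      using exchange_gap_integrable[OF a, of b] both_Lp_on(1)[OF a, of b] by simp
    show "AE x in spacetime a b. (case x of (s, z) \<Rightarrow> \<bar>u s z\<bar> powr p) \<le> 2 powr p * (M powr (p - 1) * (case x of (s, z) \<Rightarrow> ka s z * gap_powr s z)
      + \<alpha> powr p * (2 powr p * (case x of (s, z) \<Rightarrow> pair_powr s z)))"
      using u_eq_on[OF a]
    proof (eventually_elim, clarify)
      fix s z assume u: "u s z = (ka s z + kb s z) * (v' s z - v s z)"
      let ?g = "gap_powr s z"
      have "\<bar>u s z\<bar> powr p = \<bar>ka s z * (v' s z - v s z) + kb s z * (v' s z - v s z)\<bar> powr p"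
        by (simp add: u distrib_right)
      also have "\<dots> \<le> 2 powr p * (\<bar>ka s z * (v' s z - v s z)\<bar> powr p + \<bar>kb s z * (v' s z - v s z)\<bar> powr p)"
        using p by (intro abs_add_powr_le) auto
      also have "\<bar>ka s z * (v' s z - v s z)\<bar> powr p = (ka s z * ka s z powr (p - 1)) * ?g"
        using ka_bounds(1)[of s z] by (simp add: abs_mult powr_mult powr_mult_base)
      also have "\<dots> \<le> (ka s z * M powr (p - 1)) * ?g"
        using ka_bounds[of s z] p by (intro mult_right_mono mult_left_mono powr_mono2) auto
      also have "\<bar>kb s z * (v' s z - v s z)\<bar> powr p = \<bar>kb s z\<bar> powr p * ?g" by (simp add: abs_mult powr_mult)
      also have "\<dots> \<le> \<alpha> powr p * (2 powr p * pair_powr s z)"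
        using kb_bound[of s z] p gap_powr_le by (intro mult_mono powr_mono2) auto
      finally show "\<bar>u s z\<bar> powr p \<le> 2 powr p * (M powr (p - 1) * (ka s z * ?g) + \<alpha> powr p * (2 powr p * pair_powr s z))"
        by (simp add: mult_ac)
    qed
  qed
  also have "\<dots> = 2 powr p * (M powr (p - 1) * exchange_gap a b + \<alpha> powr p * (2 powr p * (2 * energy_over a b)))"
    using exchange_gap_integrable[OF a, of b] both_Lp_on[OF a, of b] by (simp add: exchange_gap_def)
  finally show ?thesis .
qed

text \<open>
  Jensen's inequality in time: on each characteristic, \<open>v\<close> moves by the integral of
  \<open>u\<close> over an interval of length at most \<open>2\<close>.
\<close>

lemma displacement_le:
  assumes a: "0 \<le> a"
  shows "(\<integral>\<^sup>+(s, z). ennreal (\<bar>v s z - v a z\<bar> powr p) \<partial>spacetime a (a + 2)) \<le>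
    ennreal (2 powr p * (\<integral>(s, z). \<bar>u s z\<bar> powr p \<partial>spacetime a (a + 2)))"
proof -
  define w where "w z = (\<integral>s. \<bar>u s z\<bar> powr p \<partial>lborel_in {a..a + 2})" for z
  note snd = Icc_circle.integrable_snd[where f = "\<lambda>s z. \<bar>u s z\<bar> powr p" and a = a and b = "a + 2"]
    Icc_circle.integral_snd[where f = "\<lambda>s z. \<bar>u s z\<bar> powr p" and a = a and b = "a + 2"]
  have w: "integrable circle w" "(\<integral>z. w z \<partial>circle) = (\<integral>(s, z). \<bar>u s z\<bar> powr p \<partial>spacetime a (a + 2))"
    using snd u_Lp_on[OF a, of "a + 2"] by (simp_all add: w_def[abs_def])
  have w0: "0 \<le> w z" for z by (simp add: w_def)
  have pw: "AE z in circle. \<forall>s\<in>{a..a + 2}. \<bar>v s z - v a z\<bar> powr p \<le> 2 powr (p - 1) * w z"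
    using AE_set_integrable_u[OF order_refl, of "a + 2"] AE_set_integrable_u_powr[OF a, of "a + 2"]
  proof (eventually_elim, intro ballI)
    fix z s assume z: "set_integrable lborel {0..a + 2} (\<lambda>s. u s z)" "set_integrable lborel {a..a + 2} (\<lambda>s. \<bar>u s z\<bar> powr p)"
      and s: "s \<in> {a..a + 2}"
    have i: "set_integrable lborel {a..s} (\<lambda>s. \<bar>u s z\<bar> powr p)"
      by (rule set_integrable_subset[OF z(2)]) (use s in auto)
    have "\<bar>v s z - v a z\<bar> powr p = \<bar>\<integral>r. u r z \<partial>lborel_in {a..s}\<bar> powr p"
      using v_increment[OF a _ _ z(1), of s] s by (simp add: integral_lborel_in)
    also have "\<dots> \<le> (s - a) powr (p - 1) * (\<integral>r. \<bar>u r z\<bar> powr p \<partial>lborel_in {a..s})"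
      using Icc.abs_integral_powr_le[OF p, where f = "\<lambda>r. u r z" and a = a and b = s] i s
      by (simp add: integrable_lborel_in measure_lborel_in_Icc)
    also have "\<dots> \<le> 2 powr (p - 1) * w z"
    proof (rule mult_mono)
      show "(s - a) powr (p - 1) \<le> 2 powr (p - 1)" using s p by (intro powr_mono2) auto
      have "(LINT r:{a..a + 2}|lborel. \<bar>u r z\<bar> powr p) = (LINT r:{a..s}|lborel. \<bar>u r z\<bar> powr p) + (LINT r:{s<..a + 2}|lborel. \<bar>u r z\<bar> powr p)"
        by (rule set_integral_Icc_append[OF z(2)]) (use s in auto)
      moreover have "0 \<le> (LINT r:{s<..a + 2}|lborel. \<bar>u r z\<bar> powr p)"
        unfolding set_lebesgue_integral_def by (intro integral_nonneg_AE AE_I2) auto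
      ultimately show "(\<integral>r. \<bar>u r z\<bar> powr p \<partial>lborel_in {a..s}) \<le> w z"
        by (simp add: w_def integral_lborel_in)
    qed auto
    finally show "\<bar>v s z - v a z\<bar> powr p \<le> 2 powr (p - 1) * w z" .
  qed
  have "(\<integral>\<^sup>+(s, z). ennreal (\<bar>v s z - v a z\<bar> powr p) \<partial>spacetime a (a + 2)) =
      (\<integral>\<^sup>+z. \<integral>\<^sup>+s. ennreal (\<bar>v s z - v a z\<bar> powr p) \<partial>lborel_in {a..a + 2} \<partial>circle)"
    by (subst Icc_circle.nn_integral_snd[symmetric]) (auto simp: split_beta')
  also have "\<dots> \<le> (\<integral>\<^sup>+z. ennreal (2 powr p * w z) \<partial>circle)"
  proof (rule nn_integral_mono_AE, use pw in eventually_elim)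
    fix z assume z: "\<forall>s\<in>{a..a + 2}. \<bar>v s z - v a z\<bar> powr p \<le> 2 powr (p - 1) * w z"
    have "(\<integral>\<^sup>+s. ennreal (\<bar>v s z - v a z\<bar> powr p) \<partial>lborel_in {a..a + 2}) =
        (\<integral>\<^sup>+s. ennreal (\<bar>v s z - v a z\<bar> powr p) * indicator {a..a + 2} s \<partial>lborel)"
      by (rule nn_integral_lborel_in) auto
    also have "\<dots> \<le> (\<integral>\<^sup>+s. ennreal (2 powr (p - 1) * w z) * indicator {a..a + 2} s \<partial>lborel)"
      using z by (intro nn_integral_mono) (auto simp: indicator_def intro!: ennreal_leI)
    also have "\<dots> = ennreal (2 powr (p - 1) * w z) * ennreal 2" by (simp add: nn_integral_cmult)
    also have "\<dots> = ennreal (2 powr p * w z)"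
      using w0[of z] powr_mult_base[of 2 "p - 1"] by (subst ennreal_mult[symmetric]) (auto simp: mult_ac)
    finally show "(\<integral>\<^sup>+s. ennreal (\<bar>v s z - v a z\<bar> powr p) \<partial>lborel_in {a..a + 2}) \<le> ennreal (2 powr p * w z)" .
  qed
  also have "\<dots> = ennreal (\<integral>z. 2 powr p * w z \<partial>circle)"
    using w w0 by (intro nn_integral_eq_integral) auto
  finally show ?thesis using w by simp
qed

text \<open>
  Compare \<open>v a\<close> at \<open>- z - 2 s\<close> and at \<open>z\<close> through their
  values at time \<open>s\<close>. Each of them differs from its value at time \<open>s\<close> by
  a displacement, and at time \<open>s\<close> the gap between the partners is controlled by the
  weighted gap, because \<open>\<mu> \<le> ka\<close> in the window. So \<open>v a\<close> has a
  small exchange defect, and it has mean zero.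
\<close>

lemma energy_le_gaps:
  assumes a: "0 \<le> a" and \<mu>: "0 < \<mu>" and \<epsilon>: "0 < \<epsilon>" and W: "{x - \<epsilon><..<x + \<epsilon>} \<subseteq> {0..<2}"
    and window: "AE (s, z) in spacetime a (a + 2). wrap (z + s) \<in> {x - \<epsilon><..<x + \<epsilon>} \<longrightarrow> \<mu> \<le> ka s z"
    and mean: "(\<integral>z. v 0 z \<partial>circle) = 0"
  shows "energy a \<le> translation_const p \<epsilon> * (4 powr p * (2 * (2 powr p * (\<integral>(s, z). \<bar>u s z\<bar> powr p \<partial>spacetime a (a + 2))) + exchange_gap a (a + 2) / \<mu>))"
proof -
  let ?W = "{x - \<epsilon><..<x + \<epsilon>}" and ?P = "spacetime a (a + 2)"
  define U where "U = (\<integral>(s, z). \<bar>u s z\<bar> powr p \<partial>?P)"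
  have U0: "0 \<le> U" by (simp add: U_def split_beta')
  have G0: "0 \<le> exchange_gap a (a + 2)" using ka_bounds by (auto simp: exchange_gap_def split_beta' intro!: integral_nonneg_AE)
  have T0: "0 < translation_const p \<epsilon>" by (rule translation_const_pos[OF \<epsilon>])
  define d where "d s z = ennreal (\<bar>v s z - v a z\<bar> powr p)" for s z
  have [measurable]: "case_prod d \<in> borel_measurable (borel \<Otimes>\<^sub>M borel)" unfolding d_def[abs_def] by measurable
  define e where "e s z = ennreal (\<bar>v' s z - v a (- z - 2 * s)\<bar> powr p)" for s z
  have [measurable]: "case_prod e \<in> borel_measurable (borel \<Otimes>\<^sub>M borel)" unfolding e_def[abs_def] by measurable
  define g where "g s z = ennreal (ka s z * gap_powr s z / \<mu>)" for s z
  have [measurable]: "case_prod g \<in> borel_measurable (borel \<Otimes>\<^sub>M borel)" unfolding g_def[abs_def] by measurable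
  have pd: "periodic (d s)" for s unfolding d_def[abs_def] using periodic_v[of s] periodic_v[of a] by (simp add: periodic_def)
  have ed: "(\<integral>\<^sup>+(s, z). e s z \<partial>?P) = (\<integral>\<^sup>+(s, z). d s z \<partial>?P)"
    using nn_integral_exchange[where f = d and a = a and b = "a + 2", OF _ pd] by (simp add: d_def e_def)
  have dU: "(\<integral>\<^sup>+(s, z). d s z \<partial>?P) \<le> ennreal (2 powr p * U)"
    using displacement_le[OF a] by (simp add: d_def U_def)
  have gG: "(\<integral>\<^sup>+(s, z). g s z \<partial>?P) = ennreal (exchange_gap a (a + 2) / \<mu>)"
  proof -
    have "(\<integral>\<^sup>+(s, z). g s z \<partial>?P) = (\<integral>\<^sup>+x. ennreal ((case x of (s, z) \<Rightarrow> ka s z * gap_powr s z) / \<mu>) \<partial>?P)"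
      by (simp add: g_def split_beta')
    also have "\<dots> = ennreal (\<integral>x. (case x of (s, z) \<Rightarrow> ka s z * gap_powr s z) / \<mu> \<partial>?P)"
      using exchange_gap_integrable[OF a, of "a + 2"] ka_bounds \<mu> by (intro nn_integral_eq_integral) (auto simp: split_beta')
    finally show ?thesis by (simp add: exchange_gap_def)
  qed
  have combine: "ennreal c * (ennreal x + ennreal x + ennreal y) = ennreal (c * (2 * x + y))" if "0 \<le> c" "0 \<le> x" "0 \<le> y" for c x y
    using that by (simp flip: ennreal_plus ennreal_mult)
  have pa: "periodic (v a)" by (rule periodic_v)
  have ia: "integrable circle (\<lambda>z. \<bar>v a z\<bar> powr p)" by (rule energy_integrable[OF a])
  have ma: "(\<integral>z. v a z \<partial>circle) = 0" using integral_v_eq[OF a] mean by simp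
  have "ennreal (energy a) = (\<integral>\<^sup>+z. ennreal (\<bar>v a z\<bar> powr p) \<partial>circle)"
    unfolding energy_def by (rule nn_integral_eq_integral[symmetric, OF ia]) auto
  also have "\<dots> \<le> ennreal (translation_const p \<epsilon>) *
     (\<integral>\<^sup>+s. \<integral>\<^sup>+z. indicator ?W (wrap (z + s)) * ennreal (\<bar>v a (- z - 2 * s) - v a z\<bar> powr p) \<partial>circle \<partial>lborel_in {a..a + 2})"
    by (rule nn_integral_powr_le_exchange_defect[OF _ pa p \<epsilon> ia ma W]) measurable
  also have "(\<integral>\<^sup>+s. \<integral>\<^sup>+z. indicator ?W (wrap (z + s)) * ennreal (\<bar>v a (- z - 2 * s) - v a z\<bar> powr p) \<partial>circle \<partial>lborel_in {a..a + 2})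
     = (\<integral>\<^sup>+(s, z). indicator ?W (wrap (z + s)) * ennreal (\<bar>v a (- z - 2 * s) - v a z\<bar> powr p) \<partial>?P)"
    by (subst circle.nn_integral_fst[symmetric]) (auto simp: split_beta')
  also have "\<dots> \<le> (\<integral>\<^sup>+x. ennreal (4 powr p) * (case_prod d x + case_prod e x + case_prod g x) \<partial>?P)"
  proof (rule nn_integral_mono_AE, use window in eventually_elim)
    fix x' :: "real \<times> real" assume "case x' of (s, z) \<Rightarrow> wrap (z + s) \<in> ?W \<longrightarrow> \<mu> \<le> ka s z"
    moreover obtain s z where x': "x' = (s, z)" by fastforce
    ultimately have w: "wrap (z + s) \<in> ?W \<longrightarrow> \<mu> \<le> ka s z" by simp
    have "indicator ?W (wrap (z + s)) * ennreal (\<bar>v a (- z - 2 * s) - v a z\<bar> powr p)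
       \<le> ennreal (4 powr p) * (d s z + e s z + g s z)"
    proof (cases "wrap (z + s) \<in> ?W")
      case True
      define x1 x2 x3 where "x1 = v s z - v a z" and "x2 = - (v' s z - v a (- z - 2 * s))" and "x3 = v' s z - v s z"
      have "\<mu> * \<bar>x3\<bar> powr p \<le> ka s z * \<bar>x3\<bar> powr p" using True w by (intro mult_right_mono) auto
      then have x3: "\<bar>x3\<bar> powr p \<le> ka s z * \<bar>x3\<bar> powr p / \<mu>" using \<mu> by (simp add: field_simps)
      have "v a (- z - 2 * s) - v a z = (x1 + x2) + x3" by (simp add: x1_def x2_def x3_def)
      then have "\<bar>v a (- z - 2 * s) - v a z\<bar> powr p = \<bar>(x1 + x2) + x3\<bar> powr p" by (simp only:)
      also have "\<dots> \<le> 2 powr p * (\<bar>x1 + x2\<bar> powr p + \<bar>x3\<bar> powr p)" using p by (intro abs_add_powr_le) auto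
      also have "\<dots> \<le> 2 powr p * (2 powr p * (\<bar>x1\<bar> powr p + \<bar>x2\<bar> powr p) + 2 powr p * \<bar>x3\<bar> powr p)"
      proof (intro mult_left_mono add_mono abs_add_powr_le)
        have "1 powr p \<le> 2 powr p" using p by (intro powr_mono2) auto
        then show "\<bar>x3\<bar> powr p \<le> 2 powr p * \<bar>x3\<bar> powr p" using mult_right_mono[of 1 "2 powr p" "\<bar>x3\<bar> powr p"] by simp
      qed (use p in auto)
      also have "\<dots> = (2 powr p * 2 powr p) * (\<bar>x1\<bar> powr p + \<bar>x2\<bar> powr p + \<bar>x3\<bar> powr p)" by (simp add: algebra_simps)
      also have "2 powr p * 2 powr p = (4::real) powr p" by (simp flip: powr_mult)
      finally have "\<bar>v a (- z - 2 * s) - v a z\<bar> powr p \<le> 4 powr p * (\<bar>x1\<bar> powr p + \<bar>x2\<bar> powr p + ka s z * \<bar>x3\<bar> powr p / \<mu>)"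
        using x3 by (smt (verit) mult_left_mono powr_ge_zero)
      then have "ennreal (\<bar>v a (- z - 2 * s) - v a z\<bar> powr p) \<le> ennreal (4 powr p * (\<bar>x1\<bar> powr p + \<bar>x2\<bar> powr p + ka s z * \<bar>x3\<bar> powr p / \<mu>))"
        by (rule ennreal_leI)
      also have "\<dots> = ennreal (4 powr p) * (d s z + e s z + g s z)"
        using ka_bounds(1)[of s z] \<mu> abs_minus_commute[of "v' s z"]
        unfolding d_def e_def g_def x1_def x2_def x3_def
        by (simp add: ennreal_mult ennreal_plus)
      finally show ?thesis using True by simp
    qed simp
    then show "(case x' of (s, z) \<Rightarrow> indicator ?W (wrap (z + s)) * ennreal (\<bar>v a (- z - 2 * s) - v a z\<bar> powr p))
       \<le> ennreal (4 powr p) * (case_prod d x' + case_prod e x' + case_prod g x')"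
      by (simp add: x')
  qed
  also have "\<dots> = ennreal (4 powr p) * ((\<integral>\<^sup>+(s, z). d s z \<partial>?P) + (\<integral>\<^sup>+(s, z). e s z \<partial>?P) + (\<integral>\<^sup>+(s, z). g s z \<partial>?P))"
    by (simp add: nn_integral_cmult nn_integral_add spacetime_measurable)
  also have "\<dots> \<le> ennreal (4 powr p) * (ennreal (2 powr p * U) + ennreal (2 powr p * U) + ennreal (exchange_gap a (a + 2) / \<mu>))"
    using dU ed gG by (intro mult_left_mono add_mono) auto
  also have "\<dots> = ennreal (4 powr p * (2 * (2 powr p * U) + exchange_gap a (a + 2) / \<mu>))"
    by (rule combine) (use U0 G0 \<mu> in auto)
  finally have "ennreal (energy a) \<le> ennreal (translation_const p \<epsilon>) * ennreal (4 powr p * (2 * (2 powr p * U) + exchange_gap a (a + 2) / \<mu>))"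
    by (simp add: mult_left_mono)
  also have "\<dots> = ennreal (translation_const p \<epsilon> * (4 powr p * (2 * (2 powr p * U) + exchange_gap a (a + 2) / \<mu>)))"
    using U0 G0 \<mu> T0 by (intro ennreal_mult[symmetric]) auto
  finally show ?thesis
    unfolding U_def[symmetric] using U0 G0 \<mu> T0 by (subst (asm) ennreal_le_iff) auto
qed

end


section \<open>Contraction over one period\<close>

text \<open>
  With \<open>E\<close> and \<open>E'\<close> the energies at the two ends of the period and
  \<open>G\<close> the exchange gap, the preceding lemmas give \<open>E \<le> Q G + R
  \<alpha>\<^sup>p E\<close> and \<open>G \<le> C (2/p) (E - E') + 32 C \<alpha> E + 8 \<eta> M
  E\<close>, where \<open>C\<close> depends on \<open>\<eta>\<close>. First \<open>\<eta>\<close>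
  is chosen so that its term contributes at most \<open>E/4\<close>; this fixes \<open>C\<close>.
  Then \<open>\<alpha>\<close> is chosen so that its two terms contribute at most
  \<open>E/8\<close> each. There remains \<open>E/2 \<le> Q C (2/p) (E - E')\<close>.
\<close>

theorem exchange_contraction:
  fixes p M \<mu> \<epsilon> :: real
  assumes p: "1 < p" and M: "0 \<le> M" and \<mu>: "0 < \<mu>" and \<epsilon>: "0 < \<epsilon>"
  shows "\<exists>\<alpha>>0. \<exists>\<delta>>0. \<delta> < 1 \<and>
    (\<forall>v u ka kb x a. exchange_evolution p M \<alpha> v u ka kb \<longrightarrow> {x - \<epsilon><..<x + \<epsilon>} \<subseteq> {0..<2} \<longrightarrow> 0 \<le> a \<longrightarrow>
      (AE (s, z) in spacetime a (a + 2). wrap (z + s) \<in> {x - \<epsilon><..<x + \<epsilon>} \<longrightarrow> \<mu> \<le> ka s z) \<longrightarrow>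
      (\<integral>z. v 0 z \<partial>circle) = 0 \<longrightarrow>
      exchange_evolution.energy p v (a + 2) \<le> (1 - \<delta>) * exchange_evolution.energy p v a \<and>
      (\<forall>t\<in>{a..a + 2}. exchange_evolution.energy p v t \<le> 2 * exchange_evolution.energy p v a))"
proof -
  define T where "T = translation_const p \<epsilon> * 4 powr p"
  have T: "0 < T" using translation_const_pos[OF \<epsilon>, of p] by (simp add: T_def)
  define Q where "Q = T * (2 * (2 powr p * (2 powr p * M powr (p - 1))) + 1 / \<mu>)"
  have Q: "0 < Q" unfolding Q_def using T \<mu> by (intro mult_pos_pos add_nonneg_pos) auto
  define R where "R = T * (2 * (2 powr p * (2 powr p * (2 powr p * 8))))"
  have R: "0 < R" unfolding R_def using T by (intro mult_pos_pos) auto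
  define \<eta> where "\<eta> = 1 / (1 + 32 * Q * M)"
  have \<eta>: "0 < \<eta>" unfolding \<eta>_def using Q M by (intro divide_pos_pos add_pos_nonneg) auto
  have \<eta>Q: "Q * (8 * \<eta> * M) \<le> 1 / 4"
    using Q M by (simp add: \<eta>_def divide_simps add_pos_nonneg mult_ac)
  obtain C where C: "0 < C" "\<And>x y. \<bar>x - y\<bar> powr p \<le> \<eta> * (\<bar>x\<bar> powr p + \<bar>y\<bar> powr p) + C * ((x - y) * (signed_powr (p - 1) x - signed_powr (p - 1) y))"
    using abs_diff_powr_le_dissipation[OF p \<eta>] by blast
  define \<alpha> where "\<alpha> = min (min 1 (1 / (16 * p))) (min (1 / (256 * C * Q)) (1 / (8 * R)))"
  have \<alpha>: "0 < \<alpha>" using C Q R p by (simp add: \<alpha>_def)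
  have \<alpha>1: "\<alpha> \<le> 1" "\<alpha> \<le> 1 / (16 * p)" "\<alpha> \<le> 1 / (256 * C * Q)" "\<alpha> \<le> 1 / (8 * R)" by (auto simp: \<alpha>_def)
  have \<alpha>p: "16 * p * \<alpha> \<le> 1" using \<alpha>1(2) p by (simp add: field_simps)
  have \<alpha>C: "C * Q * (32 * \<alpha>) \<le> 1 / 8" using \<alpha>1(3) C Q by (simp add: field_simps)
  have "\<alpha> powr p \<le> \<alpha> powr 1" using \<alpha> \<alpha>1 p by (intro powr_mono') auto
  then have "R * \<alpha> powr p \<le> R * \<alpha>" using \<alpha> R by (intro mult_left_mono) auto
  moreover have "R * \<alpha> \<le> 1 / 8" using \<alpha>1(4) R by (simp add: field_simps)
  ultimately have \<alpha>R: "R * \<alpha> powr p \<le> 1 / 8" by linarith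
  define \<delta> where "\<delta> = min (1 / 2) (p / (4 * C * Q))"
  have \<delta>: "0 < \<delta>" "\<delta> < 1" using p C Q by (auto simp: \<delta>_def)
  have \<delta>C: "\<delta> * (C * Q * (2 / p)) \<le> 1 / 2"
  proof -
    have "\<delta> * (C * Q * (2 / p)) \<le> p / (4 * C * Q) * (C * Q * (2 / p))"
      using C Q p by (intro mult_right_mono) (auto simp: \<delta>_def)
    also have "\<dots> = 1 / 2" using C Q p by simp
    finally show ?thesis .
  qed
  have main: "exchange_evolution.energy p v (a + 2) \<le> (1 - \<delta>) * exchange_evolution.energy p v a \<and>
      (\<forall>t\<in>{a..a + 2}. exchange_evolution.energy p v t \<le> 2 * exchange_evolution.energy p v a)"
    if ev: "exchange_evolution p M \<alpha> v u ka kb" and W: "{x - \<epsilon><..<x + \<epsilon>} \<subseteq> {0..<2}" and a: "0 \<le> a"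
      and window: "AE (s, z) in spacetime a (a + 2). wrap (z + s) \<in> {x - \<epsilon><..<x + \<epsilon>} \<longrightarrow> \<mu> \<le> ka s z"
      and mean: "(\<integral>z. v 0 z \<partial>circle) = 0" for v u ka kb x a
  proof -
    interpret exchange_evolution p M \<alpha> v u ka kb by (rule ev)
    define E where "E = energy a"
    define E' where "E' = energy (a + 2)"
    define I where "I = energy_over a (a + 2)"
    define D where "D = dissipation a (a + 2)"
    define G where "G = exchange_gap a (a + 2)"
    define U where "U = (\<integral>(s, z). \<bar>u s z\<bar> powr p \<partial>spacetime a (a + 2))"
    have I: "I \<le> 4 * E" unfolding I_def E_def by (rule energy_growth(1)[OF a \<alpha>p])
    have D: "p / 2 * D \<le> E - E' + 16 * p * \<alpha> * E"
    proof -
      have "E' + p / 2 * D \<le> E + 4 * p * \<alpha> * I"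
        unfolding E_def E'_def D_def I_def by (rule energy_dissipation) (use a in auto)
      also have "4 * p * \<alpha> * I \<le> 4 * p * \<alpha> * (4 * E)" using p \<alpha> I by (intro mult_left_mono) auto
      finally show ?thesis by simp
    qed
    have "2 / p * (p / 2 * D) \<le> 2 / p * (E - E' + 16 * p * \<alpha> * E)" using p D by (intro mult_left_mono) auto
    then have D: "D \<le> 2 / p * (E - E') + 32 * \<alpha> * E" using p by (simp add: field_simps)
    have "G \<le> C * D + 2 * \<eta> * M * I"
      unfolding G_def D_def I_def by (rule exchange_gap_le[OF a C(2)]) (use \<eta> in auto)
    also have "\<dots> \<le> C * (2 / p * (E - E') + 32 * \<alpha> * E) + 2 * \<eta> * M * (4 * E)"
      using C D I \<eta> M by (intro add_mono mult_left_mono) auto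
    finally have G: "G \<le> C * (2 / p * (E - E')) + C * (32 * \<alpha>) * E + 8 * \<eta> * M * E" by (simp add: algebra_simps)
    have "U \<le> 2 powr p * (M powr (p - 1) * G + \<alpha> powr p * (2 powr p * (2 * I)))"
      unfolding U_def G_def I_def by (rule u_powr_le[OF a])
    also have "\<dots> \<le> 2 powr p * (M powr (p - 1) * G + \<alpha> powr p * (2 powr p * (2 * (4 * E))))"
      using I by (intro mult_left_mono add_left_mono) auto
    finally have U: "U \<le> 2 powr p * (M powr (p - 1) * G + \<alpha> powr p * (2 powr p * (8 * E)))" by simp
    have "E \<le> translation_const p \<epsilon> * (4 powr p * (2 * (2 powr p * U) + G / \<mu>))"
      unfolding E_def U_def G_def by (rule energy_le_gaps[OF a \<mu> \<epsilon> W window mean])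
    also have "\<dots> = T * (2 * (2 powr p * U) + G / \<mu>)" by (simp add: T_def)
    also have "\<dots> \<le> T * (2 * (2 powr p * (2 powr p * (M powr (p - 1) * G + \<alpha> powr p * (2 powr p * (8 * E))))) + G / \<mu>)"
      using U T by (intro mult_left_mono add_right_mono) auto
    also have "\<dots> = Q * G + R * \<alpha> powr p * E" by (simp add: Q_def R_def algebra_simps)
    also have "Q * G \<le> Q * (C * (2 / p * (E - E')) + C * (32 * \<alpha>) * E + 8 * \<eta> * M * E)"
      using G Q by (intro mult_left_mono) auto
    also have "\<dots> = C * Q * (2 / p) * (E - E') + (C * Q * (32 * \<alpha>)) * E + (Q * (8 * \<eta> * M)) * E" by (simp add: algebra_simps)
    finally have "E \<le> C * Q * (2 / p) * (E - E') + (C * Q * (32 * \<alpha>)) * E + (Q * (8 * \<eta> * M)) * E + R * \<alpha> powr p * E" by simp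
    moreover have E0: "0 \<le> E" by (simp add: E_def energy_nonneg)
    have "(C * Q * (32 * \<alpha>)) * E \<le> 1 / 8 * E" "(Q * (8 * \<eta> * M)) * E \<le> 1 / 4 * E" "R * \<alpha> powr p * E \<le> 1 / 8 * E"
      using \<alpha>C \<eta>Q \<alpha>R E0 by (intro mult_right_mono; simp)+
    ultimately have "E / 2 \<le> C * Q * (2 / p) * (E - E')" by linarith
    moreover have "\<delta> * (C * Q * (2 / p)) * E \<le> 1 / 2 * E" using \<delta>C E0 by (rule mult_right_mono)
    moreover have "C * Q * (2 / p) * (\<delta> * E) = \<delta> * (C * Q * (2 / p)) * E" by (simp only: mult_ac)
    ultimately have "C * Q * (2 / p) * (\<delta> * E) \<le> C * Q * (2 / p) * (E - E')" by linarith
    then have "\<delta> * E \<le> E - E'" using C Q p by (subst (asm) mult_le_cancel_left_pos) auto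
    then have "E' \<le> (1 - \<delta>) * E" by (simp add: algebra_simps)
    then show ?thesis using energy_growth(2)[OF a \<alpha>p] by (auto simp: E_def E'_def)
  qed
  show ?thesis using main \<alpha> \<delta> by blast
qed

section \<open>Borel representatives and null sets of the plane\<close>

lemma AE_lebesgue_on_iff:
  fixes S :: "'a::euclidean_space set"
  assumes "S \<in> sets borel"
  shows "(AE x in lebesgue_on S. P x) \<longleftrightarrow> (AE x in lborel. x \<in> S \<longrightarrow> P x)"
  using assms by (subst AE_restrict_space_iff) (auto simp: AE_completion_iff)

lemma lebesgue_on_ex_borel:
  fixes f :: "'a::euclidean_space \<Rightarrow> real"
  assumes S: "S \<in> sets borel" and f: "f \<in> borel_measurable (lebesgue_on S)"
  obtains f' where "f' \<in> borel_measurable borel" "AE x in lborel. x \<in> S \<longrightarrow> f x = f' x"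
proof -
  have "S \<in> sets lebesgue" using S by auto
  then have "(\<lambda>x. if x \<in> S then f x else 0) \<in> borel_measurable lebesgue"
    using f by (simp add: borel_measurable_if)
  then obtain f' where f': "f' \<in> borel_measurable lborel" "AE x in lborel. (if x \<in> S then f x else 0) = f' x"
    by (auto dest: completion_ex_borel_measurable_real)
  show thesis
  proof (rule that)
    show "f' \<in> borel_measurable borel" using f' by simp
    show "AE x in lborel. x \<in> S \<longrightarrow> f x = f' x" using f'(2) by eventually_elim (simp split: if_splits)
  qed
qed

lemma lebesgue_on_borel_version:
  fixes f f' :: "'a::euclidean_space \<Rightarrow> real"
  assumes S: "S \<in> sets borel" and f' [measurable]: "f' \<in> borel_measurable borel"
    and eq: "AE x in lborel. x \<in> S \<longrightarrow> f x = f' x"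
  shows lebesgue_on_integral_borel: "(LINT x|lebesgue_on S. f x) = (LINT x:S|lborel. f' x)"
    and lebesgue_on_integrable_borel: "integrable (lebesgue_on S) f \<longleftrightarrow> set_integrable lborel S f'"
proof -
  note S [measurable]
  have b: "(\<lambda>x. indicator S x *\<^sub>R f' x) \<in> borel_measurable lborel" by measurable
  have l: "(\<lambda>x. indicator S x *\<^sub>R f' x) \<in> borel_measurable lebesgue"
    by (rule measurable_completion[OF b])
  have ae: "AE x in lebesgue. indicator S x *\<^sub>R f' x = indicator S x *\<^sub>R f x"
    by (rule AE_completion, use eq in eventually_elim) (auto simp: indicator_def)
  have m: "(\<lambda>x. indicator S x *\<^sub>R f x) \<in> borel_measurable lebesgue"
    by (rule borel_measurable_AE[OF l ae])
  have S': "S \<inter> space lebesgue \<in> sets lebesgue" using S by auto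
  have "(LINT x|lebesgue_on S. f x) = (LINT x|lebesgue. indicator S x *\<^sub>R f x)"
    by (rule integral_restrict_space[OF S'])
  also have "\<dots> = (LINT x|lebesgue. indicator S x *\<^sub>R f' x)"
    by (rule integral_cong_AE[OF m l]) (use ae in eventually_elim, auto)
  also have "\<dots> = (LINT x:S|lborel. f' x)"
    unfolding set_lebesgue_integral_def by (rule integral_completion[OF b])
  finally show "(LINT x|lebesgue_on S. f x) = (LINT x:S|lborel. f' x)" .
  have "integrable (lebesgue_on S) f \<longleftrightarrow> integrable lebesgue (\<lambda>x. indicator S x *\<^sub>R f x)"
    by (rule integrable_restrict_space[OF S'])
  also have "\<dots> \<longleftrightarrow> integrable lebesgue (\<lambda>x. indicator S x *\<^sub>R f' x)"
    by (rule integrable_cong_AE[OF m l]) (use ae in eventually_elim, auto)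
  also have "\<dots> \<longleftrightarrow> set_integrable lborel S f'"
    unfolding set_integrable_def by (rule integrable_completion[OF b])
  finally show "integrable (lebesgue_on S) f \<longleftrightarrow> set_integrable lborel S f'" .
qed

lemma AE_null_cover:
  assumes "AE x in lborel. P (x :: 'a::euclidean_space)"
  obtains N where "N \<in> sets borel" "AE x in lborel. x \<notin> N" "\<And>x. x \<notin> N \<Longrightarrow> P x"
proof -
  obtain N where N: "{x \<in> space lborel. \<not> P x} \<subseteq> N" "emeasure lborel N = 0" "N \<in> sets lborel"
    using assms by (rule AE_E)
  show thesis
  proof (rule that[of N])
    show "AE x in lborel. x \<notin> N" using N by (intro AE_not_in null_setsI) auto
  qed (use N in auto)
qed

lemma AE_affine:
  fixes P :: "real \<Rightarrow> bool"
  assumes "AE x in lborel. P x" "c \<noteq> 0"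
  shows "AE x in lborel. P (t + c * x)"
proof -
  obtain N where N: "N \<in> sets borel" "AE x in lborel. x \<notin> N" "\<And>x. x \<notin> N \<Longrightarrow> P x"
    using AE_null_cover[OF assms(1)] by blast
  have "AE x in lborel. t + c * x \<notin> N"
    using N by (intro AE_borel_affine[OF assms(2), of "\<lambda>x. x \<notin> N"]) auto
  then show ?thesis by eventually_elim (rule N(3))
qed

lemma pred_plane:
  fixes P :: "real \<times> real \<Rightarrow> bool"
  assumes "Measurable.pred (borel \<Otimes>\<^sub>M borel) P"
  shows "{q \<in> space (lborel \<Otimes>\<^sub>M lborel). P q} \<in> sets (lborel \<Otimes>\<^sub>M lborel)"
proof -
  have "Measurable.pred (lborel \<Otimes>\<^sub>M lborel) P"
    using assms by (simp cong: measurable_cong_sets sets_pair_measure_cong)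
  then show ?thesis by (simp only: pred_def)
qed

lemma AE_planeI:
  fixes P :: "real \<times> real \<Rightarrow> bool"
  assumes "Measurable.pred (borel \<Otimes>\<^sub>M borel) P" and "AE t in lborel. AE x in lborel. P (t, x)"
  shows "AE q in lborel. P q"
  using lborel_pair.AE_pair_measure[OF pred_plane[OF assms(1)] assms(2)] unfolding lborel_prod .

lemma AE_planeD:
  fixes Q :: "real \<times> real \<Rightarrow> bool"
  assumes "AE q in lborel. Q q"
  shows "AE t in lborel. AE x in lborel. Q (t, x)"
proof -
  have "AE q in lborel \<Otimes>\<^sub>M lborel. Q q" unfolding lborel_prod by (rule assms)
  then show ?thesis by (rule lborel_pair.AE_pair)
qed

lemma AE_plane_swap:
  fixes P :: "real \<times> real \<Rightarrow> bool"
  assumes "Measurable.pred (borel \<Otimes>\<^sub>M borel) P" and "AE t in lborel. AE x in lborel. P (t, x)"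
  shows "AE x in lborel. AE t in lborel. P (t, x)"
  using lborel_pair.AE_commute[of "\<lambda>t x. P (t, x)"] pred_plane[OF assms(1)] assms(2) by simp

lemma AE_plane_cover:
  assumes "AE q in lborel. Q (q :: real \<times> real)"
  obtains N where "N \<in> sets (borel \<Otimes>\<^sub>M borel)" "AE q in lborel. q \<notin> N" "\<And>q. q \<notin> N \<Longrightarrow> Q q"
  using AE_null_cover[OF assms] unfolding borel_prod by blast

lemma AE_plane_columns:
  fixes Q :: "real \<times> real \<Rightarrow> bool"
  assumes "AE q in lborel. Q q"
  shows "AE x in lborel. AE t in lborel. Q (t, x)"
proof -
  obtain N where N: "N \<in> sets (borel \<Otimes>\<^sub>M borel)" "AE q in lborel. q \<notin> N" "\<And>q. q \<notin> N \<Longrightarrow> Q q"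
    using AE_plane_cover[OF assms] by blast
  note N(1) [measurable]
  have "AE x in lborel. AE t in lborel. (t, x) \<notin> N"
    by (rule AE_plane_swap[OF _ AE_planeD[OF N(2)]]) measurable
  then show ?thesis by (auto elim!: eventually_mono intro: N(3))
qed

text \<open>
  For each \<open>t\<close> the map \<open>x \<mapsto> x - t\<close> is a translation, so the
  preimage of a null set of the line under \<open>(t,x) \<mapsto> x - t\<close> is a null set of
  the plane.
\<close>

lemma AE_plane_of_characteristic:
  assumes "AE z in lborel. P (z :: real)"
  shows "AE q in lborel. P (snd q - fst q)"
proof -
  obtain N where N: "N \<in> sets borel" "AE x in lborel. x \<notin> N" "\<And>x. x \<notin> N \<Longrightarrow> P x"
    using AE_null_cover[OF assms] by blast
  note N(1) [measurable]
  have "AE q in lborel. snd q - fst q \<notin> N"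
  proof (rule AE_planeI)
    show "AE t in lborel. AE x in lborel. snd (t, x) - fst (t, x) \<notin> N"
      using AE_affine[OF N(2), of 1 "- t" for t] by simp
  qed measurable
  then show ?thesis by eventually_elim (auto intro: N(3))
qed

text \<open>
  The shear \<open>(s,z) \<mapsto> (s,z + s)\<close> respects null sets, so almost every
  characteristic meets a given null set of the plane in a null set of times.
\<close>

lemma AE_characteristic_of_plane:
  fixes Q :: "real \<times> real \<Rightarrow> bool"
  assumes "AE q in lborel. Q q"
  shows "AE z in lborel. AE s in lborel. Q (s, z + s)"
proof -
  obtain N where N: "N \<in> sets (borel \<Otimes>\<^sub>M borel)" "AE q in lborel. q \<notin> N" "\<And>q. q \<notin> N \<Longrightarrow> Q q"
    using AE_plane_cover[OF assms] by blast
  note N(1) [measurable]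
  have "AE z in lborel. AE s in lborel. (fst (s, z), snd (s, z) + fst (s, z)) \<notin> N"
  proof (rule AE_plane_swap[where P = "\<lambda>q. (fst q, snd q + fst q) \<notin> N"])
    show "AE s in lborel. AE z in lborel. (fst (s, z), snd (s, z) + fst (s, z)) \<notin> N"
      using AE_planeD[OF N(2)]
    proof eventually_elim
      case (elim s)
      from AE_affine[OF this, of 1 s] show ?case by (simp add: add.commute)
    qed
  qed measurable
  then show ?thesis by (auto elim!: eventually_mono intro: N(3))
qed

lemma AE_plane_mirror:
  fixes Q :: "real \<times> real \<Rightarrow> bool"
  assumes "AE q in lborel. Q q"
  shows "AE q in lborel. Q (fst q, 1 - snd q)"
proof -
  obtain N where N: "N \<in> sets (borel \<Otimes>\<^sub>M borel)" "AE q in lborel. q \<notin> N" "\<And>q. q \<notin> N \<Longrightarrow> Q q"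
    using AE_plane_cover[OF assms] by blast
  note N(1) [measurable]
  have "AE q in lborel. (fst q, 1 - snd q) \<notin> N"
  proof (rule AE_planeI)
    show "AE t in lborel. AE x in lborel. (fst (t, x), 1 - snd (t, x)) \<notin> N"
      using AE_planeD[OF N(2)]
    proof eventually_elim
      case (elim t)
      from AE_affine[OF this, of "-1" 1] show ?case by simp
    qed
  qed measurable
  then show ?thesis by eventually_elim (auto intro: N(3))
qed

text \<open>
  The positive and the negative part of \<open>g\<close> are densities of two measures that agree
  on all half-lines.
\<close>

lemma AE_zero_if_integrals_zero:
  fixes g :: "real \<Rightarrow> real"
  assumes [measurable]: "g \<in> borel_measurable borel"
    and g: "set_integrable lborel {a..b} g"
    and zero: "\<And>c d. a \<le> c \<Longrightarrow> c < d \<Longrightarrow> d \<le> b \<Longrightarrow> (LINT t:{c..d}|lborel. g t) = 0"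
  shows "AE t in lborel. t \<in> {a..b} \<longrightarrow> g t = 0"
proof -
  define h where "h t = indicator {a..b} t * g t" for t
  have h: "integrable lborel h" using g by (simp add: set_integrable_def h_def[abs_def])
  have [measurable]: "h \<in> borel_measurable borel" unfolding h_def[abs_def] by measurable
  have z: "(LINT t:{x<..}|lborel. h t) = 0" for x
  proof (cases "max x a < b")
    case True
    have "(LINT t:{x<..}|lborel. h t) = (LINT t:{max x a..b}|lborel. g t)"
      unfolding set_lebesgue_integral_def
      by (rule integral_cong_AE) (use AE_lborel_singleton[of x] in \<open>auto simp: h_def indicator_def\<close>)
    also have "\<dots> = 0" using True by (intro zero) auto
    finally show ?thesis .
  next
    case False
    have "AE t in lborel. indicator {x<..} t *\<^sub>R h t = 0"
      using AE_lborel_singleton[of b] by eventually_elim (use False in \<open>auto simp: h_def indicator_def\<close>)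
    then show ?thesis unfolding set_lebesgue_integral_def by (rule integral_eq_zero_AE)
  qed
  have pm: "integrable lborel (\<lambda>t. indicator {x<..} t * max 0 (h t))" "integrable lborel (\<lambda>t. indicator {x<..} t * max 0 (- h t))" for x
    by (rule Bochner_Integration.integrable_bound[OF h]; auto intro!: AE_I2 simp: indicator_def)+
  have e: "emeasure (density lborel (\<lambda>t. ennreal (max 0 (k t)))) {x<..} = ennreal (\<integral>t. indicator {x<..} t * max 0 (k t) \<partial>lborel)"
    if [measurable]: "k \<in> borel_measurable borel" and k: "integrable lborel (\<lambda>t. indicator {x<..} t * max 0 (k t))"
    for k :: "real \<Rightarrow> real" and x
  proof -
    have "emeasure (density lborel (\<lambda>t. ennreal (max 0 (k t)))) {x<..} = (\<integral>\<^sup>+t. ennreal (indicator {x<..} t * max 0 (k t)) \<partial>lborel)"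
      by (subst emeasure_density) (auto intro!: nn_integral_cong simp: indicator_def)
    also have "\<dots> = ennreal (\<integral>t. indicator {x<..} t * max 0 (k t) \<partial>lborel)"
      by (rule nn_integral_eq_integral[OF k]) auto
    finally show ?thesis .
  qed
  have d: "density lborel (\<lambda>t. ennreal (max 0 (h t))) = density lborel (\<lambda>t. ennreal (max 0 (- h t)))"
  proof (rule measure_eqI_lessThan)
    fix x
    have "(\<integral>t. indicator {x<..} t * max 0 (h t) \<partial>lborel) - (\<integral>t. indicator {x<..} t * max 0 (- h t) \<partial>lborel)
        = (\<integral>t. indicator {x<..} t * max 0 (h t) - indicator {x<..} t * max 0 (- h t) \<partial>lborel)"
      using pm by simp
    also have "\<dots> = (LINT t:{x<..}|lborel. h t)"
      unfolding set_lebesgue_integral_def by (intro Bochner_Integration.integral_cong) (auto simp: indicator_def max_def)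
    finally have "(\<integral>t. indicator {x<..} t * max 0 (h t) \<partial>lborel) = (\<integral>t. indicator {x<..} t * max 0 (- h t) \<partial>lborel)"
      using z by simp
    then show "emeasure (density lborel (\<lambda>t. ennreal (max 0 (h t)))) {x<..} = emeasure (density lborel (\<lambda>t. ennreal (max 0 (- h t)))) {x<..}"
      using e[of h x] e[of "\<lambda>t. - h t" x] pm[of x] by simp
    show "emeasure (density lborel (\<lambda>t. ennreal (max 0 (h t)))) {x<..} < \<infinity>"
      using e[of h x] pm[of x] by simp
  qed auto
  have "AE t in lborel. ennreal (max 0 (h t)) = ennreal (max 0 (- h t))"
    by (rule sigma_finite_measure.density_unique[OF sigma_finite_lborel _ _ d]) auto
  then show ?thesis by eventually_elim (auto simp: h_def max_def split: if_splits)
qed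

lemma set_integral_Icc_shift:
  fixes g :: "real \<Rightarrow> real"
  shows "(LINT t:{a - h..b - h}|lborel. g t) = (LINT t:{a..b}|lborel. g (t - h))"
    and "set_integrable lborel {a - h..b - h} g \<longleftrightarrow> set_integrable lborel {a..b} (\<lambda>t. g (t - h))"
proof -
  have i: "indicator {a - h..b - h} (- h + 1 * t) = (indicator {a..b} t :: real)" for t by (auto simp: indicator_def)
  show "(LINT t:{a - h..b - h}|lborel. g t) = (LINT t:{a..b}|lborel. g (t - h))"
    unfolding set_lebesgue_integral_def
    by (subst lborel_integral_real_affine[where c = 1 and t = "- h"]) (simp_all only: i, simp_all)
  show "set_integrable lborel {a - h..b - h} g \<longleftrightarrow> set_integrable lborel {a..b} (\<lambda>t. g (t - h))"
    unfolding set_integrable_def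
    by (subst lborel_integrable_real_affine_iff[where c = 1 and t = "- h", symmetric]) (simp_all only: i, simp_all)
qed

lemma AE_lborel_ex_in_interval:
  fixes P :: "real \<Rightarrow> bool"
  assumes "AE x in lborel. P x" "a < b"
  shows "\<exists>x\<in>{a<..<b}. P x"
proof (rule ccontr)
  assume n: "\<not> (\<exists>x\<in>{a<..<b}. P x)"
  have "AE x in lborel. x \<notin> {a<..<b}" using assms(1) by eventually_elim (use n in auto)
  then have "emeasure lborel {a<..<b} = 0"
    using AE_iff_null[of lborel "\<lambda>x. x \<notin> {a<..<b}"] by (simp add: null_sets_def del: greaterThanLessThan_iff)
  then show False using assms(2) by simp
qed

section \<open>Traces of transported functions\<close>

text \<open>
  A function \<open>f\<close> that is carried to the right with source \<open>H\<close>. The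
  primed functions are Borel measurable and agree almost everywhere with the given
  representatives; \<open>\<beta>\<close> and \<open>\<gamma>\<close> are the traces at \<open>x =
  0\<close> and \<open>x = 1\<close>. A broad solution satisfies this with \<open>f =
  \<xi>\<close>, and also with \<open>f(t,x) = \<rho>(t,1-x)\<close>.
\<close>

locale transport =
  fixes f H f' H' :: "real \<times> real \<Rightarrow> real" and f0 f0' \<beta> \<gamma> :: "real \<Rightarrow> real"
  assumes f'_measurable [measurable]: "f' \<in> borel_measurable borel" and H'_measurable [measurable]: "H' \<in> borel_measurable borel"
    and f0'_measurable [measurable]: "f0' \<in> borel_measurable borel"
    and \<beta>_measurable [measurable]: "\<beta> \<in> borel_measurable borel" and \<gamma>_measurable [measurable]: "\<gamma> \<in> borel_measurable borel"
    and f_eq: "AE q in lborel. q \<in> strip \<longrightarrow> f q = f' q" and H_eq: "AE q in lborel. q \<in> strip \<longrightarrow> H q = H' q"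
    and H'_off: "q \<notin> strip \<Longrightarrow> H' q = 0"
    and f0_eq: "AE x in lborel. x \<in> {0<..<1} \<longrightarrow> f0 x = f0' x"
    and inflow: "AE t in lborel. 0 < t \<longrightarrow> f (t, 0) = \<beta> t"
    and outflow: "AE t in lborel. 0 < t \<longrightarrow> f (t, 1) = \<gamma> t"
    and rule: "0 < T \<Longrightarrow> AE (t, x) in lebesgue_on ({0<..<T} \<times> {0<..<1}).
       (x > t \<longrightarrow> f (t, x) = f0 (x - t) + (LINT s|lebesgue_on {0..t}. H (s, x - t + s))) \<and>
       (x < t \<longrightarrow> f (t, x) = f (t - x, 0) + (LINT s|lebesgue_on {t - x..t}. H (s, x - t + s)))"
    and H'_integrable: "0 < T \<Longrightarrow> set_integrable lborel ({0<..<T} \<times> UNIV) H'"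
    and f_integrable: "0 < T \<Longrightarrow> 0 \<le> x \<Longrightarrow> x \<le> 1 \<Longrightarrow> integrable (lebesgue_on {0<..<T}) (\<lambda>t. f (t, x))"
    and f_continuous: "0 < T \<Longrightarrow> ((\<lambda>x. LINT t|lebesgue_on {0<..<T}. \<bar>f (t, x) - f (t, 1)\<bar>) \<longlongrightarrow> 0) (at 1 within {0..1})"
begin

definition entry :: "real \<Rightarrow> real" where
  "entry z = (if 0 < z then f0' z else if z < 0 then \<beta> (- z) else 0)"

text \<open>
  Since \<open>H'\<close> vanishes off the strip, the integral from time \<open>0\<close> covers
  the characteristics that start at time \<open>0\<close> as well as those that enter at \<open>x
  = 0\<close> later.
\<close>

definition along :: "real \<Rightarrow> real \<Rightarrow> real" where
  "along t x = entry (x - t) + (LINT s:{0..t}|lborel. H' (s, x - t + s))"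

lemma entry_measurable [measurable]: "entry \<in> borel_measurable borel"
  unfolding entry_def[abs_def] by measurable

lemma along_measurable [measurable]: "case_prod along \<in> borel_measurable (borel \<Otimes>\<^sub>M borel)"
proof -
  have "case_prod along = (\<lambda>q. entry (snd q - fst q) + (\<integral>s. (if 0 \<le> s \<and> s \<le> fst q then H' (s, snd q - fst q + s) else 0) \<partial>lborel))"
    by (auto simp: along_def fun_eq_iff set_lebesgue_integral_def indicator_def intro!: Bochner_Integration.integral_cong)
  also have "\<dots> \<in> borel_measurable (borel \<Otimes>\<^sub>M borel)" by measurable
  finally show ?thesis .
qed

text \<open>
  The rule holds at almost every point, and its terms may be replaced by their Borel versions:
  almost every characteristic meets the exceptional null set of the source in a null set of times.
\<close>

lemma f'_eq_along: "AE q in lborel. q \<in> strip \<longrightarrow> f' q = along (fst q) (snd q)"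
proof -
  have rules: "AE q in lborel. \<forall>n. q \<in> {0<..<real (Suc n)} \<times> {0<..<1} \<longrightarrow>
       (snd q > fst q \<longrightarrow> f q = f0 (snd q - fst q) + (LINT s|lebesgue_on {0..fst q}. H (s, snd q - fst q + s))) \<and>
       (snd q < fst q \<longrightarrow> f q = f (fst q - snd q, 0) + (LINT s|lebesgue_on {fst q - snd q..fst q}. H (s, snd q - fst q + s)))"
    unfolding AE_all_countable
  proof
    fix n
    have "{0<..<real (Suc n)} \<times> {0<..<1::real} \<in> sets borel" by (auto simp flip: borel_prod)
    from rule[of "real (Suc n)", unfolded AE_lebesgue_on_iff[OF this]]
    show "AE q in lborel. q \<in> {0<..<real (Suc n)} \<times> {0<..<1} \<longrightarrow>
       (snd q > fst q \<longrightarrow> f q = f0 (snd q - fst q) + (LINT s|lebesgue_on {0..fst q}. H (s, snd q - fst q + s))) \<and>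
       (snd q < fst q \<longrightarrow> f q = f (fst q - snd q, 0) + (LINT s|lebesgue_on {fst q - snd q..fst q}. H (s, snd q - fst q + s)))"
      by (simp add: split_beta')
  qed
  have Hs: "AE q in lborel. AE s in lborel. (s, (snd q - fst q) + s) \<in> strip \<longrightarrow> H (s, (snd q - fst q) + s) = H' (s, (snd q - fst q) + s)"
    by (rule AE_plane_of_characteristic[OF AE_characteristic_of_plane[OF H_eq]])
  have f0s: "AE q in lborel. snd q - fst q \<in> {0<..<1} \<longrightarrow> f0 (snd q - fst q) = f0' (snd q - fst q)"
    by (rule AE_plane_of_characteristic[OF f0_eq])
  have "AE z in lborel. 0 < - z \<longrightarrow> f (- z, 0) = \<beta> (- z)"
    using AE_affine[OF inflow, of "-1" 0] by simp
  from AE_plane_of_characteristic[OF this]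
  have \<beta>s: "AE q in lborel. 0 < fst q - snd q \<longrightarrow> f (fst q - snd q, 0) = \<beta> (fst q - snd q)" by simp
  have diag: "AE q in lborel. snd q - fst q \<noteq> (0 :: real)"
    by (rule AE_plane_of_characteristic[OF AE_lborel_singleton])
  show ?thesis
    using rules Hs f0s \<beta>s diag f_eq
  proof eventually_elim
    case (elim q)
    show ?case
    proof
      assume q: "q \<in> strip"
      define t x where "t = fst q" and "x = snd q"
      have tx: "0 < t" "0 < x" "x < 1" using q by (auto simp: strip_def t_def x_def)
      note el = elim(2-5)[folded t_def x_def]
      obtain n where "t < real (Suc n)" using reals_Archimedean2[of t] using less_trans[OF _ of_nat_less_iff[THEN iffD2, OF lessI]] by blast
      then have "q \<in> {0<..<real (Suc n)} \<times> {0<..<1}" using tx by (simp add: mem_Times_iff flip: t_def x_def)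
      with elim(1) have r: "x > t \<Longrightarrow> f q = f0 (x - t) + (LINT s|lebesgue_on {0..t}. H (s, x - t + s))"
         "x < t \<Longrightarrow> f q = f (t - x, 0) + (LINT s|lebesgue_on {t - x..t}. H (s, x - t + s))"
        unfolding t_def x_def by blast+
      have ae: "AE s in lborel. s \<in> {a..t} \<longrightarrow> H (s, x - t + s) = H' (s, x - t + s)" if "a = max 0 (t - x)" for a
        using el(1) AE_lborel_singleton[of "0::real"] AE_lborel_singleton[of "t - x"]
        by eventually_elim (use that tx in \<open>auto simp: strip_def\<close>)
      have int: "(LINT s|lebesgue_on {a..t}. H (s, x - t + s)) = (LINT s:{0..t}|lborel. H' (s, x - t + s))" if "a = max 0 (t - x)" for a
      proof -
        have "(LINT s|lebesgue_on {a..t}. H (s, x - t + s)) = (LINT s:{a..t}|lborel. H' (s, x - t + s))"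
          by (rule lebesgue_on_integral_borel[OF _ _ ae[OF that]]) auto
        also have "\<dots> = (LINT s:{0..t}|lborel. H' (s, x - t + s))"
          unfolding set_lebesgue_integral_def
        proof (intro Bochner_Integration.integral_cong refl)
          fix s
          have "H' (s, x - t + s) = 0" if "s < t - x" using that tx by (intro H'_off) (auto simp: strip_def)
          then show "indicator {a..t} s *\<^sub>R H' (s, x - t + s) = indicator {0..t} s *\<^sub>R H' (s, x - t + s)"
            using \<open>a = max 0 (t - x)\<close> by (auto simp: indicator_def max_def split: if_splits)
        qed
        finally show ?thesis .
      qed
      have fq: "f q = f' q" using elim(6) q by simp
      show "f' q = along (fst q) (snd q)"
      proof (cases "x > t")
        case True
        then have "f0 (x - t) = f0' (x - t)" using el(2) tx by simp
        with r(1)[OF True] fq int[of 0] True show ?thesis by (simp add: along_def entry_def flip: t_def x_def)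
      next
        case False
        then have "x < t" using el(4) by auto
        then have "f (t - x, 0) = \<beta> (t - x)" using el(3) by simp
        with r(2)[OF \<open>x < t\<close>] fq int[of "t - x"] \<open>x < t\<close> show ?thesis by (simp add: along_def entry_def flip: t_def x_def)
      qed
    qed
  qed
qed

text \<open>
  For fixed \<open>s\<close>, the substitution \<open>y = 1 - t + s\<close> reduces the integral
  over \<open>t\<close> to an integral of \<open>H'\<close> over a line.
\<close>

lemma H'_sheared_integrable:
  assumes T: "0 < T"
  shows "integrable (lborel \<Otimes>\<^sub>M lborel) (\<lambda>(t, s). indicator {0<..<T} s * H' (s, 1 - t + s))"
proof (rule integrableI_bounded)
  have "(\<integral>\<^sup>+x. ennreal (norm (case x of (t, s) \<Rightarrow> indicator {0<..<T} s * H' (s, 1 - t + s))) \<partial>(lborel \<Otimes>\<^sub>M lborel))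
    = (\<integral>\<^sup>+s. \<integral>\<^sup>+t. ennreal (indicator {0<..<T} s * \<bar>H' (s, (1 + s) - t)\<bar>) \<partial>lborel \<partial>lborel)"
    by (subst lborel_pair.nn_integral_snd[symmetric]) (auto simp: abs_mult algebra_simps)
  also have "\<dots> = (\<integral>\<^sup>+s. \<integral>\<^sup>+y. ennreal (indicator {0<..<T} s * \<bar>H' (s, y)\<bar>) \<partial>lborel \<partial>lborel)"
    by (intro nn_integral_cong nn_integral_reflect) measurable
  also have "\<dots> = (\<integral>\<^sup>+x. ennreal (norm (indicator ({0<..<T} \<times> UNIV) x *\<^sub>R H' x)) \<partial>(lborel \<Otimes>\<^sub>M lborel))"
  proof -
    have "(\<integral>\<^sup>+s. \<integral>\<^sup>+y. ennreal (indicator {0<..<T} s * \<bar>H' (s, y)\<bar>) \<partial>lborel \<partial>lborel)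
      = (\<integral>\<^sup>+(s, y). ennreal (indicator {0<..<T} s * \<bar>H' (s, y)\<bar>) \<partial>(lborel \<Otimes>\<^sub>M lborel))"
      by (subst lborel.nn_integral_fst[symmetric]) auto
    also have "\<dots> = (\<integral>\<^sup>+x. ennreal (norm (indicator ({0<..<T} \<times> UNIV) x *\<^sub>R H' x)) \<partial>(lborel \<Otimes>\<^sub>M lborel))"
      by (intro nn_integral_cong) (auto simp: indicator_def)
    finally show ?thesis .
  qed
  also have "\<dots> < \<infinity>"
    using H'_integrable[OF T] by (simp add: set_integrable_def integrable_iff_bounded lborel_prod)
  finally show "(\<integral>\<^sup>+x. ennreal (norm (case x of (t, s) \<Rightarrow> indicator {0<..<T} s * H' (s, 1 - t + s))) \<partial>(lborel \<Otimes>\<^sub>M lborel)) < \<infinity>" .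
qed measurable

lemma H'_nonpos: "s \<le> 0 \<Longrightarrow> H' (s, y) = 0" "1 \<le> y \<Longrightarrow> H' (s, y) = 0"
  by (auto intro!: H'_off simp: strip_def)

lemma AE_H'_line_integrable:
  assumes T: "0 < T"
  shows "AE t in lborel. set_integrable lborel {0..<T} (\<lambda>s. H' (s, 1 - t + s))"
proof -
  have e: "(\<lambda>s. indicator {0<..<T} s * H' (s, 1 - t + s)) = (\<lambda>s. indicator {0..<T} s * H' (s, 1 - t + s))" for t
    using H'_nonpos by (auto simp: fun_eq_iff indicator_def)
  have "AE t in lborel. integrable lborel (\<lambda>s. indicator {0<..<T} s * H' (s, 1 - t + s))"
    using lborel_pair.AE_integrable_fst'[OF H'_sheared_integrable[OF T]] by simp
  then show ?thesis unfolding set_integrable_def by eventually_elim (simp add: e)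
qed

text \<open>
  Let \<open>h\<close> tend to \<open>0\<close>. The values \<open>f(\<cdot>,1-h)\<close> converge
  to the trace in \<open>L\<^sup>1\<close>, and the characteristic that passes through
  \<open>(t-h,1-h)\<close> reaches \<open>x = 1\<close> at time \<open>t\<close>. The shift by
  \<open>h\<close> in time is harmless for integrals over time intervals: they vary continuously
  with the end points, and along the remaining piece of characteristic the source contributes an
  integral over a shrinking set.
\<close>

lemma outflow_integral_eq:
  assumes ab: "0 < a" "a < b"
  shows "set_integrable lborel {a..b} (\<lambda>t. \<gamma> t - along t 1)" and "(LINT t:{a..b}|lborel. \<gamma> t - along t 1) = 0"
proof -
  define T where "T = b + 1"
  have T: "0 < T" "b < T" using ab by (auto simp: T_def)
  (* the source on the last piece of the characteristic that arrives at time \<open>t\<close> *)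
  define D where "D h t s = indicator {a..b} t * (indicator {t - h<..t} s * H' (s, 1 - t + s))" for h t s
  have Dm [measurable]: "case_prod (D h) \<in> borel_measurable (lborel \<Otimes>\<^sub>M lborel)" for h
  proof -
    have "case_prod (D h) = (\<lambda>q. indicator {a..b} (fst q) * (if fst q - h < snd q \<and> snd q \<le> fst q then H' (snd q, 1 - fst q + snd q) else 0))"
      by (auto simp: fun_eq_iff D_def indicator_def)
    also have "\<dots> \<in> borel_measurable (lborel \<Otimes>\<^sub>M lborel)" by measurable
    finally show ?thesis .
  qed
  have Dle: "\<bar>D h t s\<bar> \<le> \<bar>indicator {0<..<T} s * H' (s, 1 - t + s)\<bar>" for h t s
    using H'_nonpos T by (auto simp: D_def indicator_def)
  have Di: "integrable (lborel \<Otimes>\<^sub>M lborel) (case_prod (D h))" for h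
    by (rule Bochner_Integration.integrable_bound[OF H'_sheared_integrable[OF T(1)] Dm])
       (use Dle in \<open>auto intro!: AE_I2\<close>)
  define r where "r h = (\<integral>x. case_prod (D h) x \<partial>(lborel \<Otimes>\<^sub>M lborel))" for h
  have f1: "AE t in lborel. t \<in> {0<..<T} \<longrightarrow> f (t, 1) = \<gamma> t" using outflow by eventually_elim auto
  have \<gamma>i: "set_integrable lborel {0<..<T} \<gamma>"
    using f_integrable[OF T(1), of 1] lebesgue_on_integrable_borel[OF _ _ f1] by simp
  define good where "good x \<longleftrightarrow> (AE t in lborel. (t, x) \<in> strip \<longrightarrow> f (t, x) = along t x)" for x
  have "AE q in lborel. q \<in> strip \<longrightarrow> f q = along (fst q) (snd q)"
    using f'_eq_along f_eq by eventually_elim auto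
  from AE_plane_columns[OF this] have AE_good: "AE x in lborel. good x" by (simp add: good_def)
  have K_split: "AE t in lborel. t \<in> {a..b} \<longrightarrow> (\<forall>h\<in>{0<..<a}.
      along t 1 = along (t - h) (1 - h) + (LINT s|lborel. D h t s))"
    using AE_H'_line_integrable[OF T(1)]
  proof (eventually_elim, safe)
    fix t h assume i: "set_integrable lborel {0..<T} (\<lambda>s. H' (s, 1 - t + s))" and t: "t \<in> {a..b}" and h: "h \<in> {0<..<a}"
    have "set_integrable lborel {0..t} (\<lambda>s. H' (s, 1 - t + s))"
      by (rule set_integrable_subset[OF i]) (use t T in auto)
    from set_integral_Icc_append[OF this, of "t - h" t]
    have "(LINT s:{0..t}|lborel. H' (s, 1 - t + s)) = (LINT s:{0..t - h}|lborel. H' (s, 1 - t + s)) + (LINT s:{t - h<..t}|lborel. H' (s, 1 - t + s))"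
      using t h by simp
    also have "(LINT s:{t - h<..t}|lborel. H' (s, 1 - t + s)) = (LINT s|lborel. D h t s)"
      using t by (simp add: D_def set_lebesgue_integral_def)
    finally show "along t 1 = along (t - h) (1 - h) + (LINT s|lborel. D h t s)"
      by (simp add: along_def)
  qed
  have shifted: "set_integrable lborel {a..b} (\<lambda>t. along (t - h) (1 - h))"
     "\<bar>(LINT t:{a..b}|lborel. along (t - h) (1 - h)) - (LINT t:{a - h..b - h}|lborel. \<gamma> t)\<bar> \<le>
        (LINT t|lebesgue_on {0<..<T}. \<bar>f (t, 1 - h) - f (t, 1)\<bar>)"
    if h: "h \<in> {0<..<min a 1}" and g: "good (1 - h)" for h
  proof -
    have e: "AE t in lborel. t \<in> {0<..<T} \<longrightarrow> f (t, 1 - h) = along t (1 - h)"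
      using g[unfolded good_def] by eventually_elim (use h in \<open>auto simp: strip_def\<close>)
    have i: "set_integrable lborel {0<..<T} (\<lambda>t. along t (1 - h))"
      using f_integrable[OF T(1), of "1 - h"] lebesgue_on_integrable_borel[OF _ _ e] h by simp
    have sub: "{a - h..b - h} \<subseteq> {0<..<T}" using h T by auto
    have i1: "set_integrable lborel {a - h..b - h} (\<lambda>t. along t (1 - h))" by (rule set_integrable_subset[OF i _ sub]) simp
    then show "set_integrable lborel {a..b} (\<lambda>t. along (t - h) (1 - h))" by (simp add: set_integral_Icc_shift(2))
    have i2: "set_integrable lborel {a - h..b - h} \<gamma>" by (rule set_integrable_subset[OF \<gamma>i _ sub]) simp
    have id: "set_integrable lborel {0<..<T} (\<lambda>t. \<bar>along t (1 - h) - \<gamma> t\<bar>)"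
      using i \<gamma>i by (intro set_integrable_abs set_integral_diff)
    have "(LINT t:{a..b}|lborel. along (t - h) (1 - h)) - (LINT t:{a - h..b - h}|lborel. \<gamma> t)
        = (LINT t:{a - h..b - h}|lborel. along t (1 - h) - \<gamma> t)"
      using i1 i2 by (simp add: set_integral_Icc_shift(1)[where g = "\<lambda>t. along t (1 - h)"])
    also have "\<bar>\<dots>\<bar> \<le> (LINT t:{a - h..b - h}|lborel. \<bar>along t (1 - h) - \<gamma> t\<bar>)"
      unfolding set_lebesgue_integral_def by (rule order_trans[OF integral_abs_bound]) (simp add: abs_mult)
    also have "\<dots> \<le> (LINT t:{0<..<T}|lborel. \<bar>along t (1 - h) - \<gamma> t\<bar>)"
      unfolding set_lebesgue_integral_def
      by (rule integral_mono_AE)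
         (use id set_integrable_subset[OF id _ sub] sub in \<open>auto simp: set_integrable_def indicator_def intro!: AE_I2\<close>)
    also have "\<dots> = (LINT t|lebesgue_on {0<..<T}. \<bar>f (t, 1 - h) - f (t, 1)\<bar>)"
      by (rule lebesgue_on_integral_borel[symmetric])
         (use e f1 in \<open>auto elim!: eventually_elim2\<close>)
    finally show "\<bar>(LINT t:{a..b}|lborel. along (t - h) (1 - h)) - (LINT t:{a - h..b - h}|lborel. \<gamma> t)\<bar> \<le>
        (LINT t|lebesgue_on {0<..<T}. \<bar>f (t, 1 - h) - f (t, 1)\<bar>)" .
  qed
  have fst_D: "set_integrable lborel {a..b} (\<lambda>t. LINT s|lborel. D h t s)" "(LINT t:{a..b}|lborel. LINT s|lborel. D h t s) = r h" for h
  proof -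
    have e: "indicator {a..b} t *\<^sub>R (LINT s|lborel. D h t s) = (LINT s|lborel. D h t s)" for t
      by (auto simp: indicator_def D_def)
    show "set_integrable lborel {a..b} (\<lambda>t. LINT s|lborel. D h t s)"
      unfolding set_integrable_def e using lborel_pair.integrable_fst[OF Di[of h]] .
    show "(LINT t:{a..b}|lborel. LINT s|lborel. D h t s) = r h"
      unfolding set_lebesgue_integral_def e r_def using lborel_pair.integral_fst[OF Di[of h]] .
  qed
  have split: "set_integrable lborel {a..b} (\<lambda>t. along t 1)"
    "(LINT t:{a..b}|lborel. along t 1) = (LINT t:{a..b}|lborel. along (t - h) (1 - h)) + r h"
    if h: "h \<in> {0<..<min a 1}" and g: "good (1 - h)" for h
  proof -
    have e: "AE t in lborel. t \<in> {a..b} \<longrightarrow> along t 1 = along (t - h) (1 - h) + (LINT s|lborel. D h t s)"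
      using K_split by eventually_elim (use h in auto)
    have e': "AE t in lborel. indicator {a..b} t *\<^sub>R along t 1 = indicator {a..b} t *\<^sub>R (along (t - h) (1 - h) + (LINT s|lborel. D h t s))"
      using e by eventually_elim (auto simp: indicator_def)
    have m: "(\<lambda>t. indicator {a..b} t *\<^sub>R along t 1) \<in> borel_measurable lborel"
      "(\<lambda>t. indicator {a..b} t *\<^sub>R (along (t - h) (1 - h) + (LINT s|lborel. D h t s))) \<in> borel_measurable lborel"
      by measurable
    have i: "set_integrable lborel {a..b} (\<lambda>t. along (t - h) (1 - h) + (LINT s|lborel. D h t s))"
      by (intro set_integral_add shifted(1)[OF h g] fst_D)
    then show "set_integrable lborel {a..b} (\<lambda>t. along t 1)"
      using integrable_cong_AE[OF m e'] by (simp add: set_integrable_def)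
    have "(LINT t:{a..b}|lborel. along t 1) = (LINT t:{a..b}|lborel. along (t - h) (1 - h) + (LINT s|lborel. D h t s))"
      unfolding set_lebesgue_integral_def by (rule integral_cong_AE[OF m e'])
    also have "\<dots> = (LINT t:{a..b}|lborel. along (t - h) (1 - h)) + r h"
      using set_integral_add(2)[OF shifted(1)[OF h g] fst_D(1)[of h]] fst_D(2)[of h] by simp
    finally show "(LINT t:{a..b}|lborel. along t 1) = (LINT t:{a..b}|lborel. along (t - h) (1 - h)) + r h" .
  qed
  have "\<exists>h. h \<in> {0<..<min (min a 1) (1 / real (Suc n))} \<and> good (1 - h)" for n
  proof -
    have "1 - min (min a 1) (1 / real (Suc n)) < 1" using ab by simp
    from AE_lborel_ex_in_interval[OF AE_good this] obtain x
      where "1 - min (min a 1) (1 / real (Suc n)) < x" "x < 1" "good x" by auto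
    then show ?thesis by (intro exI[of _ "1 - x"]) auto
  qed
  then obtain h where h: "h n \<in> {0<..<min (min a 1) (1 / real (Suc n))}" "good (1 - h n)" for n
    by metis
  have h1: "h n \<in> {0<..<min a 1}" for n using h(1)[of n] by auto
  have hpos: "0 < h n" for n using h1[of n] by simp
  have h0: "h \<longlonglongrightarrow> 0"
  proof (rule tendsto_sandwich[of "\<lambda>_. 0" _ _ "\<lambda>n. 1 / real (Suc n)"])
    show "\<forall>\<^sub>F n in sequentially. 0 \<le> h n" using h(1) by (auto intro!: always_eventually less_imp_le)
    show "\<forall>\<^sub>F n in sequentially. h n \<le> 1 / real (Suc n)" using h(1) by (auto intro!: always_eventually less_imp_le)
    show "(\<lambda>n. 1 / real (Suc n)) \<longlonglongrightarrow> 0" using LIMSEQ_inverse_real_of_nat by (simp add: inverse_eq_divide)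
  qed simp
  have C0: "(\<lambda>n. LINT t|lebesgue_on {0<..<T}. \<bar>f (t, 1 - h n) - f (t, 1)\<bar>) \<longlonglongrightarrow> 0"
  proof (rule filterlim_compose[OF f_continuous[OF T(1)]])
    have "(\<lambda>n. 1 - h n) \<longlonglongrightarrow> 1 - 0" by (intro tendsto_intros h0)
    then show "filterlim (\<lambda>n. 1 - h n) (at 1 within {0..1}) sequentially"
      using h1 by (auto simp: filterlim_at less_imp_le intro!: always_eventually) (metis less_irrefl)+
  qed
  have R0: "(\<lambda>n. r (h n)) \<longlonglongrightarrow> 0"
  proof -
    have "(\<lambda>n. r (h n)) \<longlonglongrightarrow> integral\<^sup>L (lborel \<Otimes>\<^sub>M lborel) (\<lambda>x :: real \<times> real. 0)"
      unfolding r_def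
    proof (rule integral_dominated_convergence[where w = "\<lambda>x. \<bar>case x of (t, s) \<Rightarrow> indicator {0<..<T} s * H' (s, 1 - t + s)\<bar>"])
      show "integrable (lborel \<Otimes>\<^sub>M lborel) (\<lambda>x. \<bar>case x of (t, s) \<Rightarrow> indicator {0<..<T} s * H' (s, 1 - t + s)\<bar>)"
        by (intro integrable_abs H'_sheared_integrable T)
      show "AE x in lborel \<Otimes>\<^sub>M lborel. (\<lambda>n. case x of (t, s) \<Rightarrow> D (h n) t s) \<longlonglongrightarrow> 0"
      proof (rule AE_I2, clarify)
        fix t s :: real
        show "(\<lambda>n. D (h n) t s) \<longlonglongrightarrow> 0"
        proof (cases "s < t")
          case True
          then have "\<forall>\<^sub>F n in sequentially. h n < t - s" using order_tendstoD(2)[OF h0, of "t - s"] by simp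
          then have "\<forall>\<^sub>F n in sequentially. D (h n) t s = 0" by eventually_elim (auto simp: D_def)
          then show ?thesis by (rule tendsto_eventually)
        next
          case False
          then have "D (h n) t s = 0" for n using H'_nonpos(2)[of "1 - t + s" s] by (auto simp: D_def indicator_def)
          then show ?thesis by simp
        qed
      qed
      show "AE x in lborel \<Otimes>\<^sub>M lborel. norm (case x of (t, s) \<Rightarrow> D (h n) t s) \<le> \<bar>case x of (t, s) \<Rightarrow> indicator {0<..<T} s * H' (s, 1 - t + s)\<bar>" for n
        using Dle by (intro AE_I2) (auto simp: split_beta')
    qed (use Dm in auto)
    then show ?thesis by simp
  qed
  have G0: "(\<lambda>n. LINT t:{a - h n..b - h n}|lborel. \<gamma> t) \<longlonglongrightarrow> (LINT t:{a..b}|lborel. \<gamma> t)"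
    unfolding set_lebesgue_integral_def
  proof (rule integral_dominated_convergence[where w = "\<lambda>t. \<bar>indicator {0<..<T} t * \<gamma> t\<bar>"])
    show "integrable lborel (\<lambda>t. \<bar>indicator {0<..<T} t * \<gamma> t\<bar>)" using \<gamma>i by (simp add: set_integrable_def)
    show "AE t in lborel. norm (indicator {a - h n..b - h n} t *\<^sub>R \<gamma> t) \<le> \<bar>indicator {0<..<T} t * \<gamma> t\<bar>" for n
      using h1[of n] T by (intro AE_I2) (auto simp: indicator_def)
    show "AE t in lborel. (\<lambda>n. indicator {a - h n..b - h n} t *\<^sub>R \<gamma> t) \<longlonglongrightarrow> indicator {a..b} t *\<^sub>R \<gamma> t"
      using AE_lborel_singleton[of b]
    proof eventually_elim
      fix t assume t: "t \<noteq> b"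
      have "\<forall>\<^sub>F n in sequentially. indicator {a - h n..b - h n} t = (indicator {a..b} t :: real)"
      proof (cases "t < a \<or> a \<le> t \<and> t < b")
        case True
        define d where "d = (if t < a then a - t else b - t)"
        have d: "0 < d" using True by (auto simp: d_def)
        from order_tendstoD(2)[OF h0 this] show ?thesis
        proof eventually_elim
          fix n assume "h n < d"
          with hpos[of n] True show "indicator {a - h n..b - h n} t = (indicator {a..b} t :: real)"
            by (auto simp: indicator_def d_def split: if_splits)
        qed
      next
        case False
        then have "b < t" using t by auto
        then have "indicator {a - h n..b - h n} t = (indicator {a..b} t :: real)" for n
          using hpos[of n] by (auto simp: indicator_def)
        then show ?thesis by simp
      qed
      then show "(\<lambda>n. indicator {a - h n..b - h n} t *\<^sub>R \<gamma> t) \<longlonglongrightarrow> indicator {a..b} t *\<^sub>R \<gamma> t"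
        by (intro tendsto_eventually) (auto elim: eventually_mono)
    qed
  qed auto
  have Ki: "set_integrable lborel {a..b} (\<lambda>t. along t 1)" by (rule split(1)[OF h1[of 0] h(2)])
  have \<gamma>i': "set_integrable lborel {a..b} \<gamma>" by (rule set_integrable_subset[OF \<gamma>i]) (use ab T in auto)
  show "set_integrable lborel {a..b} (\<lambda>t. \<gamma> t - along t 1)" by (intro set_integral_diff \<gamma>i' Ki)
  have "\<bar>(LINT t:{a..b}|lborel. along t 1) - r (h n) - (LINT t:{a - h n..b - h n}|lborel. \<gamma> t)\<bar> \<le> (LINT t|lebesgue_on {0<..<T}. \<bar>f (t, 1 - h n) - f (t, 1)\<bar>)" for n
    using shifted(2)[OF h1[of n] h(2)] split(2)[OF h1[of n] h(2)] by simp
  moreover have "(\<lambda>n. \<bar>(LINT t:{a..b}|lborel. along t 1) - r (h n) - (LINT t:{a - h n..b - h n}|lborel. \<gamma> t)\<bar>) \<longlonglongrightarrow>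
      \<bar>(LINT t:{a..b}|lborel. along t 1) - 0 - (LINT t:{a..b}|lborel. \<gamma> t)\<bar>"
    by (intro tendsto_intros R0 G0)
  ultimately have "\<bar>(LINT t:{a..b}|lborel. along t 1) - 0 - (LINT t:{a..b}|lborel. \<gamma> t)\<bar> \<le> 0"
    using C0 by (intro LIMSEQ_le[OF _ C0]) auto
  then show "(LINT t:{a..b}|lborel. \<gamma> t - along t 1) = 0"
    using set_integral_diff(2)[OF \<gamma>i' Ki] by simp
qed

lemma outflow_eq_along: "AE t in lborel. 0 < t \<longrightarrow> \<gamma> t = along t 1"
proof -
  have "AE t in lborel. \<forall>n. t \<in> {1 / real (Suc n)..real (Suc (Suc n))} \<longrightarrow> \<gamma> t - along t 1 = 0"
    unfolding AE_all_countable
  proof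
    fix n
    have n: "1 / real (Suc n) < real (Suc (Suc n))" by (rule order.strict_trans1[of _ 1]) auto
    show "AE t in lborel. t \<in> {1 / real (Suc n)..real (Suc (Suc n))} \<longrightarrow> \<gamma> t - along t 1 = 0"
    proof (rule AE_zero_if_integrals_zero)
      show "set_integrable lborel {1 / real (Suc n)..real (Suc (Suc n))} (\<lambda>t. \<gamma> t - along t 1)"
        by (rule outflow_integral_eq(1)[OF _ n]) simp
      show "(LINT t:{c..d}|lborel. \<gamma> t - along t 1) = 0" if "1 / real (Suc n) \<le> c" "c < d" for c d
        by (rule outflow_integral_eq(2)[OF _ that(2)]) (rule less_le_trans[OF _ that(1)], simp)
    qed measurable
  qed
  then show ?thesis
  proof eventually_elim
    fix t assume t: "\<forall>n. t \<in> {1 / real (Suc n)..real (Suc (Suc n))} \<longrightarrow> \<gamma> t - along t 1 = 0"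
    show "0 < t \<longrightarrow> \<gamma> t = along t 1"
    proof
      assume "0 < t"
      then obtain m where m: "inverse (real (Suc m)) < t" using reals_Archimedean by blast
      obtain k where k: "t < real k" using reals_Archimedean2 by blast
      have "1 / real (Suc (max m k)) \<le> inverse (real (Suc m))" by (simp add: inverse_eq_divide frac_le)
      then have "t \<in> {1 / real (Suc (max m k))..real (Suc (Suc (max m k)))}" using m k by auto
      with t have "\<gamma> t - along t 1 = 0" by blast
      then show "\<gamma> t = along t 1" by simp
    qed
  qed
qed

end

section \<open>Unfolding at the boundary\<close>

lemma AE_translate:
  fixes P :: "real \<Rightarrow> bool"
  assumes "AE x in lborel. P x" shows "AE x in lborel. P (t + x)"
  using AE_affine[OF assms, of 1 t] by simp

lemma AE_reflect:
  fixes P :: "real \<Rightarrow> bool"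
  assumes "AE x in lborel. P x" shows "AE x in lborel. P (t - x)"
  using AE_affine[OF assms, of "-1" t] by simp

lemma wrap_unique: "2 * of_int k \<le> y \<Longrightarrow> y < 2 * of_int k + 2 \<Longrightarrow> wrap y = y - 2 * of_int k"
  by (simp add: wrap_def floor_unique[of k "y / 2"])

lemma wrap_minus: "wrap (- y) = (if wrap y = 0 then 0 else 2 - wrap y)"
proof -
  have y: "y = wrap y + 2 * of_int \<lfloor>y / 2\<rfloor>" by (simp add: wrap_def)
  show ?thesis
  proof (cases "wrap y = 0")
    case True
    with y have "wrap (- y) = - y - 2 * of_int (- \<lfloor>y / 2\<rfloor>)" by (intro wrap_unique) auto
    then show ?thesis using True y by simp
  next
    case False
    then have "0 < wrap y" using wrap_range[of y] by simp
    then have "wrap (- y) = - y - 2 * of_int (- \<lfloor>y / 2\<rfloor> - 1)"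
      using y wrap_range[of y] by (intro wrap_unique) (auto simp: algebra_simps)
    then show ?thesis using False y by (simp add: algebra_simps)
  qed
qed

text \<open>
  The point of \<open>[0,1]\<close> below a point of the unfolded circle.
\<close>

definition fold_circle :: "real \<Rightarrow> real" where
  "fold_circle y = (if wrap y < 1 then wrap y else 2 - wrap y)"

lemma fold_circle_measurable [measurable]: "fold_circle \<in> borel_measurable borel"
  unfolding fold_circle_def[abs_def] by measurable

lemma fold_circle_minus: "fold_circle (- y) = fold_circle y"
  using wrap_range[of y] by (auto simp: fold_circle_def wrap_minus)

lemma periodic_fold_circle: "periodic fold_circle"
  using wrap_add_2 by (simp add: periodic_def fold_circle_def)

lemma AE_periodic:
  assumes "AE z in circle. P z" and per: "\<And>z. P (z + 2) = P z"
  shows "AE z in lborel. P (z :: real)"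
proof -
  have pP: "periodic P" using per by (simp add: periodic_def)
  have 0: "AE z in lborel. z \<in> {0..<2} \<longrightarrow> P z"
    using assms(1) unfolding circle_def by (subst (asm) AE_lborel_in) auto
  have "AE z in lborel. \<forall>k::int. - 2 * of_int k + z \<in> {0..<2} \<longrightarrow> P (- 2 * of_int k + z)"
    unfolding AE_all_countable by (intro allI AE_translate[OF 0])
  then show ?thesis
  proof eventually_elim
    fix z assume z: "\<forall>k::int. - 2 * of_int k + z \<in> {0..<2} \<longrightarrow> P (- 2 * of_int k + z)"
    have e: "- 2 * of_int \<lfloor>z / 2\<rfloor> + z = wrap z" by (simp add: wrap_def)
    from z[rule_format, of "\<lfloor>z / 2\<rfloor>"] have "P (wrap z)" unfolding e using wrap_range by auto
    then show "P z" by (simp add: periodic_wrap[OF pP])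
  qed
qed

lemma AE_circleI: "AE z in lborel. P z \<Longrightarrow> AE z in circle. P z"
  unfolding circle_def by (subst AE_lborel_in) (auto elim: eventually_mono)

lemma nn_integral_circle_split:
  assumes [measurable]: "g \<in> borel_measurable borel" and g: "periodic g"
  shows "(\<integral>\<^sup>+z. g z \<partial>circle) = (\<integral>\<^sup>+x. (g x + g (- x)) * indicator {0<..<1} x \<partial>lborel)"
proof -
  have g2: "g (2 - x) = g (- x)" for x using g by (metis add.commute minus_add_cancel periodic_def uminus_add_conv_diff)
  have "(\<integral>\<^sup>+z. g z \<partial>circle) = (\<integral>\<^sup>+z. g z * indicator {0..<2} z \<partial>lborel)"
    unfolding circle_def by (rule nn_integral_lborel_in) auto
  also have "\<dots> = (\<integral>\<^sup>+z. g z * indicator {0<..<1} z + g z * indicator {0<..<1} (2 - z) \<partial>lborel)"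
    by (rule nn_integral_cong_AE, use AE_lborel_singleton[of 0] AE_lborel_singleton[of 1] in eventually_elim)
       (auto simp: indicator_def)
  also have "\<dots> = (\<integral>\<^sup>+z. g z * indicator {0<..<1} z \<partial>lborel) + (\<integral>\<^sup>+z. g z * indicator {0<..<1} (2 - z) \<partial>lborel)"
    by (rule nn_integral_add) auto
  also have "(\<integral>\<^sup>+z. g z * indicator {0<..<1} (2 - z) \<partial>lborel) = (\<integral>\<^sup>+z. (\<lambda>x. g (2 - x) * indicator {0<..<1} x) (2 - z) \<partial>lborel)" by simp
  also have "\<dots> = (\<integral>\<^sup>+x. g (2 - x) * indicator {0<..<1} x \<partial>lborel)" by (rule nn_integral_reflect) measurable
  also have "(\<integral>\<^sup>+z. g z * indicator {0<..<1} z \<partial>lborel) + \<dots> = (\<integral>\<^sup>+x. g x * indicator {0<..<1} x + g (2 - x) * indicator {0<..<1} x \<partial>lborel)"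
    by (rule nn_integral_add[symmetric]) auto
  finally show ?thesis by (simp add: g2 distrib_right)
qed

lemma integral_circle_split:
  fixes g :: "real \<Rightarrow> real"
  assumes [measurable]: "g \<in> borel_measurable borel" and g: "periodic g" and i: "integrable circle g"
  shows "(\<integral>z. g z \<partial>circle) = (LINT x:{0<..<1}|lborel. g x + g (- x))"
proof -
  have g2: "g (2 - x) = g (- x)" for x using g by (metis add.commute minus_add_cancel periodic_def uminus_add_conv_diff)
  have s: "set_integrable lborel {0..<2} g" using i by (simp add: circle_def integrable_lborel_in)
  have s1: "set_integrable lborel {0<..<1} g" "set_integrable lborel {1<..<2} g"
    by (rule set_integrable_subset[OF s]; auto)+
  have i1: "indicator {1<..<2} (2 + - 1 * x) = (indicator {0<..<1} x :: real)" for x :: real by (auto simp: indicator_def)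
  have "(LINT x:{1<..<2}|lborel. g x) = (LINT x:{0<..<1}|lborel. g (- x))"
    unfolding set_lebesgue_integral_def
    by (subst lborel_integral_real_affine[where c = "-1" and t = 2]) (simp_all only: i1, simp_all add: g2)
  moreover have "set_integrable lborel {0<..<1} (\<lambda>x. g (- x))"
    using lborel_integrable_real_affine[OF s1(2)[unfolded set_integrable_def], of "-1" 2]
    unfolding set_integrable_def by (simp only: i1) (simp add: g2)
  moreover have "(\<integral>z. g z \<partial>circle) = (LINT x:{0<..<1} \<union> {1<..<2}|lborel. g x)"
  proof -
    have "(\<integral>z. g z \<partial>circle) = (LINT x:{0..<2}|lborel. g x)" by (simp add: circle_def integral_lborel_in)
    also have "\<dots> = (LINT x:{0<..<1} \<union> {1<..<2}|lborel. g x)"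
      unfolding set_lebesgue_integral_def
    proof (rule integral_cong_AE)
      show "AE x in lborel. indicator {0..<2} x *\<^sub>R g x = indicator ({0<..<1} \<union> {1<..<2}) x *\<^sub>R g x"
        using AE_lborel_singleton[of "0::real"] AE_lborel_singleton[of "1::real"]
        by eventually_elim (auto simp: indicator_def)
    qed measurable
    finally show ?thesis .
  qed
  moreover have "(LINT x:{0<..<1} \<union> {1<..<2}|lborel. g x) = (LINT x:{0<..<1}|lborel. g x) + (LINT x:{1<..<2}|lborel. g x)"
    by (rule set_integral_Un[OF _ s1]) auto
  ultimately show ?thesis using set_integral_add(2)[OF s1(1)] by simp
qed

lemma AE_plane_of_sum:
  assumes "AE m in lborel. P (m :: real)"
  shows "AE q in lborel. P (snd q + fst q)"
proof -
  have "AE z in lborel. P (1 - z)" using AE_reflect[OF assms, of 1] by simp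
  from AE_plane_mirror[OF AE_plane_of_characteristic[OF this]] show ?thesis by simp
qed

lemma strip_borel [measurable]: "strip \<in> sets borel"
  unfolding strip_def by (simp flip: borel_prod)

text \<open>
  Borel data of a broad solution. The functions \<open>ca\<close> and \<open>cb\<close> are
  \<open>a/2\<close> and \<open>b\<close>; \<open>\<beta>0\<close> and \<open>\<beta>1\<close> are
  the common traces of \<open>\<rho>\<close> and \<open>\<xi>\<close> at \<open>x = 0\<close> and
  \<open>x = 1\<close>.
\<close>

locale unfolded_system =
  fixes p M \<alpha> :: real and ca cb \<rho> \<xi> :: "real \<times> real \<Rightarrow> real" and \<rho>0 \<xi>0 \<beta>0 \<beta>1 :: "real \<Rightarrow> real"
  assumes p: "1 < p" and M: "0 \<le> M" and \<alpha>: "0 \<le> \<alpha>"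
    and ca_measurable [measurable]: "ca \<in> borel_measurable borel" and cb_measurable [measurable]: "cb \<in> borel_measurable borel"
    and \<rho>_measurable [measurable]: "\<rho> \<in> borel_measurable borel" and \<xi>_measurable [measurable]: "\<xi> \<in> borel_measurable borel"
    and \<rho>0_measurable [measurable]: "\<rho>0 \<in> borel_measurable borel" and \<xi>0_measurable [measurable]: "\<xi>0 \<in> borel_measurable borel"
    and \<beta>0_measurable [measurable]: "\<beta>0 \<in> borel_measurable borel" and \<beta>1_measurable [measurable]: "\<beta>1 \<in> borel_measurable borel"
    and ca_bounds: "0 \<le> ca q" "ca q \<le> M" and cb_bound: "\<bar>cb q\<bar> \<le> \<alpha>"
    and Lp: "0 < T \<Longrightarrow> set_integrable lborel ({0<..<T} \<times> {0<..<1}) (\<lambda>q. \<bar>\<xi> q\<bar> powr p + \<bar>\<rho> q\<bar> powr p)"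
    and \<rho>0_Lp: "set_integrable lborel {0<..<1} (\<lambda>x. \<bar>\<rho>0 x\<bar> powr p)"
    and \<xi>0_Lp: "set_integrable lborel {0<..<1} (\<lambda>x. \<bar>\<xi>0 x\<bar> powr p)"
begin

definition G :: "real \<times> real \<Rightarrow> real" where
  "G q = (if q \<in> strip then (ca q + cb q) * (\<rho> q - \<xi> q) else 0)"

definition entry_\<xi> :: "real \<Rightarrow> real" where
  "entry_\<xi> z = (if 0 < z then \<xi>0 z else if z < 0 then \<beta>0 (- z) else 0)"

definition entry_\<rho> :: "real \<Rightarrow> real" where
  "entry_\<rho> z = (if 0 < z then \<rho>0 (1 - z) else if z < 0 then \<beta>1 (- z) else 0)"

lemma G_measurable [measurable]: "G \<in> borel_measurable borel"
  unfolding G_def[abs_def] by measurable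

lemma G_off: "s \<le> 0 \<Longrightarrow> G (s, y) = 0" "y \<le> 0 \<Longrightarrow> G (s, y) = 0" "1 \<le> y \<Longrightarrow> G (s, y) = 0"
  by (auto simp: G_def strip_def)

lemma abs_G_le: "\<bar>G (s, x)\<bar> \<le> 2 * (M + \<alpha>) * (1 + (\<bar>\<xi> (s, x)\<bar> powr p + \<bar>\<rho> (s, x)\<bar> powr p))"
proof (cases "(s, x) \<in> strip")
  case True
  have y: "\<bar>y\<bar> \<le> 1 + \<bar>y\<bar> powr p" for y :: real by (rule abs_le_one_plus_powr) (use p in simp)
  have "\<bar>G (s, x)\<bar> = \<bar>ca (s, x) + cb (s, x)\<bar> * \<bar>\<rho> (s, x) - \<xi> (s, x)\<bar>" using True by (simp add: G_def abs_mult)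
  also have "\<dots> \<le> (M + \<alpha>) * (2 * (1 + (\<bar>\<xi> (s, x)\<bar> powr p + \<bar>\<rho> (s, x)\<bar> powr p)))"
  proof (rule mult_mono)
    show "\<bar>ca (s, x) + cb (s, x)\<bar> \<le> M + \<alpha>" using ca_bounds[of "(s, x)"] cb_bound[of "(s, x)"] by linarith
    show "\<bar>\<rho> (s, x) - \<xi> (s, x)\<bar> \<le> 2 * (1 + (\<bar>\<xi> (s, x)\<bar> powr p + \<bar>\<rho> (s, x)\<bar> powr p))"
    proof -
      have lin: "a + b \<le> 2 * (1 + (d + c))" if "a \<le> 1 + c" "b \<le> 1 + d" "0 \<le> c" "0 \<le> d" for a b c d :: real
        using that by simp
      show ?thesis by (rule order_trans[OF abs_triangle_ineq4 lin[OF y y]]) auto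
    qed
  qed (use M \<alpha> in auto)
  finally show ?thesis by (simp only: mult_ac)
next
  case False
  then show ?thesis using M \<alpha> by (simp add: G_def add_nonneg_nonneg)
qed

lemma G_integrable:
  assumes "0 < T" shows "set_integrable lborel ({0<..<T} \<times> UNIV) G"
proof -
  let ?R = "{0<..<T} \<times> {0<..<1} :: (real \<times> real) set"
  have R [measurable]: "?R \<in> sets borel" "({0<..<T} \<times> UNIV :: (real \<times> real) set) \<in> sets borel" by (simp_all flip: borel_prod)
  have "emeasure (lborel \<Otimes>\<^sub>M lborel) ?R = ennreal T"
    using assms by (subst lborel.emeasure_pair_measure_Times) auto
  then have "set_integrable lborel ?R (\<lambda>q. 1 :: real)"
    using R by (simp add: set_integrable_def lborel_prod)
  then have "set_integrable lborel ?R (\<lambda>q. 1 + (\<bar>\<xi> q\<bar> powr p + \<bar>\<rho> q\<bar> powr p))"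
    by (rule set_integral_add(1)[OF _ Lp[OF assms]])
  then have "set_integrable lborel ?R (\<lambda>q. 2 * (M + \<alpha>) * (1 + (\<bar>\<xi> q\<bar> powr p + \<bar>\<rho> q\<bar> powr p)))"
    by (rule set_integrable_mult_right)
  then have i: "integrable lborel (\<lambda>q. indicator ?R q *\<^sub>R (2 * (M + \<alpha>) * (1 + (\<bar>\<xi> q\<bar> powr p + \<bar>\<rho> q\<bar> powr p))))"
    by (simp add: set_integrable_def)
  show ?thesis
    unfolding set_integrable_def
  proof (rule Bochner_Integration.integrable_bound[OF i])
    show "AE q in lborel. norm (indicator ({0<..<T} \<times> UNIV) q *\<^sub>R G q) \<le> norm (indicator ?R q *\<^sub>R (2 * (M + \<alpha>) * (1 + (\<bar>\<xi> q\<bar> powr p + \<bar>\<rho> q\<bar> powr p))))"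
    proof (rule AE_I2)
      fix q :: "real \<times> real"
      obtain s x where q: "q = (s, x)" by fastforce
      show "norm (indicator ({0<..<T} \<times> UNIV) q *\<^sub>R G q) \<le> norm (indicator ?R q *\<^sub>R (2 * (M + \<alpha>) * (1 + (\<bar>\<xi> q\<bar> powr p + \<bar>\<rho> q\<bar> powr p))))"
      proof (cases "q \<in> ?R")
        case True
        then show ?thesis using abs_G_le[of s x] by (simp add: q)
      next
        case False
        then have "G q = 0 \<or> s \<notin> {0<..<T}" using G_off[of x s] by (auto simp: q)
        then show ?thesis using False by (auto simp: q)
      qed
    qed
  qed measurable
qed

text \<open>
  The source on the unfolded circle. What \<open>\<xi>\<close> gains at a point is lost by
  \<open>\<rho>\<close>, hence the sign on the half that carries \<open>\<rho>\<close>.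
\<close>

definition U :: "real \<Rightarrow> real \<Rightarrow> real" where
  "U s y = (if wrap y < 1 then G (s, wrap y) else - G (s, 2 - wrap y))"

definition u :: "real \<Rightarrow> real \<Rightarrow> real" where
  "u s z = U s (z + s)"

definition v0 :: "real \<Rightarrow> real" where
  "v0 z = (if wrap z < 1 then \<xi>0 (wrap z) else \<rho>0 (2 - wrap z))"

definition v :: "real \<Rightarrow> real \<Rightarrow> real" where
  "v t z = v0 z + (LINT s:{0..t}|lborel. u s z)"

definition ka :: "real \<Rightarrow> real \<Rightarrow> real" where
  "ka s z = ca (s, fold_circle (z + s))"

definition kb :: "real \<Rightarrow> real \<Rightarrow> real" where
  "kb s z = cb (s, fold_circle (z + s))"

lemma U_measurable [measurable]: "case_prod U \<in> borel_measurable (borel \<Otimes>\<^sub>M borel)"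
  unfolding U_def[abs_def] by measurable

lemma u_measurable [measurable]: "case_prod u \<in> borel_measurable (borel \<Otimes>\<^sub>M borel)"
  unfolding u_def[abs_def] by measurable

lemma v0_measurable [measurable]: "v0 \<in> borel_measurable borel"
  unfolding v0_def[abs_def] by measurable

lemma v_measurable [measurable]: "case_prod v \<in> borel_measurable (borel \<Otimes>\<^sub>M borel)"
proof -
  have "case_prod v = (\<lambda>q. v0 (snd q) + (\<integral>s. (if 0 \<le> s \<and> s \<le> fst q then u s (snd q) else 0) \<partial>lborel))"
    by (auto simp: v_def fun_eq_iff set_lebesgue_integral_def indicator_def intro!: Bochner_Integration.integral_cong)
  also have "\<dots> \<in> borel_measurable (borel \<Otimes>\<^sub>M borel)" by measurable
  finally show ?thesis .
qed

lemma ka_measurable [measurable]: "case_prod ka \<in> borel_measurable (borel \<Otimes>\<^sub>M borel)"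
  unfolding ka_def[abs_def] by measurable

lemma kb_measurable [measurable]: "case_prod kb \<in> borel_measurable (borel \<Otimes>\<^sub>M borel)"
  unfolding kb_def[abs_def] by measurable

lemma U_add_2: "U s (y + 2) = U s y"
  using wrap_add_2 by (simp add: U_def periodic_def)

lemma periodic_U: "periodic (U s)"
  by (simp add: periodic_def U_add_2)

lemma u_add_2: "u s (z + 2) = u s z"
  using U_add_2[of s "z + s"] by (simp add: u_def algebra_simps)

lemma v0_add_2: "v0 (z + 2) = v0 z"
  using wrap_add_2 by (simp add: v0_def periodic_def)

lemma v_add_2: "v t (z + 2) = v t z"
  by (simp add: v_def v0_add_2 u_add_2)

lemma periodic_v: "periodic (v t)"
  by (simp add: periodic_def v_add_2)

lemma v_0: "v 0 z = v0 z"
  by (simp add: v_def set_integral_Icc_same del: atLeastAtMost_singleton)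

lemma U_right:
  assumes "0 \<le> y" "y \<le> 1" shows "U s y = G (s, y)"
  using assms G_off(3)[of 1 s] by (auto simp: U_def wrap_id)

lemma U_left:
  assumes "-1 \<le> y" "y \<le> 0" shows "U s y = - G (s, - y)"
proof (cases "y = 0")
  case True
  then show ?thesis using G_off(2)[of 0 s] by (simp add: U_def wrap_id)
next
  case False
  with assms have "wrap y = y - 2 * of_int (-1)" by (intro wrap_unique) auto
  then show ?thesis using assms by (simp add: U_def)
qed

lemma v0_right: "0 < z \<Longrightarrow> z < 1 \<Longrightarrow> v0 z = \<xi>0 z"
  by (simp add: v0_def wrap_id)

lemma v0_left:
  assumes "0 < m" "m < 1" shows "v0 (- m) = \<rho>0 m"
proof -
  have "wrap (- m) = - m - 2 * of_int (-1)" using assms by (intro wrap_unique) auto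
  then show ?thesis using assms by (simp add: v0_def)
qed

lemma u_integrable:
  assumes T: "0 < T" shows "integrable (spacetime 0 T) (\<lambda>(s, z). u s z)"
proof (rule integrableI_bounded)
  have "(\<integral>\<^sup>+x. ennreal (norm (case x of (s, z) \<Rightarrow> u s z)) \<partial>spacetime 0 T) = (\<integral>\<^sup>+s. \<integral>\<^sup>+z. ennreal \<bar>u s z\<bar> \<partial>circle \<partial>lborel_in {0..T})"
    by (subst circle.nn_integral_fst[symmetric]) auto
  also have "\<dots> = (\<integral>\<^sup>+s. \<integral>\<^sup>+x. 2 * ennreal \<bar>G (s, x)\<bar> \<partial>lborel \<partial>lborel_in {0..T})"
  proof (rule nn_integral_cong)
    fix s
    have per: "periodic (\<lambda>y. ennreal \<bar>U s y\<bar>)" by (rule periodic_compose) (rule periodic_U)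
    have "(\<integral>\<^sup>+z. ennreal \<bar>u s z\<bar> \<partial>circle) = (\<integral>\<^sup>+y. ennreal \<bar>U s y\<bar> \<partial>circle)"
      unfolding u_def by (rule nn_integral_circle_shift[OF _ per]) measurable
    also have "\<dots> = (\<integral>\<^sup>+x. (ennreal \<bar>U s x\<bar> + ennreal \<bar>U s (- x)\<bar>) * indicator {0<..<1} x \<partial>lborel)"
      by (rule nn_integral_circle_split[OF _ per]) measurable
    also have "\<dots> = (\<integral>\<^sup>+x. 2 * ennreal \<bar>G (s, x)\<bar> \<partial>lborel)"
      using G_off by (intro nn_integral_cong) (auto simp: indicator_def U_right U_left mult_2)
    finally show "(\<integral>\<^sup>+z. ennreal \<bar>u s z\<bar> \<partial>circle) = (\<integral>\<^sup>+x. 2 * ennreal \<bar>G (s, x)\<bar> \<partial>lborel)" .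
  qed
  also have "\<dots> = (\<integral>\<^sup>+s. (\<integral>\<^sup>+x. 2 * ennreal \<bar>G (s, x)\<bar> \<partial>lborel) * indicator {0..T} s \<partial>lborel)"
    by (rule nn_integral_lborel_in) auto
  also have "\<dots> \<le> (\<integral>\<^sup>+s. \<integral>\<^sup>+x. 2 * ennreal (indicator {0<..<T + 1} s * \<bar>G (s, x)\<bar>) \<partial>lborel \<partial>lborel)"
  proof (intro nn_integral_mono)
    fix s
    show "(\<integral>\<^sup>+x. 2 * ennreal \<bar>G (s, x)\<bar> \<partial>lborel) * indicator {0..T} s \<le> (\<integral>\<^sup>+x. 2 * ennreal (indicator {0<..<T + 1} s * \<bar>G (s, x)\<bar>) \<partial>lborel)"
      using G_off(1)[of s] by (cases "s \<le> 0") (auto simp: indicator_def)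
  qed
  also have "\<dots> = (\<integral>\<^sup>+(s, x). 2 * ennreal (indicator {0<..<T + 1} s * \<bar>G (s, x)\<bar>) \<partial>(lborel \<Otimes>\<^sub>M lborel))"
    by (subst lborel.nn_integral_fst[symmetric]) auto
  also have "\<dots> = (\<integral>\<^sup>+q. 2 * (case q of (s, x) \<Rightarrow> ennreal (indicator {0<..<T + 1} s * \<bar>G (s, x)\<bar>)) \<partial>(lborel \<Otimes>\<^sub>M lborel))"
    by (intro nn_integral_cong) auto
  also have "\<dots> = 2 * (\<integral>\<^sup>+(s, x). ennreal (indicator {0<..<T + 1} s * \<bar>G (s, x)\<bar>) \<partial>(lborel \<Otimes>\<^sub>M lborel))"
    by (rule nn_integral_cmult) measurable
  also have "(\<integral>\<^sup>+(s, x). ennreal (indicator {0<..<T + 1} s * \<bar>G (s, x)\<bar>) \<partial>(lborel \<Otimes>\<^sub>M lborel))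
      = (\<integral>\<^sup>+q. ennreal (norm (indicator ({0<..<T + 1} \<times> UNIV) q *\<^sub>R G q)) \<partial>(lborel \<Otimes>\<^sub>M lborel))"
    by (intro nn_integral_cong) (auto simp: indicator_def)
  also have "2 * \<dots> < \<infinity>"
    using G_integrable[of "T + 1"] T by (auto simp: set_integrable_def integrable_iff_bounded lborel_prod ennreal_mult_less_top)
  finally show "(\<integral>\<^sup>+x. ennreal (norm (case x of (s, z) \<Rightarrow> u s z)) \<partial>spacetime 0 T) < \<infinity>" .
qed (auto intro: spacetime_measurable)

definition regular :: "real \<Rightarrow> bool" where
  "regular z \<longleftrightarrow> (\<forall>n. set_integrable lborel {0..real (Suc n)} (\<lambda>s. u s z))"

lemma AE_regular: "AE z in lborel. regular z"
proof (rule AE_periodic)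
  show "AE z in circle. regular z"
    unfolding regular_def AE_all_countable
  proof
    fix n
    have "AE z in circle. integrable (lborel_in {0..real (Suc n)}) (\<lambda>s. u s z)"
      using Icc_circle.AE_integrable_snd[where f = u and a = 0 and b = "real (Suc n)"] u_integrable[of "real (Suc n)"] by simp
    then show "AE z in circle. set_integrable lborel {0..real (Suc n)} (\<lambda>s. u s z)"
      by eventually_elim (simp add: integrable_lborel_in)
  qed
qed (simp add: regular_def u_add_2)

lemma regular_integrable:
  assumes "regular z" shows "set_integrable lborel {0..t} (\<lambda>s. u s z)"
proof -
  obtain n where "t < real n" using reals_Archimedean2 by blast
  then have "{0..t} \<subseteq> {0..real (Suc n)}" by auto
  moreover have "set_integrable lborel {0..real (Suc n)} (\<lambda>s. u s z)" using assms by (simp only: regular_def)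
  ultimately show ?thesis by (intro set_integrable_subset[of lborel "{0..real (Suc n)}" "\<lambda>s. u s z" "{0..t}"]) simp_all
qed

lemma v_along:
  assumes z: "regular z" and \<tau>: "0 \<le> \<tau>" "\<tau> \<le> t"
    and g: "\<And>s. 0 \<le> s \<Longrightarrow> s \<le> \<tau> \<Longrightarrow> g s = 0" "\<And>s. \<tau> < s \<Longrightarrow> s \<le> t \<Longrightarrow> g s = u s z"
  shows "v \<tau> z + (LINT s:{0..t}|lborel. g s) = v t z"
proof -
  have "(LINT s:{0..t}|lborel. g s) = (LINT s:{\<tau><..t}|lborel. u s z)"
    unfolding set_lebesgue_integral_def
    by (intro Bochner_Integration.integral_cong) (use \<tau> g in \<open>auto simp: indicator_def\<close>)
  then show ?thesis
    using set_integral_Icc_append[OF regular_integrable[OF z, of t] \<tau>] by (simp add: v_def)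
qed

lemma right_characteristic:
  assumes "regular z" "max 0 (- z) \<le> t" "t \<le> 1 - z"
  shows "v (max 0 (- z)) z + (LINT s:{0..t}|lborel. G (s, z + s)) = v t z"
proof (rule v_along[OF assms(1) _ assms(2)])
  fix s
  show "G (s, z + s) = 0" if "0 \<le> s" "s \<le> max 0 (- z)" using that G_off by (auto simp: max_def split: if_splits)
  show "G (s, z + s) = u s z" if "max 0 (- z) < s" "s \<le> t"
    using that assms by (simp add: u_def U_right)
qed auto

lemma left_characteristic:
  assumes "regular (- m)" "max 0 (m - 1) \<le> t" "t \<le> m"
  shows "v (max 0 (m - 1)) (- m) + (LINT s:{0..t}|lborel. - G (s, m - s)) = v t (- m)"
proof (rule v_along[OF assms(1) _ assms(2)])
  fix s
  show "- G (s, m - s) = 0" if "0 \<le> s" "s \<le> max 0 (m - 1)" using that G_off by (auto simp: max_def split: if_splits)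
  show "- G (s, m - s) = u s (- m)" if "max 0 (m - 1) < s" "s \<le> t"
    using that assms by (simp add: u_def U_left)
qed auto

lemma ka_window:
  assumes W: "W \<subseteq> {0<..<1}" and [measurable]: "W \<in> sets borel" and a: "0 \<le> a"
    and ca: "AE q in lborel. 0 < fst q \<and> snd q \<in> W \<longrightarrow> \<mu> \<le> ca q"
  shows "AE (s, z) in spacetime a b. wrap (z + s) \<in> W \<longrightarrow> \<mu> \<le> ka s z"
proof -
  have *: "AE s in lborel. 0 < s \<longrightarrow> (AE z in lborel. wrap (z + s) \<in> W \<longrightarrow> \<mu> \<le> ka s z)"
    using AE_planeD[OF ca]
  proof (eventually_elim, intro impI)
    fix s :: real assume s: "0 < s" and e: "AE y in lborel. 0 < fst (s, y) \<and> snd (s, y) \<in> W \<longrightarrow> \<mu> \<le> ca (s, y)"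
    define R where "R y \<longleftrightarrow> (wrap y \<in> W \<longrightarrow> \<mu> \<le> ca (s, fold_circle y))" for y
    have "AE y in circle. R y"
      unfolding circle_def
    proof (subst AE_lborel_in, simp)
      show "AE y in lborel. y \<in> {0..<2} \<longrightarrow> R y"
        using e by eventually_elim (use s W in \<open>auto simp: R_def wrap_id fold_circle_def\<close>)
    qed
    moreover have "R (y + 2) = R y" for y
      using wrap_add_2 periodic_fold_circle by (simp add: R_def periodic_def)
    ultimately have "AE y in lborel. R y" by (rule AE_periodic)
    from AE_translate[OF this, of s]
    show "AE z in lborel. wrap (z + s) \<in> W \<longrightarrow> \<mu> \<le> ka s z"
      by eventually_elim (simp add: R_def ka_def add.commute)
  qed
  have m: "{x \<in> space (spacetime a b). case x of (s, z) \<Rightarrow> wrap (z + s) \<in> W \<longrightarrow> \<mu> \<le> ka s z} \<in> sets (spacetime a b)"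
    by measurable
  show ?thesis
  proof (rule Icc_circle.AE_pair_measure[OF m])
    show "AE s in lborel_in {a..b}. AE z in circle. case (s, z) of (s, z) \<Rightarrow> wrap (z + s) \<in> W \<longrightarrow> \<mu> \<le> ka s z"
      unfolding AE_lborel_in[OF borel_closed[OF closed_atLeastAtMost]]
      using * AE_lborel_singleton[of 0] by eventually_elim (use a in \<open>auto intro: AE_circleI\<close>)
  qed
qed

end

locale unfolded_solution = unfolded_system +
  assumes \<xi>_rule: "AE q in lborel. q \<in> strip \<longrightarrow>
      \<xi> q = entry_\<xi> (snd q - fst q) + (LINT s:{0..fst q}|lborel. G (s, (snd q - fst q) + s))"
    and \<rho>_rule: "AE q in lborel. q \<in> strip \<longrightarrow>
      \<rho> q = entry_\<rho> (1 - (snd q + fst q)) + (LINT s:{0..fst q}|lborel. - G (s, (snd q + fst q) - s))"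
    and \<beta>1_rule: "AE t in lborel. 0 < t \<longrightarrow> \<beta>1 t = entry_\<xi> (1 - t) + (LINT s:{0..t}|lborel. G (s, (1 - t) + s))"
    and \<beta>0_rule: "AE t in lborel. 0 < t \<longrightarrow> \<beta>0 t = entry_\<rho> (1 - t) + (LINT s:{0..t}|lborel. - G (s, t - s))"
begin

text \<open>
  The characteristic \<open>x - t = z\<close> enters the strip at time \<open>max 0 (- z)\<close>:
  initially if \<open>z > 0\<close>, otherwise through \<open>x = 0\<close>. Its entry value
  agrees with \<open>v\<close>.
\<close>

definition match_\<xi> :: "real \<Rightarrow> bool" where
  "match_\<xi> z \<longleftrightarrow> entry_\<xi> z = v (max 0 (- z)) z"

text \<open>
  The same for the characteristic \<open>x + t = m\<close> of \<open>\<rho>\<close>, which enters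
  through \<open>x = 1\<close> if \<open>m > 1\<close>. On the unfolded circle its label is
  \<open>z = - m\<close>.
\<close>

definition match_\<rho> :: "real \<Rightarrow> bool" where
  "match_\<rho> m \<longleftrightarrow> entry_\<rho> (1 - m) = v (max 0 (m - 1)) (- m)"

text \<open>
  Induction on the number of reflections. If the entry value of a characteristic agrees with
  \<open>v\<close>, so does its value on leaving the strip, one unit of time after the side was
  entered. By the trace rules this is the entry value of the reflected characteristic. At \<open>x
  = 1\<close> the labels \<open>1 - \<tau>\<close> and \<open>- (1 + \<tau>)\<close> of the two
  characteristics differ by a full period.
\<close>

lemma AE_match:
  "(AE z in lborel. - real k < z \<and> z < 1 \<longrightarrow> match_\<xi> z) \<and> (AE m in lborel. 0 < m \<and> m < real k + 1 \<longrightarrow> match_\<rho> m)"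
proof (induction k)
  case 0
  have "match_\<xi> z" if "0 < z" "z < 1" for z
    using that by (simp add: match_\<xi>_def entry_\<xi>_def v_0 v0_right)
  moreover have "match_\<rho> m" if "0 < m" "m < 1" for m
    using that by (simp add: match_\<rho>_def entry_\<rho>_def v_0 v0_left)
  ultimately show ?case by simp
next
  case (Suc k)
  then have IH1: "AE z in lborel. - real k < z \<and> z < 1 \<longrightarrow> match_\<xi> z"
    and IH2: "AE m in lborel. 0 < m \<and> m < real k + 1 \<longrightarrow> match_\<rho> m" by auto
  have \<beta>0v: "AE \<tau> in lborel. 0 < \<tau> \<and> \<tau> < real k + 1 \<longrightarrow> \<beta>0 \<tau> = v \<tau> (- \<tau>)"
    using IH2 \<beta>0_rule AE_reflect[OF AE_regular, of 0]
  proof eventually_elim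
    case (elim \<tau>)
    show ?case
    proof
      assume \<tau>: "0 < \<tau> \<and> \<tau> < real k + 1"
      have "regular (- \<tau>)" using elim(3) by simp
      from left_characteristic[OF this, of \<tau>] show "\<beta>0 \<tau> = v \<tau> (- \<tau>)"
        using \<tau> elim(1,2) by (simp add: match_\<rho>_def)
    qed
  qed
  have \<beta>1v: "AE \<tau> in lborel. 0 < \<tau> \<and> \<tau> < real k + 1 \<longrightarrow> \<beta>1 \<tau> = v \<tau> (1 - \<tau>)"
    using AE_reflect[OF IH1, of 1] \<beta>1_rule AE_reflect[OF AE_regular, of 1]
  proof eventually_elim
    case (elim \<tau>)
    show ?case
    proof
      assume \<tau>: "0 < \<tau> \<and> \<tau> < real k + 1"
      have "regular (1 - \<tau>)" using elim(3) by simp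
      from right_characteristic[OF this, of \<tau>] show "\<beta>1 \<tau> = v \<tau> (1 - \<tau>)"
        using \<tau> elim(1,2) by (simp add: match_\<xi>_def)
    qed
  qed
  have "AE z in lborel. - real (Suc k) < z \<and> z < 1 \<longrightarrow> match_\<xi> z"
    using IH1 AE_reflect[OF \<beta>0v, of 0] AE_lborel_singleton[of "- real k"]
  proof eventually_elim
    case (elim z)
    show ?case
    proof
      assume z: "- real (Suc k) < z \<and> z < 1"
      show "match_\<xi> z"
      proof (cases "- real k < z")
        case False
        then have "z < 0" "- real k > z" using elim(3) by auto
        then show ?thesis using elim(2) z by (simp add: match_\<xi>_def entry_\<xi>_def)
      qed (use elim(1) z in auto)
    qed
  qed
  moreover have "AE m in lborel. 0 < m \<and> m < real (Suc k) + 1 \<longrightarrow> match_\<rho> m"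
    using IH2 AE_translate[OF \<beta>1v, of "-1"] AE_lborel_singleton[of "real k + 1"]
  proof eventually_elim
    case (elim m)
    show ?case
    proof
      assume m: "0 < m \<and> m < real (Suc k) + 1"
      show "match_\<rho> m"
      proof (cases "m < real k + 1")
        case False
        then have k: "real k + 1 < m" using elim(3) by auto
        then have "\<beta>1 (m - 1) = v (m - 1) (1 - (m - 1))" using elim(2) m by simp
        also have "\<dots> = v (m - 1) (- m)" using v_add_2[of "m - 1" "- m"] by (simp add: algebra_simps)
        finally show ?thesis using k by (simp add: match_\<rho>_def entry_\<rho>_def)
      qed (use elim(1) m in auto)
    qed
  qed
  ultimately show ?case by simp
qed

lemma AE_match_\<xi>: "AE z in lborel. z < 1 \<longrightarrow> match_\<xi> z"
proof -
  have "AE z in lborel. \<forall>k. - real k < z \<and> z < 1 \<longrightarrow> match_\<xi> z"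
    unfolding AE_all_countable using AE_match by blast
  then show ?thesis
    by eventually_elim (metis minus_less_iff reals_Archimedean2)
qed

lemma AE_match_\<rho>: "AE m in lborel. 0 < m \<longrightarrow> match_\<rho> m"
proof -
  have "AE m in lborel. \<forall>k. 0 < m \<and> m < real k + 1 \<longrightarrow> match_\<rho> m"
    unfolding AE_all_countable using AE_match by blast
  then show ?thesis
    by eventually_elim (metis reals_Archimedean2 less_add_one order_less_trans)
qed

lemma solution_eq_v:
  "AE q in lborel. q \<in> strip \<longrightarrow> \<xi> q = v (fst q) (snd q - fst q) \<and> \<rho> q = v (fst q) (- snd q - fst q)"
proof -
  have "AE m in lborel. regular (- m)" using AE_reflect[OF AE_regular, of 0] by simp
  from AE_plane_of_sum[OF this] AE_plane_of_sum[OF AE_match_\<rho>]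
    AE_plane_of_characteristic[OF AE_regular] AE_plane_of_characteristic[OF AE_match_\<xi>] \<xi>_rule \<rho>_rule
  show ?thesis
  proof eventually_elim
    case (elim q)
    obtain t x where q: "q = (t, x)" by fastforce
    show ?case
    proof
      assume "q \<in> strip"
      then have tx: "0 < t" "0 < x" "x < 1" by (auto simp: strip_def q)
      have "\<xi> q = v t (x - t)"
        using right_characteristic[of "x - t" t] elim(3,4,5) \<open>q \<in> strip\<close> tx by (simp add: q match_\<xi>_def)
      moreover have "\<rho> q = v t (- (x + t))"
        using left_characteristic[of "x + t" t] elim(1,2,6) \<open>q \<in> strip\<close> tx by (simp add: q match_\<rho>_def)
      ultimately show "\<xi> q = v (fst q) (snd q - fst q) \<and> \<rho> q = v (fst q) (- snd q - fst q)" by (simp add: q)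
    qed
  qed
qed

lemma nn_integral_v_powr:
  "AE t in lborel. 0 < t \<longrightarrow> (\<integral>\<^sup>+z. ennreal (\<bar>v t z\<bar> powr p) \<partial>circle) =
     (\<integral>\<^sup>+x. ennreal (\<bar>\<xi> (t, x)\<bar> powr p + \<bar>\<rho> (t, x)\<bar> powr p) * indicator {0<..<1} x \<partial>lborel)"
  using AE_planeD[OF solution_eq_v]
proof (eventually_elim, intro impI)
  fix t :: real assume t: "0 < t"
    and e: "AE x in lborel. (t, x) \<in> strip \<longrightarrow> \<xi> (t, x) = v (fst (t, x)) (snd (t, x) - fst (t, x)) \<and> \<rho> (t, x) = v (fst (t, x)) (- snd (t, x) - fst (t, x))"
  define g where "g y = ennreal (\<bar>v t (y - t)\<bar> powr p)" for y
  have [measurable]: "g \<in> borel_measurable borel" unfolding g_def[abs_def] by measurable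
  have g: "periodic g" unfolding g_def[abs_def] using periodic_shift[OF periodic_v[of t], of "- t"] by (simp add: periodic_def)
  have "(\<integral>\<^sup>+z. ennreal (\<bar>v t z\<bar> powr p) \<partial>circle) = (\<integral>\<^sup>+y. g y \<partial>circle)"
    using nn_integral_circle_shift[OF _ g, of t] by (simp add: g_def)
  also have "\<dots> = (\<integral>\<^sup>+x. (g x + g (- x)) * indicator {0<..<1} x \<partial>lborel)"
    by (rule nn_integral_circle_split[OF _ g]) measurable
  also have "\<dots> = (\<integral>\<^sup>+x. ennreal (\<bar>\<xi> (t, x)\<bar> powr p + \<bar>\<rho> (t, x)\<bar> powr p) * indicator {0<..<1} x \<partial>lborel)"
    by (rule nn_integral_cong_AE, use e in eventually_elim) (use t in \<open>auto simp: g_def strip_def indicator_def\<close>)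
  finally show "(\<integral>\<^sup>+z. ennreal (\<bar>v t z\<bar> powr p) \<partial>circle) =
     (\<integral>\<^sup>+x. ennreal (\<bar>\<xi> (t, x)\<bar> powr p + \<bar>\<rho> (t, x)\<bar> powr p) * indicator {0<..<1} x \<partial>lborel)" .
qed

lemma v_Lp:
  assumes T: "0 \<le> T" shows "integrable (spacetime 0 T) (\<lambda>(s, z). \<bar>v s z\<bar> powr p)"
proof (rule integrableI_bounded)
  define w where "w q = \<bar>\<xi> q\<bar> powr p + \<bar>\<rho> q\<bar> powr p" for q
  have [measurable]: "w \<in> borel_measurable borel" unfolding w_def[abs_def] by measurable
  have w0: "0 \<le> w q" for q by (simp add: w_def)
  have "(\<integral>\<^sup>+x. ennreal (norm (case x of (s, z) \<Rightarrow> \<bar>v s z\<bar> powr p)) \<partial>spacetime 0 T) = (\<integral>\<^sup>+s. \<integral>\<^sup>+z. ennreal (\<bar>v s z\<bar> powr p) \<partial>circle \<partial>lborel_in {0..T})"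
    by (subst circle.nn_integral_fst[symmetric]) auto
  also have "\<dots> = (\<integral>\<^sup>+s. (\<integral>\<^sup>+z. ennreal (\<bar>v s z\<bar> powr p) \<partial>circle) * indicator {0..T} s \<partial>lborel)"
    by (rule nn_integral_lborel_in) auto
  also have "\<dots> \<le> (\<integral>\<^sup>+s. \<integral>\<^sup>+x. ennreal (w (s, x)) * indicator {0<..<T + 1} s * indicator {0<..<1} x \<partial>lborel \<partial>lborel)"
    by (rule nn_integral_mono_AE, use nn_integral_v_powr AE_lborel_singleton[of 0] in eventually_elim)
       (auto simp: indicator_def w_def)
  also have "\<dots> = (\<integral>\<^sup>+(s, x). ennreal (w (s, x)) * indicator {0<..<T + 1} s * indicator {0<..<1} x \<partial>(lborel \<Otimes>\<^sub>M lborel))"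
    by (subst lborel.nn_integral_fst[symmetric]) auto
  also have "\<dots> = (\<integral>\<^sup>+q. ennreal (norm (indicator ({0<..<T + 1} \<times> {0<..<1}) q *\<^sub>R w q)) \<partial>(lborel \<Otimes>\<^sub>M lborel))"
    using w0 by (intro nn_integral_cong) (auto simp: indicator_def)
  also have "\<dots> < \<infinity>"
    using Lp[of "T + 1"] T by (simp add: set_integrable_def integrable_iff_bounded lborel_prod w_def)
  finally show "(\<integral>\<^sup>+x. ennreal (norm (case x of (s, z) \<Rightarrow> \<bar>v s z\<bar> powr p)) \<partial>spacetime 0 T) < \<infinity>" .
qed (auto intro: spacetime_measurable)

lemma nn_integral_v0_powr:
  "(\<integral>\<^sup>+z. ennreal (\<bar>v0 z\<bar> powr p) \<partial>circle) = ennreal (LINT x:{0<..<1}|lborel. \<bar>\<xi>0 x\<bar> powr p + \<bar>\<rho>0 x\<bar> powr p)"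
proof -
  have per: "periodic (\<lambda>z. ennreal (\<bar>v0 z\<bar> powr p))" by (simp add: periodic_def v0_add_2)
  have "(\<integral>\<^sup>+z. ennreal (\<bar>v0 z\<bar> powr p) \<partial>circle) = (\<integral>\<^sup>+x. (ennreal (\<bar>v0 x\<bar> powr p) + ennreal (\<bar>v0 (- x)\<bar> powr p)) * indicator {0<..<1} x \<partial>lborel)"
    by (rule nn_integral_circle_split[OF _ per]) measurable
  also have "\<dots> = (\<integral>\<^sup>+x. ennreal (indicator {0<..<1} x *\<^sub>R (\<bar>\<xi>0 x\<bar> powr p + \<bar>\<rho>0 x\<bar> powr p)) \<partial>lborel)"
    by (intro nn_integral_cong) (auto simp: indicator_def v0_right v0_left)
  also have "\<dots> = ennreal (LINT x:{0<..<1}|lborel. \<bar>\<xi>0 x\<bar> powr p + \<bar>\<rho>0 x\<bar> powr p)"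
    unfolding set_lebesgue_integral_def
    using set_integral_add(1)[OF \<xi>0_Lp \<rho>0_Lp] by (intro nn_integral_eq_integral) (auto simp: set_integrable_def)
  finally show ?thesis .
qed

lemma v0_Lp: "integrable circle (\<lambda>z. \<bar>v 0 z\<bar> powr p)"
  by (rule integrableI_bounded) (simp_all add: v_0 nn_integral_v0_powr)

lemma energy_0: "(\<integral>z. \<bar>v 0 z\<bar> powr p \<partial>circle) = (LINT x:{0<..<1}|lborel. \<bar>\<xi>0 x\<bar> powr p + \<bar>\<rho>0 x\<bar> powr p)"
proof -
  have "ennreal (\<integral>z. \<bar>v 0 z\<bar> powr p \<partial>circle) = ennreal (LINT x:{0<..<1}|lborel. \<bar>\<xi>0 x\<bar> powr p + \<bar>\<rho>0 x\<bar> powr p)"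
    using nn_integral_eq_integral[OF v0_Lp] nn_integral_v0_powr by (simp add: v_0)
  moreover have "0 \<le> (LINT x:{0<..<1}|lborel. \<bar>\<xi>0 x\<bar> powr p + \<bar>\<rho>0 x\<bar> powr p)"
    unfolding set_lebesgue_integral_def by (intro integral_nonneg_AE AE_I2) auto
  ultimately show ?thesis by (subst (asm) ennreal_inj) auto
qed

lemma mean_0: "(\<integral>z. v 0 z \<partial>circle) = (LINT x:{0<..<1}|lborel. \<xi>0 x + \<rho>0 x)"
proof -
  have "integrable circle v0"
    by (rule circle.integrable_of_abs_powr[of p]) (use v0_Lp p in \<open>auto simp: v_0\<close>)
  then have "(\<integral>z. v0 z \<partial>circle) = (LINT x:{0<..<1}|lborel. v0 x + v0 (- x))"
    by (intro integral_circle_split) (auto simp: periodic_def v0_add_2)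
  also have "\<dots> = (LINT x:{0<..<1}|lborel. \<xi>0 x + \<rho>0 x)"
    by (intro set_lebesgue_integral_cong) (auto simp: v0_right v0_left)
  finally show ?thesis by (simp add: v_0)
qed

text \<open>
  By \<open>solution_eq_v\<close> the values \<open>\<xi>(s,x)\<close> and
  \<open>\<rho>(s,x)\<close> are those of \<open>v s\<close> at two exchange partners, so the
  source is the exchange term on \<open>(0,1)\<close> and, with both signs reversed, on its mirror
  image. The rest follows by periodicity.
\<close>

lemma u_exchange:
  assumes T: "0 \<le> T" shows "AE (s, z) in spacetime 0 T. u s z = (ka s z + kb s z) * (v s (- z - 2 * s) - v s z)"
proof -
  have *: "AE s in lborel. 0 < s \<longrightarrow> (AE z in lborel. u s z = (ka s z + kb s z) * (v s (- z - 2 * s) - v s z))"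
    using AE_planeD[OF solution_eq_v]
  proof (eventually_elim, intro impI)
    fix s :: real assume s: "0 < s"
      and e: "AE x in lborel. (s, x) \<in> strip \<longrightarrow> \<xi> (s, x) = v (fst (s, x)) (snd (s, x) - fst (s, x)) \<and> \<rho> (s, x) = v (fst (s, x)) (- snd (s, x) - fst (s, x))"
    define c where "c y = ca (s, fold_circle y) + cb (s, fold_circle y)" for y
    define R where "R y \<longleftrightarrow> U s y = c y * (v s (- y - s) - v s (y - s))" for y
    have cm: "c (- y) = c y" for y by (simp add: c_def fold_circle_minus)
    have c2: "c (y + 2) = c y" for y using periodic_fold_circle by (simp add: c_def periodic_def)
    have v2: "v s (- (y + 2) - s) = v s (- y - s)" "v s (y + 2 - s) = v s (y - s)" for y
    proof -
      have "v s (- y - s) = v s ((- (y + 2) - s) + 2)" by (rule arg_cong[of _ _ "v s"]) simp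
      then show "v s (- (y + 2) - s) = v s (- y - s)" by (simp only: v_add_2)
      have "v s (y + 2 - s) = v s ((y - s) + 2)" by (rule arg_cong[of _ _ "v s"]) simp
      then show "v s (y + 2 - s) = v s (y - s)" by (simp only: v_add_2)
    qed
    have R2: "R (y + 2) = R y" for y unfolding R_def U_add_2 c2 v2 ..
    have Rx: "AE x in lborel. x \<in> {0<..<1} \<longrightarrow> R x \<and> R (- x)"
      using e
    proof eventually_elim
      case (elim x)
      show ?case
      proof
        assume x: "x \<in> {0<..<1}"
        then have st: "(s, x) \<in> strip" using s by (simp add: strip_def)
        have cx: "c x = ca (s, x) + cb (s, x)" using x by (simp add: c_def fold_circle_def wrap_id)
        have Gx: "G (s, x) = c x * (v s (- x - s) - v s (x - s))"
          using elim st by (simp add: G_def cx)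
        have "R x" using x Gx by (simp add: R_def U_right)
        moreover have "R (- x)" using x Gx by (simp add: R_def U_left cm algebra_simps)
        ultimately show "R x \<and> R (- x)" ..
      qed
    qed
    have "AE y in circle. R y"
      unfolding circle_def
    proof (subst AE_lborel_in, simp)
      show "AE y in lborel. y \<in> {0..<2} \<longrightarrow> R y"
        using Rx AE_reflect[OF Rx, of 2] AE_lborel_singleton[of 0] AE_lborel_singleton[of 1]
      proof eventually_elim
        case (elim y)
        show ?case
        proof
          assume y: "y \<in> {0..<2}"
          show "R y"
          proof (cases "y < 1")
            case False
            then have "R (- (2 - y))" using y elim(2,4) by auto
            then show ?thesis using R2[of "y - 2"] by simp
          qed (use y elim(1,3) in auto)
        qed
      qed
    qed
    then have "AE y in lborel. R y" by (rule AE_periodic) (rule R2)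
    from AE_translate[OF this, of s]
    show "AE z in lborel. u s z = (ka s z + kb s z) * (v s (- z - 2 * s) - v s z)"
    proof eventually_elim
      case (elim z)
      have "- (s + 1 * z) - s = - z - 2 * s" by simp
      with elim show ?case by (simp add: R_def c_def u_def ka_def kb_def add.commute)
    qed
  qed
  have m: "{x \<in> space (spacetime 0 T). case x of (s, z) \<Rightarrow> u s z = (ka s z + kb s z) * (v s (- z - 2 * s) - v s z)} \<in> sets (spacetime 0 T)"
    by measurable
  show ?thesis
  proof (rule Icc_circle.AE_pair_measure[OF m])
    show "AE s in lborel_in {0..T}. AE z in circle. case (s, z) of (s, z) \<Rightarrow> u s z = (ka s z + kb s z) * (v s (- z - 2 * s) - v s z)"
      unfolding AE_lborel_in[OF borel_closed[OF closed_atLeastAtMost]]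
      using * AE_lborel_singleton[of 0] by eventually_elim (auto intro: AE_circleI)
  qed
qed

theorem exchange_evolution: "exchange_evolution p M \<alpha> v u ka kb"
proof
  show "periodic (ka s)" "periodic (kb s)" for s
    using periodic_shift[OF periodic_fold_circle, of s] by (simp_all add: ka_def kb_def periodic_def)
  have "fold_circle (- z - 2 * s + s) = fold_circle (z + s)" for z s
    using fold_circle_minus[of "z + s"] by (simp add: algebra_simps)
  then show "ka s (- z - 2 * s) = ka s z" "kb s (- z - 2 * s) = kb s z" for s z by (simp_all add: ka_def kb_def)
  show "0 \<le> t \<Longrightarrow> v t z = v 0 z + (LINT s:{0..t}|lborel. u s z)" for t z
    unfolding v_0 by (simp add: v_def)
qed (use p M \<alpha> ca_bounds cb_bound periodic_v u_exchange v_Lp v0_Lp in \<open>auto simp: ka_def kb_def\<close>)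

end

section \<open>Norms of slices\<close>

lemma Linf_norm_bound:
  assumes S: "S \<in> sets borel" and f: "Linf_mem S f"
  shows "AE q in lborel. q \<in> S \<longrightarrow> \<bar>f q\<bar> \<le> Linf_norm S f"
proof -
  define E where "E = esssup (lebesgue_on S) (\<lambda>z. ereal \<bar>f z\<bar>)"
  have "AE q in lebesgue_on S. ereal \<bar>f q\<bar> \<le> E" unfolding E_def by (rule esssup_AE)
  moreover have "\<bar>f q\<bar> \<le> Linf_norm S f" if "ereal \<bar>f q\<bar> \<le> E" for q
    using that f unfolding Linf_norm_def Linf_mem_def E_def[symmetric] by (cases E) auto
  ultimately have "AE q in lebesgue_on S. \<bar>f q\<bar> \<le> Linf_norm S f" by (auto elim: eventually_mono)
  then show ?thesis by (simp add: AE_lebesgue_on_iff[OF S])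
qed

lemma borel_measurable_lebesgue_on_UN:
  fixes f :: "'a::euclidean_space \<Rightarrow> real" and S :: "nat \<Rightarrow> 'a set"
  assumes S: "\<And>n. S n \<in> sets borel" and f: "\<And>n. f \<in> borel_measurable (lebesgue_on (S n))"
  shows "f \<in> borel_measurable (lebesgue_on (\<Union>n. S n))"
proof (rule measurable_piecewise_restrict[of "range S"])
  fix X assume "X \<in> range S"
  then obtain n where X: "X = S n" by auto
  have "restrict_space (lebesgue_on (\<Union>n. S n)) X = lebesgue_on (S n)"
    unfolding X by (subst restrict_restrict_space) (use S in \<open>auto intro!: arg_cong[of _ _ lebesgue_on]\<close>)
  then show "f \<in> borel_measurable (restrict_space (lebesgue_on (\<Union>n. S n)) X)" using f by simp
  show "X \<inter> space (lebesgue_on (\<Union>n. S n)) \<in> sets (lebesgue_on (\<Union>n. S n))"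
    using S unfolding X by (auto simp: sets_restrict_space intro!: image_eqI[of _ _ "S n"])
qed auto

definition Lp_mass :: "real \<Rightarrow> real set \<Rightarrow> (real \<Rightarrow> real) \<Rightarrow> (real \<Rightarrow> real) \<Rightarrow> real" where
  "Lp_mass p S f g = (LINT x|lebesgue_on S. \<bar>f x\<bar> powr p + \<bar>g x\<bar> powr p)"

lemma Lp_mass_nonneg: "0 \<le> Lp_mass p S f g"
  by (simp add: Lp_mass_def)

lemma Lp_norm2_eq: "Lp_norm2 p S f g = Lp_mass p S f g powr (1 / p)"
  by (simp add: Lp_norm2_def Lp_mass_def)

lemma Lp_mass_eq: "0 < p \<Longrightarrow> Lp_mass p S f g = Lp_norm2 p S f g powr p"
  by (simp add: Lp_norm2_eq powr_powr Lp_mass_nonneg)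

lemma Lp_mem_diff:
  assumes p: "0 < p" and f: "Lp_mem p S f" and g: "Lp_mem p S g"
  shows "Lp_mem p S (\<lambda>x. f x - g x)"
  unfolding Lp_mem_def
proof
  have m [measurable]: "f \<in> borel_measurable (lebesgue_on S)" "g \<in> borel_measurable (lebesgue_on S)"
    using f g by (auto simp: Lp_mem_def)
  show "(\<lambda>x. f x - g x) \<in> borel_measurable (lebesgue_on S)" by measurable
  show "integrable (lebesgue_on S) (\<lambda>x. \<bar>f x - g x\<bar> powr p)"
  proof (rule Bochner_Integration.integrable_bound)
    show "integrable (lebesgue_on S) (\<lambda>x. 2 powr p * (\<bar>f x\<bar> powr p + \<bar>g x\<bar> powr p))"
      using f g by (auto simp: Lp_mem_def)
    show "AE x in lebesgue_on S. norm (\<bar>f x - g x\<bar> powr p) \<le> norm (2 powr p * (\<bar>f x\<bar> powr p + \<bar>g x\<bar> powr p))"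
      using abs_add_powr_le[OF p, of "f x" "- g x" for x] by (intro AE_I2) (simp add: abs_of_nonneg)
  qed measurable
qed

text \<open>
  A triangle inequality up to the factor \<open>2\<^sup>p\<close>, which takes the place of
  Minkowski's inequality.
\<close>

lemma Lp_mass_le_diff:
  assumes p: "0 < p" and "Lp_mem p S f" "Lp_mem p S f'" "Lp_mem p S g" "Lp_mem p S g'"
  shows "Lp_mass p S f' g' \<le> 2 powr p * (Lp_mass p S (\<lambda>x. f x - f' x) (\<lambda>x. g x - g' x) + Lp_mass p S f g)"
proof -
  note d = Lp_mem_diff[OF p assms(2,3)] Lp_mem_diff[OF p assms(4,5)]
  have e: "\<bar>y'\<bar> powr p \<le> 2 powr p * (\<bar>y - y'\<bar> powr p + \<bar>y\<bar> powr p)" for y y' :: real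
    using abs_add_powr_le[OF p, of "- (y - y')" y] by (simp add: abs_minus_commute)
  have "Lp_mass p S f' g' \<le> (LINT x|lebesgue_on S. 2 powr p * ((\<bar>f x - f' x\<bar> powr p + \<bar>g x - g' x\<bar> powr p) + (\<bar>f x\<bar> powr p + \<bar>g x\<bar> powr p)))"
    unfolding Lp_mass_def
  proof (rule integral_mono)
    fix x
    show "\<bar>f' x\<bar> powr p + \<bar>g' x\<bar> powr p \<le> 2 powr p * ((\<bar>f x - f' x\<bar> powr p + \<bar>g x - g' x\<bar> powr p) + (\<bar>f x\<bar> powr p + \<bar>g x\<bar> powr p))"
      using add_mono[OF e[of "f' x" "f x"] e[of "g' x" "g x"]] by (simp add: algebra_simps)
  qed (use assms d in \<open>auto simp: Lp_mem_def\<close>)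
  also have "\<dots> = 2 powr p * (Lp_mass p S (\<lambda>x. f x - f' x) (\<lambda>x. g x - g' x) + Lp_mass p S f g)"
    using assms d by (simp add: Lp_mass_def Lp_mem_def)
  finally show ?thesis .
qed

lemma integral_abs_le_Lp_norm2:
  assumes p: "1 < p" and T: "0 < T" and f: "Lp_mem p {0<..<T} f" and g: "Lp_mem p {0<..<T} g"
  shows "integrable (lebesgue_on {0<..<T}) f"
    and "(LINT t|lebesgue_on {0<..<T}. \<bar>f t\<bar>) \<le> T powr ((p - 1) / p) * Lp_norm2 p {0<..<T} f g"
proof -
  have fin: "finite_measure (lebesgue_on {0<..<T})"
    by (rule finite_measureI) (use T in \<open>simp add: emeasure_restrict_space\<close>)
  interpret finite_measure "lebesgue_on {0<..<T}" by (rule fin)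
  have m: "measure (lebesgue_on {0<..<T}) (space (lebesgue_on {0<..<T})) = T"
    using T by (simp add: measure_restrict_space)
  show "integrable (lebesgue_on {0<..<T}) f"
    by (rule integrable_of_abs_powr[of p]) (use p f in \<open>auto simp: Lp_mem_def\<close>)
  have [measurable]: "f \<in> borel_measurable (lebesgue_on {0<..<T})" using f by (simp add: Lp_mem_def)
  have am: "(\<lambda>t. \<bar>f t\<bar>) \<in> borel_measurable (lebesgue_on {0<..<T})" by measurable
  have "\<bar>LINT t|lebesgue_on {0<..<T}. \<bar>f t\<bar>\<bar> powr p \<le> T powr (p - 1) * (LINT t|lebesgue_on {0<..<T}. \<bar>\<bar>f t\<bar>\<bar> powr p)"
    using abs_integral_powr_le[OF p am] f unfolding m by (simp add: Lp_mem_def)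
  also have "\<dots> \<le> T powr (p - 1) * Lp_mass p {0<..<T} f g"
    unfolding Lp_mass_def using f g by (intro mult_left_mono integral_mono) (auto simp: Lp_mem_def)
  finally have "(\<bar>LINT t|lebesgue_on {0<..<T}. \<bar>f t\<bar>\<bar> powr p) powr (1 / p) \<le> (T powr (p - 1) * Lp_mass p {0<..<T} f g) powr (1 / p)"
    using p by (intro powr_mono2) auto
  then show "(LINT t|lebesgue_on {0<..<T}. \<bar>f t\<bar>) \<le> T powr ((p - 1) / p) * Lp_norm2 p {0<..<T} f g"
    using p by (simp add: powr_powr powr_mult Lp_mass_nonneg Lp_norm2_eq)
qed

lemma exponential_from_contraction:
  fixes \<delta> :: real
  assumes "0 < \<delta>" "\<delta> < 1"
  obtains K \<kappa> where "0 < K" "0 < \<kappa>"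
    "\<And>E t. (\<And>t. 0 \<le> E t) \<Longrightarrow> (\<And>a. 0 \<le> a \<Longrightarrow> E (a + 2) \<le> (1 - \<delta>) * E a) \<Longrightarrow>
       (\<And>a t. 0 \<le> a \<Longrightarrow> t \<in> {a..a + 2} \<Longrightarrow> E t \<le> 2 * E a) \<Longrightarrow> 0 \<le> t \<Longrightarrow> E t \<le> K * exp (- \<kappa> * t) * (E 0 :: real)"
proof
  define q where "q = 1 - \<delta>"
  have q: "0 < q" "q < 1" using assms by (auto simp: q_def)
  define \<kappa> where "\<kappa> = - ln q / 2"
  show "0 < 2 / q" using q by simp
  show "0 < \<kappa>" using q by (simp add: \<kappa>_def)
  fix E :: "real \<Rightarrow> real" and t :: real
  assume E0: "\<And>t. 0 \<le> E t" and step: "\<And>a. 0 \<le> a \<Longrightarrow> E (a + 2) \<le> (1 - \<delta>) * E a"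
    and grow: "\<And>a t. 0 \<le> a \<Longrightarrow> t \<in> {a..a + 2} \<Longrightarrow> E t \<le> 2 * E a" and t: "0 \<le> t"
  have pow: "E (2 * real n) \<le> q ^ n * E 0" for n
  proof (induction n)
    case (Suc n)
    have "E (2 * real (Suc n)) = E (2 * real n + 2)" by (rule arg_cong[of _ _ E]) simp
    also have "\<dots> \<le> q * E (2 * real n)" unfolding q_def by (rule step) simp
    also have "\<dots> \<le> q * (q ^ n * E 0)" using Suc q by (intro mult_left_mono) auto
    finally show ?case by simp
  qed simp
  define n where "n = nat \<lfloor>t / 2\<rfloor>"
  have "real n = of_int \<lfloor>t / 2\<rfloor>" using t by (simp add: n_def)
  then have n: "real n \<le> t / 2" "t / 2 < real n + 1" by linarith+
  have "E t \<le> 2 * E (2 * real n)" by (rule grow) (use n in auto)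
  also have "\<dots> \<le> 2 * (q ^ n * E 0)" using pow by simp
  also have "q ^ n = q powr real n" using q by (simp add: powr_realpow)
  also have "2 * (q powr real n * E 0) \<le> 2 * (q powr (t / 2 - 1) * E 0)"
    using n q E0 by (intro mult_left_mono mult_right_mono powr_mono') auto
  also have "q powr (t / 2 - 1) = q powr (t / 2) / q powr 1" by (rule powr_diff)
  also have "q powr (t / 2) = exp (- \<kappa> * t)"
    using q by (simp add: powr_def \<kappa>_def mult.commute)
  finally show "E t \<le> 2 / q * exp (- \<kappa> * t) * E 0" using q by simp
qed

section \<open>Broad solutions\<close>

text \<open>
  Continuity in time bounds the mass near each time, and compactness of the interval gives a
  common bound.
\<close>

lemma Lp_mass_locally_bounded:
  assumes p: "1 < p" and T: "0 < T" and sp: "broad_space p T \<rho> \<xi>"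
  obtains B where "\<And>t. t \<in> {0..T} \<Longrightarrow> Lp_mass p {0<..<1} (\<lambda>x. \<rho> (t, x)) (\<lambda>x. \<xi> (t, x)) \<le> B"
proof -
  define N where "N t = Lp_mass p {0<..<1} (\<lambda>x. \<rho> (t, x)) (\<lambda>x. \<xi> (t, x))" for t
  define bdd where "bdd c d \<longleftrightarrow> (\<exists>B. \<forall>t\<in>{c..d} \<inter> {0..T}. N t \<le> B)" for c d
  have mem: "Lp_mem p {0<..<1} (\<lambda>x. \<rho> (t, x))" "Lp_mem p {0<..<1} (\<lambda>x. \<xi> (t, x))" if "t \<in> {0..T}" for t
    using sp that by (auto simp: broad_space_def)
  have "bdd 0 T"
  proof (rule Bolzano)
    show "bdd a b \<Longrightarrow> bdd b c \<Longrightarrow> a \<le> b \<Longrightarrow> b \<le> c \<Longrightarrow> bdd a c" for a b c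
    proof -
      assume "bdd a b" "bdd b c"
      then obtain B1 B2 where "\<forall>t\<in>{a..b} \<inter> {0..T}. N t \<le> B1" "\<forall>t\<in>{b..c} \<inter> {0..T}. N t \<le> B2" by (auto simp: bdd_def)
      then have "N t \<le> max B1 B2" if "t \<in> {a..c} \<inter> {0..T}" for t
        using that by (cases "t \<le> b") (auto simp: le_max_iff_disj)
      then show "bdd a c" unfolding bdd_def by blast
    qed
    fix t assume t: "0 \<le> t" "t \<le> T"
    define Q where "Q s = Lp_norm2 p {0<..<1} (\<lambda>x. \<rho> (s, x) - \<rho> (t, x)) (\<lambda>x. \<xi> (s, x) - \<xi> (t, x))" for s
    have "(Q \<longlongrightarrow> 0) (at t within {0..T})" using sp t by (simp add: broad_space_def Q_def[abs_def])
    then have "\<forall>\<^sub>F s in at t within {0..T}. Q s < 1" by (rule order_tendstoD) simp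
    then obtain d where d: "0 < d" "\<And>s. s \<in> {0..T} \<Longrightarrow> s \<noteq> t \<Longrightarrow> dist s t < d \<Longrightarrow> Q s < 1"
      by (auto simp: eventually_at)
    have "N s \<le> max (N t) (2 powr p * (1 + N t))" if s: "s \<in> {0..T}" "\<bar>s - t\<bar> < d" for s
    proof (cases "s = t")
      case False
      then have "Q s < 1" using d(2) s by (simp add: dist_real_def)
      have "N s \<le> 2 powr p * (Lp_mass p {0<..<1} (\<lambda>x. \<rho> (t, x) - \<rho> (s, x)) (\<lambda>x. \<xi> (t, x) - \<xi> (s, x)) + N t)"
        unfolding N_def using p s t mem[of s] mem[of t] by (intro Lp_mass_le_diff) auto
      also have "Lp_mass p {0<..<1} (\<lambda>x. \<rho> (t, x) - \<rho> (s, x)) (\<lambda>x. \<xi> (t, x) - \<xi> (s, x)) = Q s powr p"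
        unfolding Q_def using p by (subst Lp_mass_eq[symmetric]) (auto simp: Lp_mass_def abs_minus_commute)
      also have "\<dots> \<le> 1 powr p"
        using \<open>Q s < 1\<close> p by (intro powr_mono2) (auto simp: Q_def Lp_norm2_eq)
      finally show ?thesis by (simp add: le_max_iff_disj)
    qed simp
    then show "\<exists>d>0. \<forall>a b. a \<le> t \<and> t \<le> b \<and> b - a < d \<longrightarrow> bdd a b"
      using d(1) by (intro exI[of _ d]) (auto simp: bdd_def intro!: exI[of _ "max (N t) (2 powr p * (1 + N t))"])
  qed (use T in simp)
  then obtain B where "\<forall>t\<in>{0..T} \<inter> {0..T}. N t \<le> B" unfolding bdd_def by blast
  then show thesis by (intro that[of B]) (simp add: N_def)
qed

lemma Lp_mem_borel_version:
  assumes p: "0 < p" and S: "S \<in> sets borel" and f: "Lp_mem p S f"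
    and [measurable]: "f' \<in> borel_measurable borel" and eq: "AE x in lborel. x \<in> S \<longrightarrow> f x = f' x"
  shows "set_integrable lborel S (\<lambda>x. \<bar>f' x\<bar> powr p)"
proof -
  have "AE x in lborel. x \<in> S \<longrightarrow> \<bar>f x\<bar> powr p = \<bar>f' x\<bar> powr p" using eq by eventually_elim auto
  from lebesgue_on_integrable_borel[OF S _ this] f show ?thesis by (simp add: Lp_mem_def)
qed

lemma Lp_mass_borel_version:
  assumes S: "S \<in> sets borel" and f: "Lp_mem p S f" and g: "Lp_mem p S g"
    and [measurable]: "f' \<in> borel_measurable borel" "g' \<in> borel_measurable borel"
    and eq: "AE x in lborel. x \<in> S \<longrightarrow> f x = f' x" "AE x in lborel. x \<in> S \<longrightarrow> g x = g' x"
  shows "(\<integral>\<^sup>+x. ennreal (\<bar>g' x\<bar> powr p + \<bar>f' x\<bar> powr p) * indicator S x \<partial>lborel) = ennreal (Lp_mass p S f g)"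
    and "(LINT x:S|lborel. \<bar>g' x\<bar> powr p + \<bar>f' x\<bar> powr p) = Lp_mass p S f g"
proof -
  have e: "AE x in lborel. x \<in> S \<longrightarrow> \<bar>f x\<bar> powr p + \<bar>g x\<bar> powr p = \<bar>g' x\<bar> powr p + \<bar>f' x\<bar> powr p"
    using eq by eventually_elim auto
  have i: "set_integrable lborel S (\<lambda>x. \<bar>g' x\<bar> powr p + \<bar>f' x\<bar> powr p)"
    using lebesgue_on_integrable_borel[OF S _ e] f g by (simp add: Lp_mem_def)
  show l: "(LINT x:S|lborel. \<bar>g' x\<bar> powr p + \<bar>f' x\<bar> powr p) = Lp_mass p S f g"
    unfolding Lp_mass_def using lebesgue_on_integral_borel[OF S _ e] by simp
  have "(\<integral>\<^sup>+x. ennreal (\<bar>g' x\<bar> powr p + \<bar>f' x\<bar> powr p) * indicator S x \<partial>lborel)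
      = (\<integral>\<^sup>+x. ennreal (indicator S x *\<^sub>R (\<bar>g' x\<bar> powr p + \<bar>f' x\<bar> powr p)) \<partial>lborel)"
    by (intro nn_integral_cong) (auto simp: indicator_def)
  also have "\<dots> = ennreal (LINT x:S|lborel. \<bar>g' x\<bar> powr p + \<bar>f' x\<bar> powr p)"
    unfolding set_lebesgue_integral_def using i by (intro nn_integral_eq_integral) (auto simp: set_integrable_def)
  finally show "(\<integral>\<^sup>+x. ennreal (\<bar>g' x\<bar> powr p + \<bar>f' x\<bar> powr p) * indicator S x \<partial>lborel) = ennreal (Lp_mass p S f g)"
    by (simp add: l)
qed

lemma trace_continuous_L1:
  assumes p: "1 < p" and T: "0 < T" and sp: "broad_space p T \<rho> \<xi>" and x: "x \<in> {0..1}"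
  shows "((\<lambda>y. LINT t|lebesgue_on {0<..<T}. \<bar>\<rho> (t, y) - \<rho> (t, x)\<bar>) \<longlongrightarrow> 0) (at x within {0..1})"
    and "((\<lambda>y. LINT t|lebesgue_on {0<..<T}. \<bar>\<xi> (t, y) - \<xi> (t, x)\<bar>) \<longlongrightarrow> 0) (at x within {0..1})"
proof -
  define c where "c = T powr ((p - 1) / p)"
  define Q where "Q y = Lp_norm2 p {0<..<T} (\<lambda>t. \<rho> (t, y) - \<rho> (t, x)) (\<lambda>t. \<xi> (t, y) - \<xi> (t, x))" for y
  have mem: "Lp_mem p {0<..<T} (\<lambda>t. \<rho> (t, y))" "Lp_mem p {0<..<T} (\<lambda>t. \<xi> (t, y))" if "y \<in> {0..1}" for y
    using sp that by (auto simp: broad_space_def)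
  have memd: "Lp_mem p {0<..<T} (\<lambda>t. \<rho> (t, y) - \<rho> (t, x))" "Lp_mem p {0<..<T} (\<lambda>t. \<xi> (t, y) - \<xi> (t, x))" if "y \<in> {0..1}" for y
    using p mem[OF that] mem[OF x] by (auto intro: Lp_mem_diff)
  have "(Q \<longlongrightarrow> 0) (at x within {0..1})" using sp x by (simp add: broad_space_def Q_def[abs_def])
  then have Q: "((\<lambda>y. c * Q y) \<longlongrightarrow> 0) (at x within {0..1})" by (rule tendsto_mult_right_zero)
  have ev: "\<forall>\<^sub>F y in at x within {0..1}. y \<in> {0..1}" by (simp add: eventually_at_filter)
  show "((\<lambda>y. LINT t|lebesgue_on {0<..<T}. \<bar>\<rho> (t, y) - \<rho> (t, x)\<bar>) \<longlongrightarrow> 0) (at x within {0..1})"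
  proof (rule tendsto_sandwich[OF _ _ tendsto_const Q])
    show "\<forall>\<^sub>F y in at x within {0..1}. (LINT t|lebesgue_on {0<..<T}. \<bar>\<rho> (t, y) - \<rho> (t, x)\<bar>) \<le> c * Q y"
      using ev by eventually_elim (use integral_abs_le_Lp_norm2(2)[OF p T memd] in \<open>auto simp: c_def Q_def\<close>)
  qed simp
  have sw: "Lp_norm2 p {0<..<T} f g = Lp_norm2 p {0<..<T} g f" for f g by (simp add: Lp_norm2_def add.commute)
  show "((\<lambda>y. LINT t|lebesgue_on {0<..<T}. \<bar>\<xi> (t, y) - \<xi> (t, x)\<bar>) \<longlongrightarrow> 0) (at x within {0..1})"
  proof (rule tendsto_sandwich[OF _ _ tendsto_const Q])
    show "\<forall>\<^sub>F y in at x within {0..1}. (LINT t|lebesgue_on {0<..<T}. \<bar>\<xi> (t, y) - \<xi> (t, x)\<bar>) \<le> c * Q y"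
      using ev by eventually_elim (use integral_abs_le_Lp_norm2(2)[OF p T memd(2) memd(1)] sw in \<open>auto simp: c_def Q_def\<close>)
  qed simp
qed

text \<open>
  The Borel versions of \<open>\<xi>\<close> and of the mirrored \<open>\<rho>\<close> are
  instances of \<open>transport\<close>, with the roles of the two traces interchanged, and their
  conclusions are the rules of \<open>unfolded_solution\<close>. The energy is the mass of the
  time slice at those times at which the slices of the Borel versions agree almost everywhere with
  those of \<open>\<rho>\<close> and \<open>\<xi>\<close>.
\<close>

lemma broad_solution_unfolds:
  fixes a b \<rho> \<xi> :: "real \<times> real \<Rightarrow> real" and \<rho>\<^sub>0 \<xi>\<^sub>0 :: "real \<Rightarrow> real"
  assumes p: "1 < p" and a: "Linf_mem strip a" and b: "Linf_mem strip b"
    and M: "0 \<le> M" "Linf_norm strip a / 2 \<le> M" and \<alpha>: "0 \<le> \<alpha>" "Linf_norm strip b \<le> \<alpha>"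
    and a_nonneg: "AE z in lebesgue_on strip. 0 \<le> a z"
    and W: "W \<in> sets borel" "W \<subseteq> {0<..<1}" and a_window: "AE z in lebesgue_on ({0<..} \<times> W). 2 * \<mu> \<le> a z"
    and init: "Lp_mem p {0<..<1} \<rho>\<^sub>0" "Lp_mem p {0<..<1} \<xi>\<^sub>0" and mean: "(LINT x|lebesgue_on {0<..<1}. \<rho>\<^sub>0 x + \<xi>\<^sub>0 x) = 0"
    and sol: "broad_solution p a b \<rho>\<^sub>0 \<xi>\<^sub>0 \<rho> \<xi>"
  obtains v u ka kb where "exchange_evolution p M \<alpha> v u ka kb"
    "\<forall>c\<ge>0. AE (s, z) in spacetime c (c + 2). wrap (z + s) \<in> W \<longrightarrow> \<mu> \<le> ka s z"
    "(\<integral>z. v 0 z \<partial>circle) = 0"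
    "exchange_evolution.energy p v 0 = Lp_mass p {0<..<1} \<rho>\<^sub>0 \<xi>\<^sub>0"
    "AE t in lborel. 0 < t \<longrightarrow> exchange_evolution.energy p v t = Lp_mass p {0<..<1} (\<lambda>x. \<rho> (t, x)) (\<lambda>x. \<xi> (t, x))"
proof -
  have p0: "0 < p" using p by simp
  define R where "R n = {0<..<real (Suc n)} \<times> {0<..<1 :: real}" for n
  have Rb: "R n \<in> sets borel" for n by (simp add: R_def flip: borel_prod)
  have half: "{0 :: real<..} = (\<Union>n. {0<..<real (Suc n)})"
  proof safe
    fix t :: real assume "0 < t"
    obtain n where "t < real n" using reals_Archimedean2 by blast
    then have "t \<in> {0<..<real (Suc n)}" using \<open>0 < t\<close> by auto
    then show "t \<in> (\<Union>n. {0<..<real (Suc n)})" by blast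
  qed simp
  have stripR: "strip = (\<Union>n. R n)" unfolding strip_def half R_def by auto
  have sp: "broad_space p T \<rho> \<xi>" if "0 < T" for T
    using sol that by (auto simp: broad_solution_def broad_solution_on_def)
  have ms: "\<rho> \<in> borel_measurable (lebesgue_on strip)" "\<xi> \<in> borel_measurable (lebesgue_on strip)"
    unfolding stripR
    by (rule borel_measurable_lebesgue_on_UN[OF Rb], use sp in \<open>simp add: broad_space_def R_def\<close>)+
  obtain \<rho>1 where \<rho>1 [measurable]: "\<rho>1 \<in> borel_measurable borel" and \<rho>1_eq: "AE q in lborel. q \<in> strip \<longrightarrow> \<rho> q = \<rho>1 q"
    using lebesgue_on_ex_borel[OF strip_borel ms(1)] by blast
  obtain \<xi>1 where \<xi>1 [measurable]: "\<xi>1 \<in> borel_measurable borel" and \<xi>1_eq: "AE q in lborel. q \<in> strip \<longrightarrow> \<xi> q = \<xi>1 q"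
    using lebesgue_on_ex_borel[OF strip_borel ms(2)] by blast
  have mt: "(\<lambda>t. \<xi> (t, 0)) \<in> borel_measurable (lebesgue_on {0<..})" "(\<lambda>t. \<rho> (t, 1)) \<in> borel_measurable (lebesgue_on {0<..})"
    unfolding half by (rule borel_measurable_lebesgue_on_UN, simp, use sp in \<open>simp add: broad_space_def Lp_mem_def\<close>)+
  have half_borel: "{0 :: real<..} \<in> sets borel" by simp
  obtain \<beta>0 where \<beta>0 [measurable]: "\<beta>0 \<in> borel_measurable borel" and \<beta>0_eq: "AE t in lborel. t \<in> {0<..} \<longrightarrow> \<xi> (t, 0) = \<beta>0 t"
    using lebesgue_on_ex_borel[OF half_borel mt(1)] by blast
  obtain \<beta>1 where \<beta>1 [measurable]: "\<beta>1 \<in> borel_measurable borel" and \<beta>1_eq: "AE t in lborel. t \<in> {0<..} \<longrightarrow> \<rho> (t, 1) = \<beta>1 t"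
    using lebesgue_on_ex_borel[OF half_borel mt(2)] by blast
  have I01: "{0<..<1 :: real} \<in> sets borel" by simp
  have mi: "\<rho>\<^sub>0 \<in> borel_measurable (lebesgue_on {0<..<1})" "\<xi>\<^sub>0 \<in> borel_measurable (lebesgue_on {0<..<1})"
      "a \<in> borel_measurable (lebesgue_on strip)" "b \<in> borel_measurable (lebesgue_on strip)"
    using init a b by (simp_all add: Lp_mem_def Linf_mem_def)
  obtain \<rho>0 where \<rho>0 [measurable]: "\<rho>0 \<in> borel_measurable borel" and \<rho>0_eq: "AE x in lborel. x \<in> {0<..<1} \<longrightarrow> \<rho>\<^sub>0 x = \<rho>0 x"
    using lebesgue_on_ex_borel[OF I01 mi(1)] by blast
  obtain \<xi>0 where \<xi>0 [measurable]: "\<xi>0 \<in> borel_measurable borel" and \<xi>0_eq: "AE x in lborel. x \<in> {0<..<1} \<longrightarrow> \<xi>\<^sub>0 x = \<xi>0 x"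
    using lebesgue_on_ex_borel[OF I01 mi(2)] by blast
  obtain a1 where a1 [measurable]: "a1 \<in> borel_measurable borel" and a1_eq: "AE q in lborel. q \<in> strip \<longrightarrow> a q = a1 q"
    using lebesgue_on_ex_borel[OF strip_borel mi(3)] by blast
  obtain b1 where b1 [measurable]: "b1 \<in> borel_measurable borel" and b1_eq: "AE q in lborel. q \<in> strip \<longrightarrow> b q = b1 q"
    using lebesgue_on_ex_borel[OF strip_borel mi(4)] by blast
  (* truncated, so that the bounds hold everywhere; almost everywhere in the strip nothing changes *)
  define ca where "ca q = max 0 (min M (a1 q / 2))" for q
  define cb where "cb q = max (- \<alpha>) (min \<alpha> (b1 q))" for q
  have [measurable]: "ca \<in> borel_measurable borel" "cb \<in> borel_measurable borel"
    unfolding ca_def[abs_def] cb_def[abs_def] by measurable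
  have ca_eq: "AE q in lborel. q \<in> strip \<longrightarrow> a q / 2 = ca q"
    using Linf_norm_bound[OF strip_borel a] a_nonneg[unfolded AE_lebesgue_on_iff[OF strip_borel]] a1_eq
    by eventually_elim (use M in \<open>auto simp: ca_def\<close>)
  have cb_eq: "AE q in lborel. q \<in> strip \<longrightarrow> b q = cb q"
    using Linf_norm_bound[OF strip_borel b] b1_eq by eventually_elim (use \<alpha> in \<open>auto simp: cb_def\<close>)
  have slices: "AE t in lborel. 0 < t \<longrightarrow> (AE x in lborel. x \<in> {0<..<1} \<longrightarrow> \<rho> (t, x) = \<rho>1 (t, x)) \<and> (AE x in lborel. x \<in> {0<..<1} \<longrightarrow> \<xi> (t, x) = \<xi>1 (t, x))"
    using AE_planeD[OF \<rho>1_eq] AE_planeD[OF \<xi>1_eq]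
  proof (eventually_elim, intro impI conjI)
    fix t :: real assume t: "0 < t" and "AE x in lborel. (t, x) \<in> strip \<longrightarrow> \<rho> (t, x) = \<rho>1 (t, x)"
    then show "AE x in lborel. x \<in> {0<..<1} \<longrightarrow> \<rho> (t, x) = \<rho>1 (t, x)" by (auto elim!: eventually_mono simp: strip_def)
  next
    fix t :: real assume t: "0 < t" and "AE x in lborel. (t, x) \<in> strip \<longrightarrow> \<xi> (t, x) = \<xi>1 (t, x)"
    then show "AE x in lborel. x \<in> {0<..<1} \<longrightarrow> \<xi> (t, x) = \<xi>1 (t, x)" by (auto elim!: eventually_mono simp: strip_def)
  qed
  have mass: "AE t in lborel. 0 < t \<longrightarrow> (\<integral>\<^sup>+x. ennreal (\<bar>\<xi>1 (t, x)\<bar> powr p + \<bar>\<rho>1 (t, x)\<bar> powr p) * indicator {0<..<1} x \<partial>lborel)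
      = ennreal (Lp_mass p {0<..<1} (\<lambda>x. \<rho> (t, x)) (\<lambda>x. \<xi> (t, x)))"
    using slices
  proof (eventually_elim, intro impI)
    fix t :: real assume t: "0 < t" and e: "0 < t \<longrightarrow> (AE x in lborel. x \<in> {0<..<1} \<longrightarrow> \<rho> (t, x) = \<rho>1 (t, x)) \<and> (AE x in lborel. x \<in> {0<..<1} \<longrightarrow> \<xi> (t, x) = \<xi>1 (t, x))"
    have m: "Lp_mem p {0<..<1} (\<lambda>x. \<rho> (t, x))" "Lp_mem p {0<..<1} (\<lambda>x. \<xi> (t, x))" using sp[OF t] t by (auto simp: broad_space_def)
    show "(\<integral>\<^sup>+x. ennreal (\<bar>\<xi>1 (t, x)\<bar> powr p + \<bar>\<rho>1 (t, x)\<bar> powr p) * indicator {0<..<1} x \<partial>lborel)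
      = ennreal (Lp_mass p {0<..<1} (\<lambda>x. \<rho> (t, x)) (\<lambda>x. \<xi> (t, x)))"
      by (rule Lp_mass_borel_version(1)[OF I01 m]) (use e t in auto)
  qed
  have Lp: "set_integrable lborel ({0<..<T} \<times> {0<..<1}) (\<lambda>q. \<bar>\<xi>1 q\<bar> powr p + \<bar>\<rho>1 q\<bar> powr p)" if T: "0 < T" for T
    unfolding set_integrable_def
  proof (rule integrableI_bounded)
    obtain B where B: "\<And>t. t \<in> {0..T} \<Longrightarrow> Lp_mass p {0<..<1} (\<lambda>x. \<rho> (t, x)) (\<lambda>x. \<xi> (t, x)) \<le> B"
      using Lp_mass_locally_bounded[OF p T sp[OF T]] by blast
    have Rb': "({0<..<T} \<times> {0<..<1} :: (real \<times> real) set) \<in> sets borel" by (simp flip: borel_prod)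
    then show "(\<lambda>q. indicator ({0<..<T} \<times> {0<..<1}) q *\<^sub>R (\<bar>\<xi>1 q\<bar> powr p + \<bar>\<rho>1 q\<bar> powr p)) \<in> borel_measurable lborel" by measurable
    have "(\<integral>\<^sup>+q. ennreal (norm (indicator ({0<..<T} \<times> {0<..<1}) q *\<^sub>R (\<bar>\<xi>1 q\<bar> powr p + \<bar>\<rho>1 q\<bar> powr p))) \<partial>(lborel \<Otimes>\<^sub>M lborel))
      = (\<integral>\<^sup>+(t, x). ennreal (\<bar>\<xi>1 (t, x)\<bar> powr p + \<bar>\<rho>1 (t, x)\<bar> powr p) * indicator {0<..<1} x * indicator {0<..<T} t \<partial>(lborel \<Otimes>\<^sub>M lborel))"
      by (intro nn_integral_cong) (auto simp: indicator_def)
    also have "\<dots> = (\<integral>\<^sup>+t. \<integral>\<^sup>+x. ennreal (\<bar>\<xi>1 (t, x)\<bar> powr p + \<bar>\<rho>1 (t, x)\<bar> powr p) * indicator {0<..<1} x * indicator {0<..<T} t \<partial>lborel \<partial>lborel)"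
      by (subst lborel.nn_integral_fst[symmetric]) auto
    also have "\<dots> = (\<integral>\<^sup>+t. (\<integral>\<^sup>+x. ennreal (\<bar>\<xi>1 (t, x)\<bar> powr p + \<bar>\<rho>1 (t, x)\<bar> powr p) * indicator {0<..<1} x \<partial>lborel) * indicator {0<..<T} t \<partial>lborel)"
      by (intro nn_integral_cong nn_integral_multc) measurable
    also have "\<dots> \<le> (\<integral>\<^sup>+t. ennreal B * indicator {0<..<T} t \<partial>lborel)"
      by (rule nn_integral_mono_AE, use mass in eventually_elim) (use B in \<open>auto simp: indicator_def intro!: ennreal_leI\<close>)
    also have "\<dots> < \<infinity>" using T by (simp add: nn_integral_cmult ennreal_mult_less_top)
    finally show "(\<integral>\<^sup>+q. ennreal (norm (indicator ({0<..<T} \<times> {0<..<1}) q *\<^sub>R (\<bar>\<xi>1 q\<bar> powr p + \<bar>\<rho>1 q\<bar> powr p))) \<partial>lborel) < \<infinity>"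
      by (simp only: lborel_prod)
  qed
  interpret S: unfolded_system p M \<alpha> ca cb \<rho>1 \<xi>1 \<rho>0 \<xi>0 \<beta>0 \<beta>1
  proof
    show "set_integrable lborel {0<..<1} (\<lambda>x. \<bar>\<rho>0 x\<bar> powr p)" by (rule Lp_mem_borel_version[OF p0 I01 init(1) \<rho>0 \<rho>0_eq])
    show "set_integrable lborel {0<..<1} (\<lambda>x. \<bar>\<xi>0 x\<bar> powr p)" by (rule Lp_mem_borel_version[OF p0 I01 init(2) \<xi>0 \<xi>0_eq])
  qed (use p M \<alpha> Lp in \<open>auto simp: ca_def cb_def\<close>)
  define H where "H q = ((1 / 2) * a q + b q) * (\<rho> q - \<xi> q)" for q
  have H_eq: "AE q in lborel. q \<in> strip \<longrightarrow> H q = S.G q"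
    using ca_eq cb_eq \<rho>1_eq \<xi>1_eq by eventually_elim (auto simp: H_def S.G_def)
  have bc: "AE t in lborel. 0 < t \<longrightarrow> \<rho> (t, 0) = \<xi> (t, 0) \<and> \<rho> (t, 1) = \<xi> (t, 1)"
  proof -
    have "AE t in lborel. \<forall>n. t \<in> {0<..<real (Suc n)} \<longrightarrow> \<rho> (t, 0) = \<xi> (t, 0) \<and> \<rho> (t, 1) = \<xi> (t, 1)"
      unfolding AE_all_countable
    proof
      fix n
      have I: "{0<..<real (Suc n)} \<in> sets borel" by simp
      have "broad_solution_on p (real (Suc n)) a b \<rho>\<^sub>0 \<xi>\<^sub>0 \<rho> \<xi>" using sol unfolding broad_solution_def by simp
      then have "AE t in lebesgue_on {0<..<real (Suc n)}. \<rho> (t, 0) = \<xi> (t, 0) \<and> \<rho> (t, 1) = \<xi> (t, 1)"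
        unfolding broad_solution_on_def by blast
      then show "AE t in lborel. t \<in> {0<..<real (Suc n)} \<longrightarrow> \<rho> (t, 0) = \<xi> (t, 0) \<and> \<rho> (t, 1) = \<xi> (t, 1)"
        unfolding AE_lebesgue_on_iff[OF I] .
    qed
    then show ?thesis
    proof eventually_elim
      fix t assume "\<forall>n. t \<in> {0<..<real (Suc n)} \<longrightarrow> \<rho> (t, 0) = \<xi> (t, 0) \<and> \<rho> (t, 1) = \<xi> (t, 1)"
      then show "0 < t \<longrightarrow> \<rho> (t, 0) = \<xi> (t, 0) \<and> \<rho> (t, 1) = \<xi> (t, 1)"
        using half by (metis UN_E greaterThan_iff)
    qed
  qed
  define rule_\<rho> where "rule_\<rho> t x \<longleftrightarrow>
     (x + t < 1 \<longrightarrow> \<rho> (t, x) = \<rho>\<^sub>0 (x + t) + (LINT s|lebesgue_on {0..t}. - H (s, x + t - s))) \<and>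
     (x + t > 1 \<longrightarrow> \<rho> (t, x) = \<rho> (t + x - 1, 1) + (LINT s|lebesgue_on {t + x - 1..t}. - H (s, x + t - s)))" for t x
  define rule_\<xi> where "rule_\<xi> t x \<longleftrightarrow>
     (x > t \<longrightarrow> \<xi> (t, x) = \<xi>\<^sub>0 (x - t) + (LINT s|lebesgue_on {0..t}. H (s, x - t + s))) \<and>
     (x < t \<longrightarrow> \<xi> (t, x) = \<xi> (t - x, 0) + (LINT s|lebesgue_on {t - x..t}. H (s, x - t + s)))" for t x
  have rect: "({0<..<T} \<times> {0<..<1} :: (real \<times> real) set) \<in> sets borel" for T by (simp flip: borel_prod)
  have rules: "AE q in lborel. q \<in> {0<..<T} \<times> {0<..<1} \<longrightarrow> rule_\<rho> (fst q) (snd q) \<and> rule_\<xi> (fst q) (snd q)"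
    if T: "0 < T" for T
  proof -
    have on: "broad_solution_on p T a b \<rho>\<^sub>0 \<xi>\<^sub>0 \<rho> \<xi>" using sol T by (simp add: broad_solution_def)
    have FG: "(\<lambda>z. - ((1 / 2) * a z + b z) * (\<rho> z - \<xi> z)) = (\<lambda>z. - H z)" "(\<lambda>z. ((1 / 2) * a z + b z) * (\<rho> z - \<xi> z)) = H"
      by (simp_all only: H_def[abs_def] mult_minus_left)
    have "AE (t, x) in lebesgue_on ({0<..<T} \<times> {0<..<1}). rule_\<rho> t x \<and> rule_\<xi> t x"
      using on[unfolded broad_solution_on_def, unfolded FG, unfolded Let_def] by (simp only: rule_\<rho>_def rule_\<xi>_def conj_assoc)
    then show ?thesis
      unfolding AE_lebesgue_on_iff[OF rect] by (rule eventually_mono) (simp add: split_beta')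
  qed
  have tr: "integrable (lebesgue_on {0<..<T}) (\<lambda>t. \<rho> (t, x))" "integrable (lebesgue_on {0<..<T}) (\<lambda>t. \<xi> (t, x))" if "0 < T" "0 \<le> x" "x \<le> 1" for T x
    using sp[OF that(1)] that by (auto simp: broad_space_def intro!: integral_abs_le_Lp_norm2(1)[OF p])
  interpret X: transport \<xi> H \<xi>1 S.G \<xi>\<^sub>0 \<xi>0 \<beta>0 \<beta>1
  proof
    show "AE t in lborel. 0 < t \<longrightarrow> \<xi> (t, 0) = \<beta>0 t" using \<beta>0_eq by simp
    show "AE t in lborel. 0 < t \<longrightarrow> \<xi> (t, 1) = \<beta>1 t" using \<beta>1_eq bc by eventually_elim auto
    show "AE (t, x) in lebesgue_on ({0<..<T} \<times> {0<..<1}).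
       (x > t \<longrightarrow> \<xi> (t, x) = \<xi>\<^sub>0 (x - t) + (LINT s|lebesgue_on {0..t}. H (s, x - t + s))) \<and>
       (x < t \<longrightarrow> \<xi> (t, x) = \<xi> (t - x, 0) + (LINT s|lebesgue_on {t - x..t}. H (s, x - t + s)))" if T: "0 < T" for T
      unfolding AE_lebesgue_on_iff[OF rect] rule_\<xi>_def[symmetric]
      using rules[OF T] by (rule eventually_mono) (simp add: split_beta')
    show "((\<lambda>x. LINT t|lebesgue_on {0<..<T}. \<bar>\<xi> (t, x) - \<xi> (t, 1)\<bar>) \<longlongrightarrow> 0) (at 1 within {0..1})" if "0 < T" for T
      by (rule trace_continuous_L1(2)[OF p that sp[OF that]]) simp
    show "q \<notin> strip \<Longrightarrow> S.G q = 0" for q by (simp add: S.G_def)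
  qed (use \<xi>1_eq H_eq \<xi>0_eq S.G_integrable tr in auto)
  have mir: "(\<lambda>q :: real \<times> real. (fst q, 1 - snd q)) \<in> borel \<rightarrow>\<^sub>M borel"
    by (intro borel_measurable_continuous_onI continuous_intros)
  have mir_G [measurable]: "(\<lambda>q. S.G (fst q, 1 - snd q)) \<in> borel_measurable borel"
    and mir_\<rho> [measurable]: "(\<lambda>q. \<rho>1 (fst q, 1 - snd q)) \<in> borel_measurable borel"
    using measurable_compose[OF mir S.G_measurable] measurable_compose[OF mir \<rho>1] by simp_all
  (* the reflection \<open>x \<mapsto> 1 - x\<close> makes \<open>\<rho>\<close> move to the
     right, with inflow trace \<open>\<beta>1\<close> and outflow trace \<open>\<beta>0\<close> *)
  interpret Y: transport "\<lambda>q. \<rho> (fst q, 1 - snd q)" "\<lambda>q. - H (fst q, 1 - snd q)" "\<lambda>q. \<rho>1 (fst q, 1 - snd q)"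
    "\<lambda>q. - S.G (fst q, 1 - snd q)" "\<lambda>x. \<rho>\<^sub>0 (1 - x)" "\<lambda>x. \<rho>0 (1 - x)" \<beta>1 \<beta>0
  proof
    have st: "(fst q, 1 - snd q) \<in> strip \<longleftrightarrow> q \<in> strip" for q by (auto simp: strip_def mem_Times_iff)
    show "AE q in lborel. q \<in> strip \<longrightarrow> \<rho> (fst q, 1 - snd q) = \<rho>1 (fst q, 1 - snd q)"
      using AE_plane_mirror[OF \<rho>1_eq] by (simp add: st)
    show "AE q in lborel. q \<in> strip \<longrightarrow> - H (fst q, 1 - snd q) = - S.G (fst q, 1 - snd q)"
      using AE_plane_mirror[OF H_eq] by (simp add: st)
    show "q \<notin> strip \<Longrightarrow> - S.G (fst q, 1 - snd q) = 0" for q by (simp add: S.G_def st)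
    show "AE x in lborel. x \<in> {0<..<1} \<longrightarrow> \<rho>\<^sub>0 (1 - x) = \<rho>0 (1 - x)"
      using AE_reflect[OF \<rho>0_eq, of 1] by eventually_elim auto
    show "AE t in lborel. 0 < t \<longrightarrow> \<rho> (fst (t, 0::real), 1 - snd (t, 0::real)) = \<beta>1 t" using \<beta>1_eq by simp
    show "AE t in lborel. 0 < t \<longrightarrow> \<rho> (fst (t, 1::real), 1 - snd (t, 1::real)) = \<beta>0 t" using \<beta>0_eq bc by eventually_elim auto
    show "AE (t, x) in lebesgue_on ({0<..<T} \<times> {0<..<1}).
       (x > t \<longrightarrow> \<rho> (fst (t, x), 1 - snd (t, x)) = \<rho>\<^sub>0 (1 - (x - t)) + (LINT s|lebesgue_on {0..t}. - H (fst (s, x - t + s), 1 - snd (s, x - t + s)))) \<and>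
       (x < t \<longrightarrow> \<rho> (fst (t, x), 1 - snd (t, x)) = \<rho> (fst (t - x, 0::real), 1 - snd (t - x, 0::real)) + (LINT s|lebesgue_on {t - x..t}. - H (fst (s, x - t + s), 1 - snd (s, x - t + s))))" if T: "0 < T" for T
      unfolding AE_lebesgue_on_iff[OF rect] using AE_plane_mirror[OF rules[OF T]]
    proof (rule eventually_mono, clarify)
      fix t x
      assume "(fst (t, x), 1 - snd (t, x)) \<in> {0<..<T} \<times> {0<..<1} \<longrightarrow>
          rule_\<rho> (fst (fst (t, x), 1 - snd (t, x))) (snd (fst (t, x), 1 - snd (t, x))) \<and>
          rule_\<xi> (fst (fst (t, x), 1 - snd (t, x))) (snd (fst (t, x), 1 - snd (t, x)))"
        and "t \<in> {0<..<T}" "x \<in> {0<..<1}"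
      then have r: "rule_\<rho> t (1 - x)" by simp
      have s1: "1 - x + t - s = 1 - (x - t + s)" for s by simp
      have s2: "1 - x + t = 1 - (x - t)" "t + (1 - x) - 1 = t - x" by simp_all
      show "(x > t \<longrightarrow> \<rho> (fst (t, x), 1 - snd (t, x)) = \<rho>\<^sub>0 (1 - (x - t)) + (LINT s|lebesgue_on {0..t}. - H (fst (s, x - t + s), 1 - snd (s, x - t + s)))) \<and>
       (x < t \<longrightarrow> \<rho> (fst (t, x), 1 - snd (t, x)) = \<rho> (fst (t - x, 0::real), 1 - snd (t - x, 0::real)) + (LINT s|lebesgue_on {t - x..t}. - H (fst (s, x - t + s), 1 - snd (s, x - t + s))))"
        using r[unfolded rule_\<rho>_def, unfolded s1, unfolded s2] by simp
    qed
    show "set_integrable lborel ({0<..<T} \<times> UNIV) (\<lambda>q. - S.G (fst q, 1 - snd q))" if T: "0 < T" for T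
      unfolding set_integrable_def
    proof (rule integrableI_bounded)
      have m [measurable]: "({0<..<T} \<times> UNIV :: (real \<times> real) set) \<in> sets borel" by (simp flip: borel_prod)
      show "(\<lambda>q. indicator ({0<..<T} \<times> UNIV) q *\<^sub>R - S.G (fst q, 1 - snd q)) \<in> borel_measurable lborel" by measurable
      have "(\<integral>\<^sup>+q. ennreal (norm (indicator ({0<..<T} \<times> UNIV) q *\<^sub>R - S.G (fst q, 1 - snd q))) \<partial>(lborel \<Otimes>\<^sub>M lborel))
         = (\<integral>\<^sup>+(s, x). ennreal (indicator {0<..<T} s * \<bar>S.G (s, 1 - x)\<bar>) \<partial>(lborel \<Otimes>\<^sub>M lborel))"
        by (intro nn_integral_cong) (auto simp: indicator_def)
      also have "\<dots> = (\<integral>\<^sup>+s. \<integral>\<^sup>+x. ennreal (indicator {0<..<T} s * \<bar>S.G (s, 1 - x)\<bar>) \<partial>lborel \<partial>lborel)"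
        by (subst lborel.nn_integral_fst[symmetric]) auto
      also have "\<dots> = (\<integral>\<^sup>+s. \<integral>\<^sup>+x. ennreal (indicator {0<..<T} s * \<bar>S.G (s, x)\<bar>) \<partial>lborel \<partial>lborel)"
        by (intro nn_integral_cong nn_integral_reflect) measurable
      also have "\<dots> = (\<integral>\<^sup>+(s, x). ennreal (indicator {0<..<T} s * \<bar>S.G (s, x)\<bar>) \<partial>(lborel \<Otimes>\<^sub>M lborel))"
        by (subst lborel.nn_integral_fst[symmetric]) auto
      also have "\<dots> = (\<integral>\<^sup>+q. ennreal (norm (indicator ({0<..<T} \<times> UNIV) q *\<^sub>R S.G q)) \<partial>(lborel \<Otimes>\<^sub>M lborel))"
        by (intro nn_integral_cong) (auto simp: indicator_def)
      also have "\<dots> < \<infinity>" using S.G_integrable[OF T] by (simp add: set_integrable_def integrable_iff_bounded lborel_prod)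
      finally show "(\<integral>\<^sup>+q. ennreal (norm (indicator ({0<..<T} \<times> UNIV) q *\<^sub>R - S.G (fst q, 1 - snd q))) \<partial>lborel) < \<infinity>"
        by (simp only: lborel_prod)
    qed
    show "integrable (lebesgue_on {0<..<T}) (\<lambda>t. \<rho> (fst (t, x), 1 - snd (t, x)))" if "0 < T" "0 \<le> x" "x \<le> 1" for T x
      using tr(1)[OF that(1), of "1 - x"] that by simp
    show "((\<lambda>x. LINT t|lebesgue_on {0<..<T}. \<bar>\<rho> (fst (t, x), 1 - snd (t, x)) - \<rho> (fst (t, 1::real), 1 - snd (t, 1::real))\<bar>) \<longlongrightarrow> 0) (at 1 within {0..1})" if T: "0 < T" for T
    proof -
      have f: "filterlim (\<lambda>x :: real. 1 - x) (at 0 within {0..1}) (at 1 within {0..1})"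
        unfolding filterlim_at by (auto simp: eventually_at_filter intro!: tendsto_eq_intros)
      have "((\<lambda>y. LINT t|lebesgue_on {0<..<T}. \<bar>\<rho> (t, y) - \<rho> (t, 0)\<bar>) \<longlongrightarrow> 0) (at 0 within {0..1})"
        by (rule trace_continuous_L1(1)[OF p T sp[OF T]]) simp
      from filterlim_compose[OF this f] show ?thesis by simp
    qed
    show "(\<lambda>q. \<rho>1 (fst q, 1 - snd q)) \<in> borel_measurable borel" "(\<lambda>q. - S.G (fst q, 1 - snd q)) \<in> borel_measurable borel"
      by measurable
  qed auto
  have eX: "X.entry z = S.entry_\<xi> z" for z by (simp add: X.entry_def S.entry_\<xi>_def)
  have eY: "Y.entry z = S.entry_\<rho> z" for z by (simp add: Y.entry_def S.entry_\<rho>_def)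
  interpret V: unfolded_solution p M \<alpha> ca cb \<rho>1 \<xi>1 \<rho>0 \<xi>0 \<beta>0 \<beta>1
  proof
    show "AE q in lborel. q \<in> strip \<longrightarrow> \<xi>1 q = S.entry_\<xi> (snd q - fst q) + (LINT s:{0..fst q}|lborel. S.G (s, snd q - fst q + s))"
      using X.f'_eq_along by (simp add: X.along_def eX)
    show "AE t in lborel. 0 < t \<longrightarrow> \<beta>1 t = S.entry_\<xi> (1 - t) + (LINT s:{0..t}|lborel. S.G (s, 1 - t + s))"
      using X.outflow_eq_along by (simp add: X.along_def eX)
    have s: "1 - (1 - (snd q + fst q) + s) = snd q + fst q - s" "1 - snd q - fst q = 1 - (snd q + fst q)" for q :: "real \<times> real" and s by simp_all
    have s2: "1 - (1 - snd q) = snd q" for q :: "real \<times> real" by simp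
    have st: "(fst q, 1 - snd q) \<in> strip \<longleftrightarrow> q \<in> strip" for q by (auto simp: strip_def mem_Times_iff)
    show "AE q in lborel. q \<in> strip \<longrightarrow> \<rho>1 q = S.entry_\<rho> (1 - (snd q + fst q)) + (LINT s:{0..fst q}|lborel. - S.G (s, snd q + fst q - s))"
      using AE_plane_mirror[OF Y.f'_eq_along] unfolding Y.along_def eY fst_conv snd_conv st s s2 prod.collapse .
    have s': "1 - (1 - t + s) = t - s" for t s :: real by simp
    show "AE t in lborel. 0 < t \<longrightarrow> \<beta>0 t = S.entry_\<rho> (1 - t) + (LINT s:{0..t}|lborel. - S.G (s, t - s))"
      using Y.outflow_eq_along unfolding Y.along_def eY fst_conv snd_conv s' .
  qed
  interpret E: exchange_evolution p M \<alpha> S.v S.u S.ka S.kb by (rule V.exchange_evolution)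
  show thesis
  proof (rule that)
    show "exchange_evolution p M \<alpha> S.v S.u S.ka S.kb" by (rule V.exchange_evolution)
    have "AE q in lborel. q \<in> {0<..} \<times> W \<longrightarrow> 2 * \<mu> \<le> a q"
      using a_window W by (subst (asm) AE_lebesgue_on_iff) (auto simp flip: borel_prod)
    then have "AE q in lborel. 0 < fst q \<and> snd q \<in> W \<longrightarrow> \<mu> \<le> ca q"
      using ca_eq by eventually_elim (use W in \<open>auto simp: strip_def mem_Times_iff\<close>)
    then show "\<forall>c\<ge>0. AE (s, z) in spacetime c (c + 2). wrap (z + s) \<in> W \<longrightarrow> \<mu> \<le> S.ka s z"
      by (intro allI impI S.ka_window[OF W(2,1)])
    have "AE x in lborel. x \<in> {0<..<1} \<longrightarrow> \<rho>\<^sub>0 x + \<xi>\<^sub>0 x = \<xi>0 x + \<rho>0 x" using \<rho>0_eq \<xi>0_eq by eventually_elim auto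
    from lebesgue_on_integral_borel[OF I01 _ this] show "(\<integral>z. S.v 0 z \<partial>circle) = 0"
      using mean by (simp add: V.mean_0)
    show "E.energy 0 = Lp_mass p {0<..<1} \<rho>\<^sub>0 \<xi>\<^sub>0"
      unfolding E.energy_def V.energy_0 by (rule Lp_mass_borel_version(2)[OF I01 init \<rho>0 \<xi>0 \<rho>0_eq \<xi>0_eq])
    show "AE t in lborel. 0 < t \<longrightarrow> E.energy t = Lp_mass p {0<..<1} (\<lambda>x. \<rho> (t, x)) (\<lambda>x. \<xi> (t, x))"
      using V.nn_integral_v_powr mass
    proof eventually_elim
      case (elim t)
      show ?case
      proof
        assume t: "0 < t"
        have "ennreal (E.energy t) = (\<integral>\<^sup>+z. ennreal (\<bar>S.v t z\<bar> powr p) \<partial>circle)"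
          unfolding E.energy_def using E.energy_integrable[of t] t by (intro nn_integral_eq_integral[symmetric]) auto
        also have "\<dots> = ennreal (Lp_mass p {0<..<1} (\<lambda>x. \<rho> (t, x)) (\<lambda>x. \<xi> (t, x)))" using elim t by simp
        finally show "E.energy t = Lp_mass p {0<..<1} (\<lambda>x. \<rho> (t, x)) (\<lambda>x. \<xi> (t, x))"
          using E.energy_nonneg Lp_mass_nonneg by (subst (asm) ennreal_inj) auto
      qed
    qed
  qed
qed

text \<open>
  The energy of the unfolded solution decays exponentially, and it is the mass of the time slice
  for almost every time. At an arbitrary time, the mass is compared with the masses at nearby
  later times by continuity and the triangle inequality up to the factor \<open>2\<^sup>p\<close>;
  this factor enters \<open>C\<close>.
\<close>

theorem theorem4p1:
  fixes p \<epsilon>\<^sub>0 lam A :: real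
  assumes "1 < p" and "0 < \<epsilon>\<^sub>0" and "0 < lam"
  shows "\<exists>\<alpha>>0. \<exists>C>0. \<exists>\<gamma>>0.
    \<forall>(a :: real \<times> real \<Rightarrow> real) (b :: real \<times> real \<Rightarrow> real) x\<^sub>0.
      Linf_mem strip a \<and> Linf_norm strip a = A \<and> Linf_mem strip b \<and>
      x\<^sub>0 \<in> {0<..<1} \<and> {x\<^sub>0 - \<epsilon>\<^sub>0<..<x\<^sub>0 + \<epsilon>\<^sub>0} \<subseteq> {0<..<1} \<and>
      (AE z in lebesgue_on strip. 0 \<le> a z) \<and>
      (AE z in lebesgue_on ({0<..} \<times> {x\<^sub>0 - \<epsilon>\<^sub>0<..<x\<^sub>0 + \<epsilon>\<^sub>0}). lam \<le> a z) \<and>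
      Linf_norm strip b \<le> \<alpha> \<longrightarrow>
      (\<forall>\<rho>\<^sub>0 \<xi>\<^sub>0 \<rho> \<xi>.
         Lp_mem p {0<..<1} \<rho>\<^sub>0 \<and> Lp_mem p {0<..<1} \<xi>\<^sub>0 \<and>
         (LINT x|lebesgue_on {0<..<1}. \<rho>\<^sub>0 x + \<xi>\<^sub>0 x) = 0 \<and>
         broad_solution p a b \<rho>\<^sub>0 \<xi>\<^sub>0 \<rho> \<xi> \<longrightarrow>
         (\<forall>t\<ge>0. Lp_norm2 p {0<..<1} (\<lambda>x. \<rho> (t, x)) (\<lambda>x. \<xi> (t, x))
                  \<le> C * exp (- \<gamma> * t) * Lp_norm2 p {0<..<1} \<rho>\<^sub>0 \<xi>\<^sub>0))"
proof -
  note p = assms(1)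
  define M where "M = \<bar>A\<bar> / 2"
  define \<mu> where "\<mu> = lam / 2"
  have M: "0 \<le> M" and \<mu>: "0 < \<mu>" using assms by (simp_all add: M_def \<mu>_def)
  obtain \<alpha> \<delta> where \<alpha>: "0 < \<alpha>" and \<delta>: "0 < \<delta>" "\<delta> < 1"
    and contraction: "\<And>v u ka kb x a. exchange_evolution p M \<alpha> v u ka kb \<Longrightarrow> {x - \<epsilon>\<^sub>0<..<x + \<epsilon>\<^sub>0} \<subseteq> {0..<2} \<Longrightarrow> 0 \<le> a \<Longrightarrow>
      (AE (s, z) in spacetime a (a + 2). wrap (z + s) \<in> {x - \<epsilon>\<^sub>0<..<x + \<epsilon>\<^sub>0} \<longrightarrow> \<mu> \<le> ka s z) \<Longrightarrow>
      (\<integral>z. v 0 z \<partial>circle) = 0 \<Longrightarrow>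
      exchange_evolution.energy p v (a + 2) \<le> (1 - \<delta>) * exchange_evolution.energy p v a \<and>
      (\<forall>t\<in>{a..a + 2}. exchange_evolution.energy p v t \<le> 2 * exchange_evolution.energy p v a)"
    using exchange_contraction[OF p M \<mu> assms(2)] by blast
  obtain K \<kappa> where K: "0 < K" and \<kappa>: "0 < \<kappa>" and decay:
    "\<And>E t. (\<And>t. 0 \<le> E t) \<Longrightarrow> (\<And>a. 0 \<le> a \<Longrightarrow> E (a + 2) \<le> (1 - \<delta>) * E a) \<Longrightarrow>
       (\<And>a t. 0 \<le> a \<Longrightarrow> t \<in> {a..a + 2} \<Longrightarrow> E t \<le> 2 * E a) \<Longrightarrow> 0 \<le> t \<Longrightarrow> E t \<le> K * exp (- \<kappa> * t) * (E 0 :: real)"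
    using exponential_from_contraction[OF \<delta>] by blast
  define C where "C = (2 powr p * K) powr (1 / p)"
  define \<gamma> where "\<gamma> = \<kappa> / p"
  have C: "0 < C" using K by (simp add: C_def)
  have \<gamma>: "0 < \<gamma>" using \<kappa> p by (simp add: \<gamma>_def)
  show ?thesis
  proof (rule exI[of _ \<alpha>], rule conjI[OF \<alpha>], rule exI[of _ C], rule conjI[OF C], rule exI[of _ \<gamma>], rule conjI[OF \<gamma>], intro allI impI)
    fix a b :: "real \<times> real \<Rightarrow> real" and x\<^sub>0 and \<rho>\<^sub>0 \<xi>\<^sub>0 :: "real \<Rightarrow> real" and \<rho> \<xi> :: "real \<times> real \<Rightarrow> real" and t :: real
    assume coeff: "Linf_mem strip a \<and> Linf_norm strip a = A \<and> Linf_mem strip b \<and>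
      x\<^sub>0 \<in> {0<..<1} \<and> {x\<^sub>0 - \<epsilon>\<^sub>0<..<x\<^sub>0 + \<epsilon>\<^sub>0} \<subseteq> {0<..<1} \<and>
      (AE z in lebesgue_on strip. 0 \<le> a z) \<and>
      (AE z in lebesgue_on ({0<..} \<times> {x\<^sub>0 - \<epsilon>\<^sub>0<..<x\<^sub>0 + \<epsilon>\<^sub>0}). lam \<le> a z) \<and>
      Linf_norm strip b \<le> \<alpha>"
      and sol: "Lp_mem p {0<..<1} \<rho>\<^sub>0 \<and> Lp_mem p {0<..<1} \<xi>\<^sub>0 \<and>
         (LINT x|lebesgue_on {0<..<1}. \<rho>\<^sub>0 x + \<xi>\<^sub>0 x) = 0 \<and> broad_solution p a b \<rho>\<^sub>0 \<xi>\<^sub>0 \<rho> \<xi>"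
      and t: "0 \<le> t"
    let ?W = "{x\<^sub>0 - \<epsilon>\<^sub>0<..<x\<^sub>0 + \<epsilon>\<^sub>0}"
    define N where "N s = Lp_mass p {0<..<1} (\<lambda>x. \<rho> (s, x)) (\<lambda>x. \<xi> (s, x))" for s
    define N0 where "N0 = Lp_mass p {0<..<1} \<rho>\<^sub>0 \<xi>\<^sub>0"
    have M': "Linf_norm strip a / 2 \<le> M" and win': "AE z in lebesgue_on ({0<..} \<times> ?W). 2 * \<mu> \<le> a z"
      using coeff by (auto simp: M_def \<mu>_def)
    have c: "Linf_mem strip a" "Linf_mem strip b" "Linf_norm strip b \<le> \<alpha>" "AE z in lebesgue_on strip. 0 \<le> a z" "?W \<subseteq> {0<..<1}"
      and i: "Lp_mem p {0<..<1} \<rho>\<^sub>0" "Lp_mem p {0<..<1} \<xi>\<^sub>0" "(LINT x|lebesgue_on {0<..<1}. \<rho>\<^sub>0 x + \<xi>\<^sub>0 x) = 0"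
      and bs: "broad_solution p a b \<rho>\<^sub>0 \<xi>\<^sub>0 \<rho> \<xi>"
      using coeff sol by blast+
    have Wb: "?W \<in> sets borel" by simp
    obtain v u ka kb where ev: "exchange_evolution p M \<alpha> v u ka kb"
      and win: "\<forall>c\<ge>0. AE (s, z) in spacetime c (c + 2). wrap (z + s) \<in> ?W \<longrightarrow> \<mu> \<le> ka s z"
      and mean: "(\<integral>z. v 0 z \<partial>circle) = 0"
      and e0: "exchange_evolution.energy p v 0 = Lp_mass p {0<..<1} \<rho>\<^sub>0 \<xi>\<^sub>0"
      and et: "AE t in lborel. 0 < t \<longrightarrow> exchange_evolution.energy p v t = Lp_mass p {0<..<1} (\<lambda>x. \<rho> (t, x)) (\<lambda>x. \<xi> (t, x))"
      by (rule broad_solution_unfolds[OF p c(1,2) M M' less_imp_le[OF \<alpha>] c(3,4) Wb c(5) win' i(1,2,3) bs])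
    note e0 = e0[folded N0_def] and et = et[folded N_def]
    interpret exchange_evolution p M \<alpha> v u ka kb by (rule ev)
    have W2: "?W \<subseteq> {0..<2}"
    proof
      fix y assume "y \<in> ?W"
      then have "y \<in> {0<..<1}" using coeff by blast
      then show "y \<in> {0..<2}" by simp
    qed
    note con = contraction[OF ev W2 _ win[rule_format] mean]
    have E: "energy s \<le> K * exp (- \<kappa> * s) * N0" if "0 \<le> s" for s
      unfolding e0[symmetric]
      by (rule decay) (use con that in \<open>auto simp: energy_nonneg\<close>)
    have "broad_space p (t + 1) \<rho> \<xi>"
      using sol t unfolding broad_solution_def broad_solution_on_def by auto
    then have mem: "Lp_mem p {0<..<1} (\<lambda>x. \<rho> (s, x))" "Lp_mem p {0<..<1} (\<lambda>x. \<xi> (s, x))"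
      and cont: "((\<lambda>s. Lp_norm2 p {0<..<1} (\<lambda>x. \<rho> (s, x) - \<rho> (t, x)) (\<lambda>x. \<xi> (s, x) - \<xi> (t, x))) \<longlongrightarrow> 0) (at t within {0..t + 1})"
      if "s \<in> {0..t + 1}" for s
      using that t unfolding broad_space_def by auto
    define D where "D s = Lp_norm2 p {0<..<1} (\<lambda>x. \<rho> (s, x) - \<rho> (t, x)) (\<lambda>x. \<xi> (s, x) - \<xi> (t, x))" for s
    have le: "N t \<le> 2 powr p * (e + K * exp (- \<kappa> * t) * N0)" if e: "0 < e" for e
    proof -
      have "\<forall>\<^sub>F s in at t within {0..t + 1}. D s < e powr (1 / p)"
        using cont[of t] t e unfolding D_def by (intro order_tendstoD) auto
      then obtain d where d: "0 < d" "\<And>s. s \<in> {0..t + 1} \<Longrightarrow> s \<noteq> t \<Longrightarrow> dist s t < d \<Longrightarrow> D s < e powr (1 / p)"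
        unfolding eventually_at by blast
      obtain s where s: "t < s" "s < t + min 1 d" "energy s = N s"
        using AE_lborel_ex_in_interval[OF et, of t "t + min 1 d"] d(1) t by auto
      have "D s < e powr (1 / p)" using s t by (intro d) (auto simp: dist_real_def)
      then have "D s powr p \<le> (e powr (1 / p)) powr p" using p by (intro powr_mono2) (auto simp: D_def Lp_norm2_eq)
      then have De: "D s powr p \<le> e" using p e by (simp add: powr_powr)
      have "N t \<le> 2 powr p * (D s powr p + N s)"
        using Lp_mass_le_diff[of p "{0<..<1}" "\<lambda>x. \<rho> (s, x)" "\<lambda>x. \<rho> (t, x)" "\<lambda>x. \<xi> (s, x)" "\<lambda>x. \<xi> (t, x)"] mem[of s] mem[of t] s t p
        by (simp add: N_def D_def Lp_mass_eq)
      also have "\<dots> \<le> 2 powr p * (e + K * exp (- \<kappa> * t) * N0)"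
      proof (intro mult_left_mono add_mono De)
        have "N s \<le> K * exp (- \<kappa> * s) * N0" using E[of s] s t by simp
        also have "\<dots> \<le> K * exp (- \<kappa> * t) * N0"
          using K \<kappa> s by (intro mult_right_mono mult_left_mono) (auto simp: N0_def Lp_mass_nonneg)
        finally show "N s \<le> K * exp (- \<kappa> * t) * N0" .
      qed simp
      finally show ?thesis .
    qed
    have "N t \<le> 2 powr p * (K * exp (- \<kappa> * t) * N0)"
    proof (rule field_le_epsilon)
      fix e :: real assume "0 < e"
      then show "N t \<le> 2 powr p * (K * exp (- \<kappa> * t) * N0) + e"
        using le[of "e / 2 powr p"] by (simp add: distrib_left add.commute)
    qed
    also have "\<dots> = (2 powr p * K) * exp (- \<gamma> * t) powr p * N0"
      using p by (simp add: \<gamma>_def exp_powr_real)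
    finally have "N t powr (1 / p) \<le> ((2 powr p * K) * exp (- \<gamma> * t) powr p * N0) powr (1 / p)"
      using p by (intro powr_mono2) (auto simp: N_def Lp_mass_nonneg)
    also have "\<dots> = C * exp (- \<gamma> * t) * N0 powr (1 / p)"
      using p K by (simp add: C_def powr_mult powr_powr N0_def Lp_mass_nonneg)
    finally show "Lp_norm2 p {0<..<1} (\<lambda>x. \<rho> (t, x)) (\<lambda>x. \<xi> (t, x)) \<le> C * exp (- \<gamma> * t) * Lp_norm2 p {0<..<1} \<rho>\<^sub>0 \<xi>\<^sub>0"
      by (simp add: N_def N0_def Lp_norm2_eq)
  qed
qed

end
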